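(* Let $T$ be a nice t-minimal theory, $\mathbb{M}$ a monster model, $G$ a definable group and $H\le G$ a definable subgroup. Then the inclusion $H\to G$ is a closed embedding with respect to the canonical topologies on $H$ and $G$.
   Context: A complete one-sorted theory $T$ is t-minimal if there is a Hausdorff topology on models $M$ of $T$ (on $M^1$) with a basis given by a definable family, such that every definable $D\subseteq M$ has non-empty interior iff $D$ is infinite. "Definable" means definable with parameters; $\mathbb{M}^n$ has the product topology. $\dim(X)$ for definable $X\subseteq\mathbb{M}^n$ is $-\infty$ if $X=\emptyset$ and otherwise the largest $k$ such that some coordinate projection of $X$ to $\mathbb{M}^k$ has non-empty interior. A $k$-correspondence $f:X\rightrightarrows Y$ assigns a $k$-element subset of $Y$ to each $x\in X$; it is continuous if locally $f(x)=\{g_1(x),\dots,g_k(x)\}$ with continuous $g_i$. $T$ is nice if every definable $k$-correspondence $f:U\rightrightarrows\mathbb{M}^m$ on a definable open $U\subseteq\mathbb{M}^n$ is continuous on a definable open $U_0\subseteq U$ with $\dim(U\setminus U_0)<n$. A cell is $\sigma(\Gamma(f))$ for $f:U\rightrightarrows\mathbb{M}^{n-i}$ a continuous definable correspondence on a definable open $U\subseteq\mathbb{M}^i$ and $\sigma$ a coordinate permutation. A definable manifold is a definable set with a topology having a definable basis, covered by finitely many definable open subsets each definably homeomorphic to an open subset of a cell. The canonical topology on a definable group $G$ is the unique definable topology making $G$ a definable manifold and a topological group. *)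

theory Defs
  imports "HOL-Analysis.Analysis" "HOL-Algebra.Group"
begin

unbundle cardinal_syntax

section \<open>First-order logic\<close>

text \<open>
  A language is given by its function and predicate symbols together with their arities; a symbol
  name used with two arities counts as two symbols.  Constants are function symbols of arity 0.
\<close>

record ('f, 'p) language =
  fsyms :: "('f \<times> nat) set"
  psyms :: "('p \<times> nat) set"

datatype 'f tm = Var nat | Fn 'f "'f tm list"

datatype ('f, 'p) fm =
    Falsum
  | Equal "'f tm" "'f tm"
  | Pred 'p "'f tm list"
  | Imp "('f, 'p) fm" "('f, 'p) fm"
  | All nat "('f, 'p) fm"

abbreviation Neg :: "('f, 'p) fm \<Rightarrow> ('f, 'p) fm" where
  "Neg \<phi> \<equiv> Imp \<phi> Falsum"

fun wf_tm :: "('f, 'p) language \<Rightarrow> 'f tm \<Rightarrow> bool" where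
  "wf_tm L (Var i) \<longleftrightarrow> True"
| "wf_tm L (Fn f ts) \<longleftrightarrow> (f, length ts) \<in> fsyms L \<and> (\<forall>t\<in>set ts. wf_tm L t)"

fun wf_fm :: "('f, 'p) language \<Rightarrow> ('f, 'p) fm \<Rightarrow> bool" where
  "wf_fm L Falsum \<longleftrightarrow> True"
| "wf_fm L (Equal t u) \<longleftrightarrow> wf_tm L t \<and> wf_tm L u"
| "wf_fm L (Pred p ts) \<longleftrightarrow> (p, length ts) \<in> psyms L \<and> (\<forall>t\<in>set ts. wf_tm L t)"
| "wf_fm L (Imp \<phi> \<psi>) \<longleftrightarrow> wf_fm L \<phi> \<and> wf_fm L \<psi>"
| "wf_fm L (All i \<phi>) \<longleftrightarrow> wf_fm L \<phi>"

fun fv_tm :: "'f tm \<Rightarrow> nat set" where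
  "fv_tm (Var i) = {i}"
| "fv_tm (Fn f ts) = (\<Union>t\<in>set ts. fv_tm t)"

fun fv :: "('f, 'p) fm \<Rightarrow> nat set" where
  "fv Falsum = {}"
| "fv (Equal t u) = fv_tm t \<union> fv_tm u"
| "fv (Pred p ts) = (\<Union>t\<in>set ts. fv_tm t)"
| "fv (Imp \<phi> \<psi>) = fv \<phi> \<union> fv \<psi>"
| "fv (All i \<phi>) = fv \<phi> - {i}"

definition sentences :: "('f, 'p) language \<Rightarrow> ('f, 'p) fm set" where
  "sentences L = {\<phi>. wf_fm L \<phi> \<and> fv \<phi> = {}}"

record ('f, 'p, 'm) fo_struct =
  univ :: "'m set"
  fint :: "'f \<Rightarrow> 'm list \<Rightarrow> 'm"
  pint :: "'p \<Rightarrow> 'm list \<Rightarrow> bool"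

definition is_struct :: "('f, 'p) language \<Rightarrow> ('f, 'p, 'm) fo_struct \<Rightarrow> bool" where
  "is_struct L M \<longleftrightarrow> univ M \<noteq> {} \<and>
     (\<forall>(f, n)\<in>fsyms L. \<forall>xs\<in>lists (univ M). length xs = n \<longrightarrow> fint M f xs \<in> univ M)"

fun tval :: "('f, 'p, 'm) fo_struct \<Rightarrow> (nat \<Rightarrow> 'm) \<Rightarrow> 'f tm \<Rightarrow> 'm" where
  "tval M s (Var i) = s i"
| "tval M s (Fn f ts) = fint M f (map (tval M s) ts)"

fun sat :: "('f, 'p, 'm) fo_struct \<Rightarrow> (nat \<Rightarrow> 'm) \<Rightarrow> ('f, 'p) fm \<Rightarrow> bool" where
  "sat M s Falsum \<longleftrightarrow> False"
| "sat M s (Equal t u) \<longleftrightarrow> tval M s t = tval M s u"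
| "sat M s (Pred p ts) \<longleftrightarrow> pint M p (map (tval M s) ts)"
| "sat M s (Imp \<phi> \<psi>) \<longleftrightarrow> (sat M s \<phi> \<longrightarrow> sat M s \<psi>)"
| "sat M s (All i \<phi>) \<longleftrightarrow> (\<forall>a\<in>univ M. sat M (s(i := a)) \<phi>)"

definition holds :: "('f, 'p, 'm) fo_struct \<Rightarrow> ('f, 'p) fm \<Rightarrow> bool" where
  "holds M \<phi> \<longleftrightarrow> (\<forall>s. range s \<subseteq> univ M \<longrightarrow> sat M s \<phi>)"

definition is_model ::
  "('f, 'p) language \<Rightarrow> ('f, 'p) fm set \<Rightarrow> ('f, 'p, 'm) fo_struct \<Rightarrow> bool" where
  "is_model L T M \<longleftrightarrow> is_struct L M \<and> (\<forall>\<phi>\<in>T. holds M \<phi>)"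

text \<open>
  HOL cannot quantify over all types inside a formula, so ``all models'' means all models whose
  universe is a subset of a given type \<open>'m\<close>.  By Loewenheim-Skolem this does not affect
  the consequence relation once \<open>'m\<close> is at least as large as the set of formulas, which is
  the case when \<open>'m\<close> carries a monster model.
\<close>

definition entails ::
  "'m itself \<Rightarrow> ('f, 'p) language \<Rightarrow> ('f, 'p) fm set \<Rightarrow> ('f, 'p) fm \<Rightarrow> bool" where
  "entails _ L T \<phi> \<longleftrightarrow> (\<forall>M::('f, 'p, 'm) fo_struct. is_model L T M \<longrightarrow> holds M \<phi>)"

definition complete_theory ::
  "'m itself \<Rightarrow> ('f, 'p) language \<Rightarrow> ('f, 'p) fm set \<Rightarrow> bool" where
  "complete_theory ty L T \<longleftrightarrow> T \<subseteq> sentences L \<and>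
     \<not> entails ty L T Falsum \<and>
     (\<forall>\<phi>\<in>sentences L. entails ty L T \<phi> \<or> entails ty L T (Neg \<phi>))"


section \<open>Monster models\<close>

text \<open>
  A 1-type over \<open>A\<close> is given as a set of pairs \<open>(\<phi>, s)\<close>: variable 0 of \<open>\<phi>\<close> is the free variable
  of the type, and \<open>s\<close> assigns parameters from \<open>A\<close> to the other free variables of \<open>\<phi>\<close>.
\<close>

definition saturated ::
  "('f, 'p) language \<Rightarrow> ('f, 'p, 'm) fo_struct \<Rightarrow> 'm rel \<Rightarrow> bool" where
  "saturated L M \<kappa> \<longleftrightarrow>
     (\<forall>A p. A \<subseteq> univ M \<longrightarrow> |A| <o \<kappa> \<longrightarrow>
        (\<forall>(\<phi>, s)\<in>p. wf_fm L \<phi> \<and> (\<forall>i\<in>fv \<phi> - {0}. s i \<in> A)) \<longrightarrow>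
        (\<forall>q\<subseteq>p. finite q \<longrightarrow> (\<exists>a\<in>univ M. \<forall>(\<phi>, s)\<in>q. sat M (s(0 := a)) \<phi>)) \<longrightarrow>
        (\<exists>a\<in>univ M. \<forall>(\<phi>, s)\<in>p. sat M (s(0 := a)) \<phi>))"

definition partial_elementary ::
  "('f, 'p) language \<Rightarrow> ('f, 'p, 'm) fo_struct \<Rightarrow> 'm set \<Rightarrow> ('m \<Rightarrow> 'm) \<Rightarrow> bool" where
  "partial_elementary L M A f \<longleftrightarrow> A \<subseteq> univ M \<and> f ` A \<subseteq> univ M \<and>
     (\<forall>\<phi> s. wf_fm L \<phi> \<longrightarrow> s ` fv \<phi> \<subseteq> A \<longrightarrow> (sat M s \<phi> \<longleftrightarrow> sat M (f \<circ> s) \<phi>))"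

definition automorphism ::
  "('f, 'p) language \<Rightarrow> ('f, 'p, 'm) fo_struct \<Rightarrow> ('m \<Rightarrow> 'm) \<Rightarrow> bool" where
  "automorphism L M g \<longleftrightarrow> bij_betw g (univ M) (univ M) \<and>
     (\<forall>(f, n)\<in>fsyms L. \<forall>xs\<in>lists (univ M). length xs = n \<longrightarrow>
        g (fint M f xs) = fint M f (map g xs)) \<and>
     (\<forall>(p, n)\<in>psyms L. \<forall>xs\<in>lists (univ M). length xs = n \<longrightarrow>
        (pint M p xs \<longleftrightarrow> pint M p (map g xs)))"

definition strongly_homogeneous ::
  "('f, 'p) language \<Rightarrow> ('f, 'p, 'm) fo_struct \<Rightarrow> 'm rel \<Rightarrow> bool" where
  "strongly_homogeneous L M \<kappa> \<longleftrightarrow>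
     (\<forall>A f. |A| <o \<kappa> \<longrightarrow> partial_elementary L M A f \<longrightarrow>
        (\<exists>g. automorphism L M g \<and> (\<forall>a\<in>A. g a = f a)))"

text \<open>
  A monster model is \<open>\<kappa>\<close>-saturated and strongly \<open>\<kappa>\<close>-homogeneous for some cardinal \<open>\<kappa>\<close> above the
  number of formulas, which is the maximum of the cardinality of the language and \<open>\<aleph>\<^sub>0\<close>.  An infinite
  \<open>\<kappa>\<close>-saturated model has at least \<open>\<kappa>\<close> elements, so \<open>\<kappa>\<close> can be taken on the type \<open>'m\<close>.
\<close>

definition monster ::
  "('f, 'p) language \<Rightarrow> ('f, 'p) fm set \<Rightarrow> ('f, 'p, 'm) fo_struct \<Rightarrow> bool" where
  "monster L T M \<longleftrightarrow> is_model L T M \<and>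
     (\<exists>\<kappa>::'m rel. Card_order \<kappa> \<and> |{\<phi>. wf_fm L \<phi>}| <o \<kappa> \<and>
        saturated L M \<kappa> \<and> strongly_homogeneous L M \<kappa>)"


section \<open>Definable sets\<close>

text \<open>
  An \<open>n\<close>-tuple is a function on \<open>{..<n}\<close>, extended by \<open>undefined\<close>.
\<close>

definition tuples :: "('f, 'p, 'm) fo_struct \<Rightarrow> nat \<Rightarrow> (nat \<Rightarrow> 'm) set" where
  "tuples M n = {..<n} \<rightarrow>\<^sub>E univ M"

definition cat :: "nat \<Rightarrow> (nat \<Rightarrow> 'm) \<Rightarrow> (nat \<Rightarrow> 'm) \<Rightarrow> nat \<Rightarrow> 'm" where
  "cat n x y = (\<lambda>i. if i < n then x i else y (i - n))"

text \<open>
  Definability is with parameters: the variables below \<open>n\<close> are the coordinates, and the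
  remaining free variables of \<open>\<phi>\<close> are interpreted by the parameters \<open>s\<close>.
\<close>

definition definable ::
  "('f, 'p) language \<Rightarrow> ('f, 'p, 'm) fo_struct \<Rightarrow> nat \<Rightarrow> (nat \<Rightarrow> 'm) set \<Rightarrow> bool" where
  "definable L M n X \<longleftrightarrow>
     (\<exists>\<phi> s. wf_fm L \<phi> \<and> range s \<subseteq> univ M \<and>
        X = {x \<in> tuples M n. sat M (\<lambda>i. if i < n then x i else s i) \<phi>})"

definition definable1 ::
  "('f, 'p) language \<Rightarrow> ('f, 'p, 'm) fo_struct \<Rightarrow> 'm set \<Rightarrow> bool" where
  "definable1 L M D \<longleftrightarrow> D \<subseteq> univ M \<and> definable L M 1 {x \<in> tuples M 1. x 0 \<in> D}"

definition definable_family ::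
  "('f, 'p) language \<Rightarrow> ('f, 'p, 'm) fo_struct \<Rightarrow> nat \<Rightarrow> (nat \<Rightarrow> 'm) set set \<Rightarrow> bool" where
  "definable_family L M n \<F> \<longleftrightarrow>
     (\<exists>k X Y. definable L M (n + k) X \<and> definable L M k Y \<and>
        \<F> = (\<lambda>b. {x \<in> tuples M n. cat n x b \<in> X}) ` Y)"

definition definable_map ::
  "('f, 'p) language \<Rightarrow> ('f, 'p, 'm) fo_struct \<Rightarrow> nat \<Rightarrow> nat \<Rightarrow>
     (nat \<Rightarrow> 'm) set \<Rightarrow> ((nat \<Rightarrow> 'm) \<Rightarrow> (nat \<Rightarrow> 'm)) \<Rightarrow> bool" where
  "definable_map L M n m X h \<longleftrightarrow> X \<subseteq> tuples M n \<and> h ` X \<subseteq> tuples M m \<and>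
     definable L M (n + m) ((\<lambda>x. cat n x (h x)) ` X)"

definition is_basis :: "'a topology \<Rightarrow> 'a set set \<Rightarrow> bool" where
  "is_basis t \<B> \<longleftrightarrow> openin t = arbitrary union_of (\<lambda>B. B \<in> \<B>)"


section \<open>T-minimal theories\<close>

definition t_minimal_topology ::
  "('f, 'p) language \<Rightarrow> ('f, 'p, 'm) fo_struct \<Rightarrow> 'm topology \<Rightarrow> bool" where
  "t_minimal_topology L M \<tau> \<longleftrightarrow> topspace \<tau> = univ M \<and> Hausdorff_space \<tau> \<and>
     (\<exists>\<F>. definable_family L M 1 \<F> \<and> is_basis \<tau> ((\<lambda>F. (\<lambda>x. x 0) ` F) ` \<F>)) \<and>
     (\<forall>D. definable1 L M D \<longrightarrow> (\<tau> interior_of D \<noteq> {} \<longleftrightarrow> infinite D))"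

text \<open>
  A complete theory can have several such topologies, and the later notions depend on the choice;
  hence the assignment \<open>\<T>\<close> of a topology to each model is explicit.
\<close>

definition t_minimal ::
  "('f, 'p) language \<Rightarrow> ('f, 'p) fm set \<Rightarrow> (('f, 'p, 'm) fo_struct \<Rightarrow> 'm topology) \<Rightarrow> bool" where
  "t_minimal L T \<T> \<longleftrightarrow> complete_theory TYPE('m) L T \<and>
     (\<forall>M. is_model L T M \<longrightarrow> t_minimal_topology L M (\<T> M))"

definition power_top :: "'m topology \<Rightarrow> nat \<Rightarrow> (nat \<Rightarrow> 'm) topology" where
  "power_top \<tau> n = product_topology (\<lambda>_. \<tau>) {..<n}"

text \<open>
  The coordinate projection to a set \<open>J\<close> of \<open>k\<close> coordinates takes values in the product indexed by
  \<open>J\<close> itself, which is the \<open>k\<close>-th power up to renumbering the coordinates.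
\<close>

definition dim :: "'m topology \<Rightarrow> nat \<Rightarrow> (nat \<Rightarrow> 'm) set \<Rightarrow> ereal" where
  "dim \<tau> n X = (if X = {} then -\<infinity> else
     ereal (real (Max {card J |J. J \<subseteq> {..<n} \<and>
       product_topology (\<lambda>_. \<tau>) J interior_of ((\<lambda>x. restrict x J) ` X) \<noteq> {}})))"

definition correspondence :: "nat \<Rightarrow> 'a set \<Rightarrow> 'b set \<Rightarrow> ('a \<Rightarrow> 'b set) \<Rightarrow> bool" where
  "correspondence k X Y f \<longleftrightarrow> (\<forall>x\<in>X. f x \<subseteq> Y \<and> finite (f x) \<and> card (f x) = k)"

definition corr_graph ::
  "nat \<Rightarrow> (nat \<Rightarrow> 'm) set \<Rightarrow> ((nat \<Rightarrow> 'm) \<Rightarrow> (nat \<Rightarrow> 'm) set) \<Rightarrow> (nat \<Rightarrow> 'm) set" where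
  "corr_graph n X f = {cat n x y |x y. x \<in> X \<and> y \<in> f x}"

definition definable_correspondence ::
  "('f, 'p) language \<Rightarrow> ('f, 'p, 'm) fo_struct \<Rightarrow> nat \<Rightarrow> nat \<Rightarrow> nat \<Rightarrow>
     (nat \<Rightarrow> 'm) set \<Rightarrow> ((nat \<Rightarrow> 'm) \<Rightarrow> (nat \<Rightarrow> 'm) set) \<Rightarrow> bool" where
  "definable_correspondence L M n m k X f \<longleftrightarrow> X \<subseteq> tuples M n \<and>
     correspondence k X (tuples M m) f \<and> definable L M (n + m) (corr_graph n X f)"

definition continuous_correspondence ::
  "'a topology \<Rightarrow> 'b topology \<Rightarrow> nat \<Rightarrow> ('a \<Rightarrow> 'b set) \<Rightarrow> bool" where
  "continuous_correspondence S S' k f \<longleftrightarrow>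
     correspondence k (topspace S) (topspace S') f \<and>
     (\<forall>x\<in>topspace S. \<exists>V g. openin S V \<and> x \<in> V \<and>
        (\<forall>i<k. continuous_map (subtopology S V) S' (g i)) \<and>
        (\<forall>v\<in>V. f v = {g i v |i. i < k}))"

definition nice ::
  "('f, 'p) language \<Rightarrow> ('f, 'p, 'm) fo_struct \<Rightarrow> 'm topology \<Rightarrow> bool" where
  "nice L M \<tau> \<longleftrightarrow>
     (\<forall>n m k U f. definable L M n U \<longrightarrow> openin (power_top \<tau> n) U \<longrightarrow>
        definable_correspondence L M n m k U f \<longrightarrow>
        (\<exists>U\<^sub>0\<subseteq>U. definable L M n U\<^sub>0 \<and> openin (power_top \<tau> n) U\<^sub>0 \<and>
           dim \<tau> n (U - U\<^sub>0) < ereal (real n) \<and>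
           continuous_correspondence (subtopology (power_top \<tau> n) U\<^sub>0) (power_top \<tau> m) k f))"


section \<open>Definable manifolds and definable groups\<close>

definition cell ::
  "('f, 'p) language \<Rightarrow> ('f, 'p, 'm) fo_struct \<Rightarrow> 'm topology \<Rightarrow> nat \<Rightarrow> (nat \<Rightarrow> 'm) set \<Rightarrow> bool" where
  "cell L M \<tau> n C \<longleftrightarrow>
     (\<exists>i k U f \<sigma>. i \<le> n \<and> definable L M i U \<and> openin (power_top \<tau> i) U \<and>
        definable_correspondence L M i (n - i) k U f \<and>
        continuous_correspondence (subtopology (power_top \<tau> i) U) (power_top \<tau> (n - i)) k f \<and>
        \<sigma> permutes {..<n} \<and>
        C = (\<lambda>x. x \<circ> \<sigma>) ` corr_graph i U f)"

definition definable_manifold ::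
  "('f, 'p) language \<Rightarrow> ('f, 'p, 'm) fo_struct \<Rightarrow> 'm topology \<Rightarrow> nat \<Rightarrow>
     (nat \<Rightarrow> 'm) set \<Rightarrow> (nat \<Rightarrow> 'm) topology \<Rightarrow> bool" where
  "definable_manifold L M \<tau> n X t \<longleftrightarrow> definable L M n X \<and> topspace t = X \<and>
     (\<exists>\<B>. definable_family L M n \<B> \<and> is_basis t \<B>) \<and>
     (\<exists>\<V>. finite \<V> \<and> \<Union>\<V> = X \<and>
        (\<forall>V\<in>\<V>. definable L M n V \<and> openin t V \<and>
           (\<exists>m C W h. cell L M \<tau> m C \<and> openin (subtopology (power_top \<tau> m) C) W \<and>
              definable_map L M n m V h \<and>
              homeomorphic_map (subtopology t V) (subtopology (power_top \<tau> m) W) h)))"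

definition definable_group ::
  "('f, 'p) language \<Rightarrow> ('f, 'p, 'm) fo_struct \<Rightarrow> nat \<Rightarrow> (nat \<Rightarrow> 'm) monoid \<Rightarrow> bool" where
  "definable_group L M n G \<longleftrightarrow> group G \<and> definable L M n (carrier G) \<and>
     definable L M (n + n + n)
       {cat (n + n) (cat n x y) (x \<otimes>\<^bsub>G\<^esub> y) |x y. x \<in> carrier G \<and> y \<in> carrier G}"

definition definable_subgroup ::
  "('f, 'p) language \<Rightarrow> ('f, 'p, 'm) fo_struct \<Rightarrow> nat \<Rightarrow> (nat \<Rightarrow> 'm) set \<Rightarrow>
     (nat \<Rightarrow> 'm) monoid \<Rightarrow> bool" where
  "definable_subgroup L M n H G \<longleftrightarrow> subgroup H G \<and> definable L M n H"

definition topological_group :: "'a monoid \<Rightarrow> 'a topology \<Rightarrow> bool" where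
  "topological_group G t \<longleftrightarrow> group G \<and> topspace t = carrier G \<and>
     continuous_map (prod_topology t t) t (\<lambda>(x, y). x \<otimes>\<^bsub>G\<^esub> y) \<and>
     continuous_map t t (\<lambda>x. inv\<^bsub>G\<^esub> x)"

text \<open>
  In a nice t-minimal theory, every definable group has exactly one such topology.
\<close>

definition canonical_topology ::
  "('f, 'p) language \<Rightarrow> ('f, 'p, 'm) fo_struct \<Rightarrow> 'm topology \<Rightarrow> nat \<Rightarrow>
     (nat \<Rightarrow> 'm) monoid \<Rightarrow> (nat \<Rightarrow> 'm) topology \<Rightarrow> bool" where
  "canonical_topology L M \<tau> n G t \<longleftrightarrow>
     definable_manifold L M \<tau> n (carrier G) t \<and> topological_group G t"

definition closed_embedding :: "'a topology \<Rightarrow> 'b topology \<Rightarrow> ('a \<Rightarrow> 'b) \<Rightarrow> bool" where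
  "closed_embedding S S' f \<longleftrightarrow> embedding_map S S' f \<and> closedin S' (f ` topspace S)"

end

theory Submission
  imports Defs
begin

text \<open>
  Call a definable \<open>D \<subseteq> M\<^sup>n\<close> broad if for every \<open>k\<close> it contains a product of \<open>n\<close> sets of size \<open>k\<close>.
  By saturation, broad definable sets are exactly those with non-empty interior.  This replaces the
  additivity of dimension, which can fail in a t-minimal theory.  It implies that a definable set
  without interior is a finite union of sets \<open>D\<^sub>j\<close> meeting every line in direction \<open>j\<close> in a finite
  set, and hence, with niceness, that every definable set is a finite union of cells.

  Cells are locally closed, so \<open>H\<close>, read in a chart of \<open>G\<close>, agrees with a single cell near some point.
  Hence \<open>H\<close> is locally closed in \<open>G\<close> at that point, and a subgroup which is somewhere locally closed
  is closed.  Moreover, both \<open>H\<close> with its canonical topology and \<open>H\<close> as a subspace of \<open>G\<close> contain a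
  non-empty open set which is the image of an open subset of some \<open>M\<^sup>d\<close> under a definable open map.
  By niceness such a map is generically continuous into any definable manifold, so the identity of
  \<open>H\<close> is continuous somewhere in both directions, and then everywhere by translation.
\<close>

section \<open>Definable predicates\<close>

text \<open>Having grids of all sizes is not a first-order condition, but having a grid of one given
  size is. This is why grids are used: saturation turns statements about every finite size into a
  single open set. Two consequences take the place of dimension theory. An open set covered by
  finitely many definable sets has a non-empty open subset inside one of them. And a set with finite
  lines in direction \<open>j\<close> can give up \<open>j\<close> as a base coordinate, because
  moving that coordinate into the fibre keeps the fibres finite; cell decomposition is thus an
  induction on the number of base coordinates.

  A second obstacle is that the values of a correspondence need not be definably distinguishable:
  its continuous local branches are not assumed definable. A branch becomes definable once a
  definable box isolates its value from the other ones. Finally, the topology of a definable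
  manifold is not assumed to be related to the product topology of the surrounding power, so generic
  continuity into a manifold is read in a chart.\<close>

definition tup :: "nat \<Rightarrow> (nat \<Rightarrow> 'm) \<Rightarrow> nat \<Rightarrow> 'm" where
  "tup n x = restrict x {..<n}"

lemma tup_less [simp]: "j < n \<Longrightarrow> tup n x j = x j"
  by (simp add: tup_def)

lemma tup_ge [simp]: "\<not> j < n \<Longrightarrow> tup n x j = undefined"
  by (simp add: tup_def)

lemma tup_cong: "(\<And>j. j < n \<Longrightarrow> x j = y j) \<Longrightarrow> tup n x = tup n y"
  by (auto simp: tup_def restrict_def)

lemma tup_tup [simp]: "tup n (tup n x) = tup n x"
  by (rule tup_cong) simp

lemma tuples_iff: "x \<in> tuples M n \<longleftrightarrow> (\<forall>j<n. x j \<in> univ M) \<and> (\<forall>j. \<not> j < n \<longrightarrow> x j = undefined)"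
  by (auto simp: tuples_def PiE_iff extensional_def)

lemma tuplesD [dest]:
  "x \<in> tuples M n \<Longrightarrow> j < n \<Longrightarrow> x j \<in> univ M"
  "x \<in> tuples M n \<Longrightarrow> \<not> j < n \<Longrightarrow> x j = undefined"
  by (simp_all add: tuples_iff)

lemma tup_in_tuples_iff: "tup n x \<in> tuples M n \<longleftrightarrow> (\<forall>j<n. x j \<in> univ M)"
  by (auto simp: tuples_iff)

lemma tup_tuples [simp]: "x \<in> tuples M n \<Longrightarrow> tup n x = x"
  by (auto simp: tuples_iff tup_def fun_eq_iff)

lemma tuples_eqI:
  assumes "x \<in> tuples M n" "y \<in> tuples M n" "\<And>j. j < n \<Longrightarrow> x j = y j"
  shows "x = y"
  using assms by (auto simp: tuples_iff fun_eq_iff) metis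

lemma tuples_0 [simp]: "tuples M 0 = {\<lambda>_. undefined}"
  by (simp add: tuples_def)

lemma cat_tuples: "x \<in> tuples M n \<Longrightarrow> y \<in> tuples M m \<Longrightarrow> cat n x y \<in> tuples M (n + m)"
  by (auto simp: tuples_iff cat_def)

text \<open>\<open>cat n\<close> reads its first argument only below \<open>n\<close>, but all of
  its second one; hence the tuple hypotheses concern the first arguments alone.\<close>

lemma cat_eq_iff:
  assumes "x \<in> tuples M n" "x' \<in> tuples M n"
  shows "cat n x y = cat n x' y' \<longleftrightarrow> x = x' \<and> y = y'"
proof
  assume eq: "cat n x y = cat n x' y'"
  have "x = x'"
    using fun_cong[OF eq] by (intro tuples_eqI[OF assms]) (metis cat_def)
  moreover have "y j = y' j" for j
    using fun_cong[OF eq, of "n + j"] by (simp add: cat_def)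
  ultimately show "x = x' \<and> y = y'" by auto
qed auto

lemma split_tuple:
  assumes "z \<in> tuples M (n + m)"
  shows "tup n z \<in> tuples M n" "tup m (\<lambda>j. z (n + j)) \<in> tuples M m"
    "cat n (tup n z) (tup m (\<lambda>j. z (n + j))) = z"
  using assms by (auto simp: tuples_iff cat_def tup_def fun_eq_iff)

section \<open>Renaming of variables and dependence of satisfaction on free variables\<close>

fun ren_tm :: "(nat \<Rightarrow> nat) \<Rightarrow> 'f tm \<Rightarrow> 'f tm" where
  "ren_tm r (Var i) = Var (r i)"
| "ren_tm r (Fn f ts) = Fn f (map (ren_tm r) ts)"

text \<open>Bound variables are renamed together with the free ones, so an injective renaming cannot
  capture a variable.\<close>

fun ren :: "(nat \<Rightarrow> nat) \<Rightarrow> ('f, 'p) fm \<Rightarrow> ('f, 'p) fm" where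
  "ren r Falsum = Falsum"
| "ren r (Equal t u) = Equal (ren_tm r t) (ren_tm r u)"
| "ren r (Pred p ts) = Pred p (map (ren_tm r) ts)"
| "ren r (Imp \<phi> \<psi>) = Imp (ren r \<phi>) (ren r \<psi>)"
| "ren r (All i \<phi>) = All (r i) (ren r \<phi>)"

lemma wf_ren_tm [simp]: "wf_tm L (ren_tm r t) \<longleftrightarrow> wf_tm L t"
  by (induction t) auto

lemma wf_ren [simp]: "wf_fm L (ren r \<phi>) \<longleftrightarrow> wf_fm L \<phi>"
  by (induction \<phi>) auto

lemma tval_ren_tm: "tval M s (ren_tm r t) = tval M (s \<circ> r) t"
proof (induction t)
  case (Fn f ts)
  then have "map (tval M s \<circ> ren_tm r) ts = map (tval M (s \<circ> r)) ts" by (auto simp: o_def)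
  then show ?case by (metis map_map ren_tm.simps(2) tval.simps(2))
qed simp

lemma sat_ren:
  assumes "inj r"
  shows "sat M s (ren r \<phi>) \<longleftrightarrow> sat M (s \<circ> r) \<phi>"
proof (induction \<phi> arbitrary: s)
  case (Pred p ts)
  have "map (tval M s \<circ> ren_tm r) ts = map (tval M (s \<circ> r)) ts"
    by (auto simp: tval_ren_tm)
  then show ?case by (simp del: map_eq_conv comp_apply)
next
  case (All i \<phi>)
  have "(s(r i := a)) \<circ> r = (s \<circ> r)(i := a)" for a
    using assms by (auto simp: fun_eq_iff inj_def)
  then show ?case using All by (simp del: comp_apply fun_upd_apply)
qed (auto simp: tval_ren_tm)

lemma tval_cong: "(\<And>i. i \<in> fv_tm t \<Longrightarrow> s i = s' i) \<Longrightarrow> tval M s t = tval M s' t"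
proof (induction t)
  case (Fn f ts)
  then have "map (tval M s) ts = map (tval M s') ts" by auto
  then show ?case by (simp del: map_eq_conv)
qed simp

lemma sat_cong: "(\<And>i. i \<in> fv \<phi> \<Longrightarrow> s i = s' i) \<Longrightarrow> sat M s \<phi> \<longleftrightarrow> sat M s' \<phi>"
proof (induction \<phi> arbitrary: s s')
  case (Equal t u)
  then have "tval M s t = tval M s' t" "tval M s u = tval M s' u"
    by (auto intro!: tval_cong)
  then show ?case by simp
next
  case (Pred p ts)
  then have "map (tval M s) ts = map (tval M s') ts" by (auto intro!: tval_cong)
  then show ?case by (simp del: map_eq_conv)
next
  case (Imp \<phi> \<psi>)
  have "sat M s \<phi> \<longleftrightarrow> sat M s' \<phi>" "sat M s \<psi> \<longleftrightarrow> sat M s' \<psi>"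
    by (rule Imp.IH; simp add: Imp.prems)+
  then show ?case by simp
next
  case (All i \<phi>)
  have "sat M (s(i := a)) \<phi> \<longleftrightarrow> sat M (s'(i := a)) \<phi>" for a
    by (rule All.IH) (auto simp: All.prems)
  then show ?case by simp
qed auto

text \<open>
  An environment \<open>e\<close> gives the tuple variables \<open>e 0, e 1, \<dots>\<close> their values. Variable number
  \<open>prod_encode (0, j)\<close> of a formula is a parameter, \<open>prod_encode (Suc i, j)\<close> stands for \<open>e i j\<close>.
  Below, \<open>dp P\<close> says that a formula with parameters defines \<open>P\<close>, and \<open>dt f\<close> that \<open>f\<close> is a variable
  or a parameter.  Environments are not restricted to the universe, whence \<open>dp_univ\<close>.
\<close>

definition asg :: "(nat \<Rightarrow> 'm) \<Rightarrow> (nat \<Rightarrow> nat \<Rightarrow> 'm) \<Rightarrow> nat \<Rightarrow> 'm" where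
  "asg c e v = (case prod_decode v of (0, j) \<Rightarrow> c j | (Suc i, j) \<Rightarrow> e i j)"

lemma asg_simps [simp]:
  "asg c e (prod_encode (0, j)) = c j" "asg c e (prod_encode (Suc i, j)) = e i j"
  by (simp_all add: asg_def)

lemma asg_upd: "(asg c e)(prod_encode (Suc i, j) := a) = asg c (e(i := (e i)(j := a)))"
proof
  fix v
  obtain k l where "v = prod_encode (k, l)" by (metis prod_decode_inverse surj_pair)
  then show "((asg c e)(prod_encode (Suc i, j) := a)) v = asg c (e(i := (e i)(j := a))) v"
    by (cases k) auto
qed

section \<open>Closure properties of definable predicates\<close>

locale fo_structure =
  fixes L :: "('f, 'p) language" and M :: "('f, 'p, 'm) fo_struct"
  assumes univ_nonempty: "univ M \<noteq> {}"
begin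

definition dp :: "((nat \<Rightarrow> nat \<Rightarrow> 'm) \<Rightarrow> bool) \<Rightarrow> bool" where
  "dp P \<longleftrightarrow> (\<exists>\<phi> c. wf_fm L \<phi> \<and> range c \<subseteq> univ M \<and> (\<forall>e. P e \<longleftrightarrow> sat M (asg c e) \<phi>))"

inductive dt :: "((nat \<Rightarrow> nat \<Rightarrow> 'm) \<Rightarrow> 'm) \<Rightarrow> bool" where
  dt_var: "dt (\<lambda>e. e i j)"
| dt_const: "c \<in> univ M \<Longrightarrow> dt (\<lambda>e. c)"

abbreviation elt :: 'm where "elt \<equiv> SOME a. a \<in> univ M"

lemma elt_in: "elt \<in> univ M"
  using univ_nonempty by (simp add: some_in_eq)

lemma dp_cong: "(\<And>e. P e \<longleftrightarrow> Q e) \<Longrightarrow> dp P \<longleftrightarrow> dp Q"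
  by (simp add: dp_def)

lemma dp_False: "dp (\<lambda>e. False)"
  unfolding dp_def using elt_in by (intro exI[of _ Falsum] exI[of _ "\<lambda>_. elt"]) auto

lemma dp_imp:
  assumes "dp P" "dp Q"
  shows "dp (\<lambda>e. P e \<longrightarrow> Q e)"
proof -
  obtain \<phi> c \<psi> d where \<phi>: "wf_fm L \<phi>" "range c \<subseteq> univ M" "\<And>e. P e \<longleftrightarrow> sat M (asg c e) \<phi>"
    and \<psi>: "wf_fm L \<psi>" "range d \<subseteq> univ M" "\<And>e. Q e \<longleftrightarrow> sat M (asg d e) \<psi>"
    using assms unfolding dp_def by blast
  \<comment> \<open>The parameters of the two formulas are moved to the even and to the odd
    parameter slots, so that \<open>cd\<close> can hold both; tuple variables keep their
    numbers.\<close>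
  define r where "r b v = (case prod_decode v of (i, j) \<Rightarrow>
    prod_encode (i, if i = 0 then 2 * j + b else j))" for b v :: nat
  have r: "inj (r b)" for b
    by (rule injI) (auto simp: r_def prod_decode_eq split: prod.splits if_splits
        intro!: prod_decode_eq[THEN iffD1])
  define cd where "cd j = (if even j then c (j div 2) else d (j div 2))" for j
  have "asg cd e \<circ> r 0 = asg c e" "asg cd e \<circ> r (Suc 0) = asg d e" for e
    by (auto simp: fun_eq_iff asg_def r_def cd_def split: prod.splits nat.splits)
  then have "(P e \<longrightarrow> Q e) \<longleftrightarrow> sat M (asg cd e) (Imp (ren (r 0) \<phi>) (ren (r (Suc 0)) \<psi>))" for e
    by (simp add: \<phi>(3) \<psi>(3) sat_ren[OF r])
  moreover have "range cd \<subseteq> univ M" using \<phi>(2) \<psi>(2) by (auto simp: cd_def)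
  ultimately show ?thesis unfolding dp_def
    using \<phi>(1) \<psi>(1) by (intro exI[of _ "Imp (ren (r 0) \<phi>) (ren (r (Suc 0)) \<psi>)"] exI[of _ cd]) auto
qed

lemma dp_not: "dp P \<Longrightarrow> dp (\<lambda>e. \<not> P e)"
  using dp_imp[OF _ dp_False] by simp

lemma dp_True: "dp (\<lambda>e. True)"
  using dp_not[OF dp_False] by simp

lemma dp_triv: "dp (\<lambda>e. b)"
  using dp_True dp_False by (cases b) auto

lemma dp_disj: "dp P \<Longrightarrow> dp Q \<Longrightarrow> dp (\<lambda>e. P e \<or> Q e)"
  using dp_imp[OF dp_not, of P Q] by (simp add: imp_conv_disj)

lemma dp_conj: "dp P \<Longrightarrow> dp Q \<Longrightarrow> dp (\<lambda>e. P e \<and> Q e)"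
  using dp_not[OF dp_imp[OF _ dp_not], of P Q] by simp

lemma dp_Ball:
  assumes "finite A" "\<And>a. a \<in> A \<Longrightarrow> dp (\<lambda>e. P e a)"
  shows "dp (\<lambda>e. \<forall>a\<in>A. P e a)"
  using assms
proof (induction A rule: finite_induct)
  case (insert a A)
  then show ?case using dp_conj[of "\<lambda>e. P e a" "\<lambda>e. \<forall>a\<in>A. P e a"] by simp
qed (simp add: dp_True)

lemma dp_Bex:
  assumes "finite A" "\<And>a. a \<in> A \<Longrightarrow> dp (\<lambda>e. P e a)"
  shows "dp (\<lambda>e. \<exists>a\<in>A. P e a)"
  using dp_not[OF dp_Ball[OF assms(1), of "\<lambda>e a. \<not> P e a"]] dp_not[OF assms(2)] by simp

lemma dp_all_less: "(\<And>j. j < n \<Longrightarrow> dp (\<lambda>e. P e j)) \<Longrightarrow> dp (\<lambda>e. \<forall>j<n. P e j)"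
  for n :: nat
  using dp_Ball[of "{..<n}" P] by (simp add: Ball_def)

lemma dp_ex_less: "(\<And>j. j < n \<Longrightarrow> dp (\<lambda>e. P e j)) \<Longrightarrow> dp (\<lambda>e. \<exists>j<n. P e j)"
  for n :: nat
  using dp_Bex[of "{..<n}" P] by (simp add: Bex_def)

lemma dp_all_upd:
  assumes "dp P"
  shows "dp (\<lambda>e. \<forall>a\<in>univ M. P (e(i := (e i)(j := a))))"
proof -
  obtain \<phi> c where \<phi>: "wf_fm L \<phi>" "range c \<subseteq> univ M" "\<And>e. P e \<longleftrightarrow> sat M (asg c e) \<phi>"
    using assms unfolding dp_def by blast
  then show ?thesis unfolding dp_def
    by (intro exI[of _ "All (prod_encode (Suc i, j)) \<phi>"] exI[of _ c]) (simp add: asg_upd)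
qed

lemma dp_ex_upd:
  assumes "dp P"
  shows "dp (\<lambda>e. \<exists>a\<in>univ M. P (e(i := (e i)(j := a))))"
  using dp_not[OF dp_all_upd[OF dp_not[OF assms]]] by simp

lemma dp_ex_tup_upd:
  assumes "dp P"
  shows "dp (\<lambda>e. \<exists>b\<in>tuples M k. P (e(i := (\<lambda>j. if j < k then b j else e i j))))"
proof (induction k)
  case 0
  then show ?case using assms by simp
next
  case (Suc k)
  let ?u = "\<lambda>k e b. e(i := (\<lambda>j. if j < k then b j else e i j))"
  have "(\<exists>a\<in>univ M. \<exists>b\<in>tuples M k. P (?u k (e(i := (e i)(k := a))) b)) \<longleftrightarrow>
      (\<exists>b\<in>tuples M (Suc k). P (?u (Suc k) e b))" (is "?l \<longleftrightarrow> ?r") for e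
  proof
    assume ?l
    then obtain a b where ab: "a \<in> univ M" "b \<in> tuples M k" "P (?u k (e(i := (e i)(k := a))) b)"
      by blast
    have "?u k (e(i := (e i)(k := a))) b = ?u (Suc k) e (b(k := a))"
      by (auto simp: fun_eq_iff)
    moreover have "b(k := a) \<in> tuples M (Suc k)"
      using ab by (auto simp: tuples_iff less_Suc_eq)
    ultimately show ?r using ab(3) by auto
  next
    assume ?r
    then obtain b where b: "b \<in> tuples M (Suc k)" "P (?u (Suc k) e b)" by blast
    have "?u (Suc k) e b = ?u k (e(i := (e i)(k := b k))) (tup k b)"
      by (auto simp: fun_eq_iff)
    moreover have "tup k b \<in> tuples M k" "b k \<in> univ M"
      using b by (auto simp: tuples_iff)
    ultimately show ?l using b(2) by auto
  qed
  with dp_ex_upd[OF Suc, of i k] show ?case by (rule dp_cong[THEN iffD1, rotated])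
qed

text \<open>The bound tuple is stored in the environment variable \<open>e i\<close>, and the second
  premise says that \<open>i\<close> is fresh for \<open>P\<close>. The truncation
  \<open>tup k\<close> is there because environments are arbitrary beyond the first \<open>k\<close>
  entries.\<close>

lemma dp_ex:
  assumes "dp (\<lambda>e. P e (tup k (e i)))" "\<And>e b y. P (e(i := b)) y = P e y"
  shows "dp (\<lambda>e. \<exists>b\<in>tuples M k. P e b)"
proof -
  have "tup k (\<lambda>j. if j < k then b j else e i j) = b" if "b \<in> tuples M k" for b e
    using that by (auto simp: fun_eq_iff tuples_iff tup_def)
  then show ?thesis
    using dp_ex_tup_upd[OF assms(1), of k i] by (simp add: assms(2) cong: bex_cong dp_cong)
qed

lemma dp_all:
  assumes "dp (\<lambda>e. P e (tup k (e i)))" "\<And>e b y. P (e(i := b)) y = P e y"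
  shows "dp (\<lambda>e. \<forall>b\<in>tuples M k. P e b)"
  using dp_not[OF dp_ex[of "\<lambda>e b. \<not> P e b" k i]] dp_not[OF assms(1)] assms(2) by simp

lemma dp_ex1:
  assumes "dp (\<lambda>e. P e (e i 0))" "\<And>e b y. P (e(i := b)) y = P e y"
  shows "dp (\<lambda>e. \<exists>a\<in>univ M. P e a)"
  using dp_ex_upd[OF assms(1), of i 0] by (simp add: assms(2))

lemma dp_all1:
  assumes "dp (\<lambda>e. P e (e i 0))" "\<And>e b y. P (e(i := b)) y = P e y"
  shows "dp (\<lambda>e. \<forall>a\<in>univ M. P e a)"
  using dp_all_upd[OF assms(1), of i 0] by (simp add: assms(2))

lemma dp_eq:
  assumes "dt f" "dt g"
  shows "dp (\<lambda>e. f e = g e)"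
proof -
  \<comment> \<open>Parameter slot 0 is reserved for \<open>f\<close> and slot 1 for
    \<open>g\<close>, so that two constants fit into one assignment \<open>k\<close>.\<close>
  have "\<exists>v c. c \<in> univ M \<and> (\<forall>d e. d 0 = c \<longrightarrow> f e = asg d e v)" using assms(1)
  proof cases
    case (dt_var i j)
    then show ?thesis using elt_in by (intro exI[of _ "prod_encode (Suc i, j)"]) auto
  next
    case (dt_const c)
    then show ?thesis by (intro exI[of _ "prod_encode (0, 0)"]) auto
  qed
  moreover have "\<exists>v c. c \<in> univ M \<and> (\<forall>d e. d 1 = c \<longrightarrow> g e = asg d e v)" using assms(2)
  proof cases
    case (dt_var i j)
    then show ?thesis using elt_in by (intro exI[of _ "prod_encode (Suc i, j)"]) auto
  next
    case (dt_const c)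
    then show ?thesis by (intro exI[of _ "prod_encode (0, 1)"]) auto
  qed
  ultimately obtain v c w d where
    *: "c \<in> univ M" "d \<in> univ M" "\<And>k e. k 0 = c \<Longrightarrow> f e = asg k e v"
      "\<And>k e. k 1 = d \<Longrightarrow> g e = asg k e w"
    by blast
  define k where "k = (\<lambda>i::nat. if i = 0 then c else d)"
  have "k 0 = c" "k 1 = d" by (auto simp: k_def)
  then have "f e = g e \<longleftrightarrow> sat M (asg k e) (Equal (Var v) (Var w))" for e
    using *(3)[of k e] *(4)[of k e] by auto
  then show ?thesis unfolding dp_def using *(1,2)
    by (intro exI[of _ "Equal (Var v) (Var w)"] exI[of _ k]) (auto simp: k_def)
qed

text \<open>Quantifiers in \<open>sat\<close> range over the universe, so equality with a quantified
  element expresses membership in it.\<close>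

lemma dp_univ:
  assumes "dt f"
  shows "dp (\<lambda>e. f e \<in> univ M)"
  using assms
proof cases
  case (dt_var i j)
  have "dp (\<lambda>e. \<exists>a\<in>univ M. a = e i j)"
    by (rule dp_ex1[where i = "Suc i"]) (auto intro: dp_eq dt.intros)
  then show ?thesis by (simp add: dt_var)
next
  case (dt_const c)
  then show ?thesis by (simp add: dp_True)
qed

lemma dt_if: "(b \<Longrightarrow> dt f) \<Longrightarrow> (\<not> b \<Longrightarrow> dt g) \<Longrightarrow> dt (\<lambda>e. if b then f e else g e)"
  by (cases b) auto

lemma dt_tup: "j < n \<Longrightarrow> dt (\<lambda>e. f e j) \<Longrightarrow> dt (\<lambda>e. tup n (f e) j)"
  by simp

lemma dt_cat:
  "(j < n \<Longrightarrow> dt (\<lambda>e. f e j)) \<Longrightarrow> (\<not> j < n \<Longrightarrow> dt (\<lambda>e. g e (j - n))) \<Longrightarrow>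
    dt (\<lambda>e. cat n (f e) (g e) j)"
  by (cases "j < n") (auto simp: cat_def)

lemma dt_upd:
  "(j = i \<Longrightarrow> dt g) \<Longrightarrow> (j \<noteq> i \<Longrightarrow> dt (\<lambda>e. f e j)) \<Longrightarrow> dt (\<lambda>e. ((f e)(i := g e)) j)"
  by (cases "j = i") auto

lemma dp_mem_var:
  assumes "definable L M n X"
  shows "dp (\<lambda>e. tup n (e i) \<in> X)"
proof -
  obtain \<phi> s where \<phi>: "wf_fm L \<phi>" "range s \<subseteq> univ M"
    and X: "X = {x \<in> tuples M n. sat M (\<lambda>i. if i < n then x i else s i) \<phi>}"
    using assms unfolding definable_def by blast
  define r where "r v = (if v < n then prod_encode (Suc i, v) else prod_encode (0, v))" for v
  have r: "inj r" by (rule injI) (auto simp: r_def split: if_splits)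
  have "sat M (\<lambda>j. if j < n then tup n (e i) j else s j) \<phi> \<longleftrightarrow> sat M (asg s e) (ren r \<phi>)" for e
    unfolding sat_ren[OF r] by (rule sat_cong) (auto simp: r_def)
  then have "dp (\<lambda>e. sat M (\<lambda>j. if j < n then tup n (e i) j else s j) \<phi>)"
    unfolding dp_def using \<phi> by (intro exI[of _ "ren r \<phi>"] exI[of _ s]) auto
  then have "dp (\<lambda>e. (\<forall>j<n. e i j \<in> univ M) \<and> sat M (\<lambda>j. if j < n then tup n (e i) j else s j) \<phi>)"
    by (intro dp_conj dp_all_less dp_univ dt_var)
  then show ?thesis by (simp add: X tup_in_tuples_iff)
qed

lemma definable_subset: "definable L M n X \<Longrightarrow> X \<subseteq> tuples M n"
  by (auto simp: definable_def)

text \<open>This avoids substitution into formulas: a fresh tuple variable is quantified, required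
  to lie in \<open>X\<close>, and equated coordinatewise with \<open>f e\<close>. Each coordinate of
  \<open>f\<close> reads at most one variable, so an index \<open>i\<close> above all of these is
  fresh.\<close>

lemma dp_mem:
  assumes X: "definable L M n X" and f: "\<And>j. j < n \<Longrightarrow> dt (\<lambda>e. f e j)"
    and und: "\<And>e j. \<not> j < n \<Longrightarrow> f e j = undefined"
  shows "dp (\<lambda>e. f e \<in> X)"
proof -
  have "\<exists>I. \<forall>i\<ge>I. \<forall>e b. f (e(i := b)) j = f e j" if "j < n" for j
    using f[OF that]
  proof cases
    case (dt_var i l)
    then have "f e j = e i l" for e by meson
    then show ?thesis by (intro exI[of _ "Suc i"]) auto
  next
    case (dt_const c)
    then have "f e j = c" for e by meson
    then show ?thesis by auto
  qed
  then obtain I where I: "\<And>j i e b. j < n \<Longrightarrow> i \<ge> I j \<Longrightarrow> f (e(i := b)) j = f e j" by metis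
  define i where "i = Max (I ` {..<n})"
  have i: "f (e(i := b)) j = f e j" if "j < n" for j e b
    using that by (intro I) (auto simp: i_def)
  have f_upd: "f (e(i := b)) = f e" for e b
    using i und by (metis ext)
  have "dp (\<lambda>e. \<exists>b\<in>tuples M n. b \<in> X \<and> (\<forall>j<n. b j = f e j))"
    by (rule dp_ex[where i = i])
      (auto simp: f_upd intro!: dp_conj dp_mem_var[OF X] dp_all_less dp_eq dt_var f)
  moreover have "(\<exists>b\<in>tuples M n. b \<in> X \<and> (\<forall>j<n. b j = f e j)) \<longleftrightarrow> f e \<in> X" for e
    using definable_subset[OF X] und tuples_eqI
    by (smt (verit, best) ext subsetD tuples_iff)
  ultimately show ?thesis by simp
qed

lemma definableI:
  assumes "dp (\<lambda>e. P (tup n (e 0)))"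
  shows "definable L M n {x \<in> tuples M n. P x}"
proof -
  obtain \<phi> c where \<phi>: "wf_fm L \<phi>" "range c \<subseteq> univ M"
      "\<And>e. P (tup n (e 0)) \<longleftrightarrow> sat M (asg c e) \<phi>"
    using assms unfolding dp_def by blast
  \<comment> \<open>Tuple variable 0 has code 1 in \<open>prod_encode\<close>. Its first
    \<open>n\<close> entries become the coordinates, and every other variable is shifted beyond
    \<open>n\<close> and becomes a parameter. The truth value does not depend on the remaining tuple
    variables, so \<open>s\<close> fills them with \<open>elt\<close>.\<close>
  define r where "r v = (case prod_decode v of (i, j) \<Rightarrow> if i = 1 \<and> j < n then j else n + v)" for v
  have r: "inj r"
    by (rule injI) (auto simp: r_def split: prod.splits if_splits
        intro: prod_decode_eq[THEN iffD1])
  define s where "s w = asg c (\<lambda>_ _. elt) (w - n)" for w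
  have s: "range s \<subseteq> univ M"
    using range_subsetD[OF \<phi>(2)] elt_in by (auto simp: s_def asg_def split: prod.splits nat.splits)
  have "P x \<longleftrightarrow> sat M (\<lambda>i. if i < n then x i else s i) (ren r \<phi>)" if "x \<in> tuples M n" for x
  proof -
    define e where "e i j = (if i = 0 \<and> j < n then x j else elt)" for i j :: nat
    have "tup n (e 0) = x" using that by (auto simp: e_def fun_eq_iff tup_def tuples_iff)
    moreover have "asg c e v = ((\<lambda>i. if i < n then x i else s i) \<circ> r) v" for v
      by (auto simp: asg_def r_def s_def e_def split: prod.splits nat.splits)
    then have "asg c e = (\<lambda>i. if i < n then x i else s i) \<circ> r" by blast
    ultimately show ?thesis unfolding sat_ren[OF r] using \<phi>(3)[of e] by simp
  qed
  then show ?thesis unfolding definable_def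
    using \<phi>(1) s by (intro exI[of _ "ren r \<phi>"] exI[of _ s]) auto
qed

lemma dp_tup_eq:
  fixes n :: nat
  assumes "\<And>j. j < n \<Longrightarrow> dt (\<lambda>e. f e j)" "\<And>j. j < n \<Longrightarrow> dt (\<lambda>e. g e j)"
    and "\<And>e j. \<not> j < n \<Longrightarrow> f e j = undefined" "\<And>e j. \<not> j < n \<Longrightarrow> g e j = undefined"
  shows "dp (\<lambda>e. f e = g e)"
proof -
  have "dp (\<lambda>e. \<forall>j<n. f e j = g e j)" by (intro dp_all_less dp_eq assms)
  moreover have "(\<forall>j<n. f e j = g e j) \<longleftrightarrow> f e = g e" for e
    using assms(3,4) by (metis ext)
  ultimately show ?thesis by simp
qed

lemmas dp_intros = dp_imp dp_not dp_triv dp_disj dp_conj dp_all_less dp_ex_less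
lemmas dt_intros = dt_var dt_const dt_tup dt_cat dt_upd dt_if

text \<open>Tuple variable 0 is occupied by the concatenated tuple, so the two halves are read from
  variables 1 and 2.\<close>

lemma definable2I:
  assumes "dp (\<lambda>e. Q (tup n (e 1)) (tup m (e 2)))"
  shows "definable L M (n + m) {cat n x y |x y. x \<in> tuples M n \<and> y \<in> tuples M m \<and> Q x y}"
proof -
  have "dp (\<lambda>e. \<exists>x\<in>tuples M n. \<exists>y\<in>tuples M m. tup (n + m) (e 0) = cat n x y \<and> Q x y)"
    apply (rule dp_ex[where i = 1])
     apply (rule dp_ex[where i = 2])
      apply (intro dp_conj assms dp_tup_eq[where n = "n + m"] dt_intros)
    by (auto simp: cat_def)
  from definableI[where P = "\<lambda>z. \<exists>x\<in>tuples M n. \<exists>y\<in>tuples M m. z = cat n x y \<and> Q x y", OF this]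
  show ?thesis
    by (rule back_subst[of "definable L M (n + m)"]) (auto intro: cat_tuples)
qed

lemma definable_Int:
  assumes "definable L M n X" "definable L M n Y"
  shows "definable L M n (X \<inter> Y)"
proof -
  have "X \<inter> Y = {x \<in> tuples M n. x \<in> X \<and> x \<in> Y}"
    using assms[THEN definable_subset] by auto
  then show ?thesis
    using definableI[where n = n and P = "\<lambda>x. x \<in> X \<and> x \<in> Y"] assms
    by (simp add: dp_intros dp_mem_var)
qed

lemma definable_Diff:
  assumes "definable L M n X" "definable L M n Y"
  shows "definable L M n (X - Y)"
proof -
  have "X - Y = {x \<in> tuples M n. x \<in> X \<and> x \<notin> Y}"
    using assms[THEN definable_subset] by auto
  then show ?thesis
    using definableI[where n = n and P = "\<lambda>x. x \<in> X \<and> x \<notin> Y"] assms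
    by (simp add: dp_intros dp_mem_var)
qed

lemma definable_tuples: "definable L M n (tuples M n)"
  using definableI[where P = "\<lambda>_. True", OF dp_True] by simp

end

section \<open>Saturation and grids\<close>

text \<open>Lower bounds on cardinality are first-order, by the recursion
  \<open>at_least_Suc\<close>, and they treat finite and infinite sets alike.\<close>

definition at_least :: "nat \<Rightarrow> 'a set \<Rightarrow> bool" where
  "at_least k A \<longleftrightarrow> (\<exists>B\<subseteq>A. finite B \<and> card B = k)"

lemma at_least_0: "at_least 0 A"
  by (auto simp: at_least_def)

lemma at_least_Suc: "at_least (Suc k) A \<longleftrightarrow> (\<exists>a\<in>A. at_least k (A - {a}))"
proof
  assume "at_least (Suc k) A"
  then obtain B where B: "B \<subseteq> A" "finite B" "card B = Suc k" by (auto simp: at_least_def)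
  then obtain a where "a \<in> B" by fastforce
  with B show "\<exists>a\<in>A. at_least k (A - {a})"
    unfolding at_least_def by (intro bexI[of _ a] exI[of _ "B - {a}"]) auto
next
  assume "\<exists>a\<in>A. at_least k (A - {a})"
  then obtain a B where "a \<in> A" "B \<subseteq> A - {a}" "finite B" "card B = k" by (auto simp: at_least_def)
  then show "at_least (Suc k) A"
    unfolding at_least_def by (intro exI[of _ "insert a B"]) (auto simp: card_insert_if subset_iff)
qed

lemma at_least_mono: "A \<subseteq> B \<Longrightarrow> at_least k A \<Longrightarrow> at_least k B"
  by (auto simp: at_least_def)

lemma at_least_antimono: "l \<le> k \<Longrightarrow> at_least k A \<Longrightarrow> at_least l A"
  unfolding at_least_def by (metis obtain_subset_with_card_n subset_trans finite_subset)

lemma at_least_finite: "finite A \<Longrightarrow> at_least k A \<longleftrightarrow> k \<le> card A"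
  unfolding at_least_def by (metis card_mono obtain_subset_with_card_n finite_subset)

lemma infinite_iff_at_least: "infinite A \<longleftrightarrow> (\<forall>k. at_least k A)"
proof
  show "infinite A \<Longrightarrow> \<forall>k. at_least k A"
    unfolding at_least_def by (meson infinite_arbitrarily_large)
  show "\<forall>k. at_least k A \<Longrightarrow> infinite A"
    using at_least_finite[of A] Suc_n_not_le_n by blast
qed

lemma tuples_upd: "x \<in> tuples M n \<Longrightarrow> a \<in> univ M \<Longrightarrow> x(n := a) \<in> tuples M (Suc n)"
  by (auto simp: tuples_iff)

lemma tuples_Suc:
  assumes "z \<in> tuples M (Suc n)"
  shows "tup n z \<in> tuples M n" "z n \<in> univ M" "(tup n z)(n := z n) = z"
  using assms by (auto simp: tuples_iff fun_eq_iff tup_def)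

text \<open>Arrays with \<open>n\<close> rows of length \<open>k\<close> are stored in one tuple of
  length \<open>n * k\<close>, with entry \<open>(j, l)\<close> at position
  \<open>j * k + l\<close>, so that a single tuple quantifier ranges over them.\<close>

lemma index_bound: "j * k + l < n * k" if "j < n" "l < k" for j k l n :: nat
proof -
  have "j * k + l < Suc j * k" using that by simp
  also have "\<dots> \<le> n * k" using that by (intro mult_le_mono1) simp
  finally show ?thesis .
qed

lemma div_mod_bound: "i div k < n" "i mod k < k" if "i < n * k" for i k n :: nat
  using that by (simp_all add: less_mult_imp_div_less) (cases k; simp)

text \<open>When a set \<open>C = F \<inter> Q\<close> is added, consider the place \<open>V\<close>
  where the old union agrees with one of its members. Either the old union inside \<open>V\<close>
  lies in the closure of \<open>C\<close>, hence in \<open>F\<close>, and the whole union agrees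
  with \<open>C\<close> on \<open>V \<inter> Q\<close>; or removing the closure of \<open>C\<close>
  from \<open>V\<close> leaves a place where the old member still works.\<close>

lemma finite_union_locally_closed:
  assumes "finite \<C>" "\<C> \<noteq> {}" "\<Union>\<C> \<noteq> {}" "\<Union>\<C> \<subseteq> topspace X"
    and "\<And>C. C \<in> \<C> \<Longrightarrow> \<exists>F Q. closedin X F \<and> openin X Q \<and> C = F \<inter> Q"
  shows "\<exists>C\<in>\<C>. \<exists>V. openin X V \<and> V \<inter> \<Union>\<C> \<noteq> {} \<and> V \<inter> \<Union>\<C> \<subseteq> C"
  using assms
proof (induction \<C> rule: finite_induct)
  case (insert C \<C>)
  show ?case
  proof (cases "\<Union>\<C> = {}")
    case True
    then show ?thesis using insert.prems by (intro bexI[of _ C] exI[of _ "topspace X"]) auto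
  next
    case False
    then have "\<exists>C\<in>\<C>. \<exists>V. openin X V \<and> V \<inter> \<Union>\<C> \<noteq> {} \<and> V \<inter> \<Union>\<C> \<subseteq> C"
      using insert by auto
    then obtain C' V where V: "C' \<in> \<C>" "openin X V" "V \<inter> \<Union>\<C> \<noteq> {}" "V \<inter> \<Union>\<C> \<subseteq> C'" by blast
    obtain F Q where F: "closedin X F" "C = F \<inter> Q" and Q: "openin X Q"
      using insert.prems(4)[of C] by blast
    have clC: "X closure_of C \<subseteq> F" using F by (simp add: closure_of_minimal)
    have C: "C \<subseteq> X closure_of C"
      using insert.prems(3) by (intro closure_of_subset) auto
    show ?thesis
    proof (cases "V \<inter> \<Union>\<C> \<subseteq> (X closure_of C)")
      case True
      obtain p where "p \<in> V" "p \<in> X closure_of C" using True V(3) by blast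
      then have "V \<inter> C \<noteq> {}" using V(2) unfolding in_closure_of by blast
      moreover have "V \<inter> Q \<inter> \<Union>(insert C \<C>) \<subseteq> C" using True clC F(2) by auto
      ultimately show ?thesis using openin_Int[OF V(2) Q] F(2)
        by (intro bexI[of _ C] exI[of _ "V \<inter> Q"]) auto
    next
      case False
      have "openin X (V - X closure_of C)" using V(2) by (simp add: openin_diff)
      then show ?thesis using False V C
        by (intro bexI[of _ C'] exI[of _ "V - X closure_of C"]) auto
    qed
  qed
qed simp

lemma cat_mem_Collect_iff:
  assumes "x \<in> tuples M n" "y \<in> tuples M m"
  shows "cat n x y \<in> {cat n x y |x y. x \<in> tuples M n \<and> y \<in> tuples M m \<and> P x y} \<longleftrightarrow> P x y"
proof
  assume "cat n x y \<in> {cat n x y |x y. x \<in> tuples M n \<and> y \<in> tuples M m \<and> P x y}"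
  then obtain x' y' where "cat n x y = cat n x' y'" "x' \<in> tuples M n" "P x' y'" by blast
  then show "P x y" using cat_eq_iff[OF assms(1)] by auto
qed (use assms in blast)

text \<open>As \<open>U\<close> is open, local data in the subspace \<open>U\<close> are local data
  in the ambient space; this removes the nested subtopologies.\<close>

lemma continuous_correspondenceE:
  assumes "continuous_correspondence (subtopology X U) Z k f" "openin X U" "x \<in> U"
  obtains V g where "openin X V" "x \<in> V" "V \<subseteq> U"
    "\<forall>l<k. continuous_map (subtopology X V) Z (g l)"
    "\<forall>v\<in>V. f v = {g l v |l. l < k}"
proof -
  have x: "x \<in> topspace (subtopology X U)" using assms(2,3) openin_subset by auto
  have *: "\<forall>x\<in>topspace (subtopology X U). \<exists>V g. openin (subtopology X U) V \<and> x \<in> V \<and>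
        (\<forall>i<k. continuous_map (subtopology (subtopology X U) V) Z (g i)) \<and>
        (\<forall>v\<in>V. f v = {g i v |i. i < k})"
    using assms(1) unfolding continuous_correspondence_def by (rule conjunct2)
  from bspec[OF * x] obtain V g where V: "openin (subtopology X U) V" "x \<in> V"
    and g: "\<forall>i<k. continuous_map (subtopology (subtopology X U) V) Z (g i)"
    and f: "\<forall>v\<in>V. f v = {g i v |i. i < k}"
    by (elim exE conjE)
  have VU: "V \<subseteq> U" "openin X V" using V(1) assms(2) by (auto simp: openin_open_subtopology)
  then have "subtopology (subtopology X U) V = subtopology X V"
    by (simp add: subtopology_subtopology Int_absorb1)
  then show thesis using that[of V g] VU V(2) g f by simp
qed

text \<open>The definable basis is fixed by names: \<open>Y\<close> is the set of indices, which are
  \<open>K\<close>-tuples, and \<open>BX\<close> is the incidence relation between points and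
  indices. Saturation enters in the form of descending sequences of definable sets in one
  variable.\<close>

locale t_minimal_structure = fo_structure L M
  for L :: "('f, 'p) language" and M :: "('f, 'p, 'm) fo_struct" +
  fixes \<tau> :: "'m topology" and K :: nat and BX Y :: "(nat \<Rightarrow> 'm) set"
  assumes countably_saturated:
    "\<And>X. (\<And>k::nat. definable L M 1 (X k)) \<Longrightarrow> (\<And>k. X (Suc k) \<subseteq> X k) \<Longrightarrow>
       (\<And>k. X k \<noteq> {}) \<Longrightarrow> \<exists>x. \<forall>k. x \<in> X k"
    and topspace_\<tau>: "topspace \<tau> = univ M"
    and Hausdorff_\<tau>: "Hausdorff_space \<tau>"
    and definable_BX: "definable L M (1 + K) BX"
    and definable_Y: "definable L M K Y"
    and basis_\<tau>: "is_basis \<tau> ((\<lambda>b. {a \<in> univ M. cat 1 (tup 1 (\<lambda>_. a)) b \<in> BX}) ` Y)"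
    and interior_iff: "\<And>D. definable1 L M D \<Longrightarrow> \<tau> interior_of D \<noteq> {} \<longleftrightarrow> infinite D"
    and niceness: "nice L M \<tau>"
begin

definition Bs :: "(nat \<Rightarrow> 'm) \<Rightarrow> 'm set" where
  "Bs b = {a \<in> univ M. cat 1 (tup 1 (\<lambda>_. a)) b \<in> BX}"

abbreviation "ptop \<equiv> power_top \<tau>"

lemma Bs_subset: "Bs b \<subseteq> univ M"
  by (auto simp: Bs_def)

lemma Y_tuples: "b \<in> Y \<Longrightarrow> b \<in> tuples M K"
  using definable_subset[OF definable_Y] by auto

lemma open_Bs: "b \<in> Y \<Longrightarrow> openin \<tau> (Bs b)"
  using basis_\<tau> unfolding is_basis_def Bs_def
  by (metis (no_types, lifting) arbitrary_union_of_inc image_eqI)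

lemma ex_Bs:
  assumes "openin \<tau> U" "a \<in> U"
  shows "\<exists>b\<in>Y. a \<in> Bs b \<and> Bs b \<subseteq> U"
proof -
  have "(arbitrary union_of (\<lambda>B. B \<in> Bs ` Y)) U"
    using assms(1) basis_\<tau> by (simp add: is_basis_def Bs_def[abs_def])
  then obtain \<U> where "\<U> \<subseteq> Bs ` Y" "\<Union>\<U> = U"
    by (auto simp: union_of_def)
  then show ?thesis using assms(2) by blast
qed

lemma dp_Bs:
  assumes "dt f" "\<And>j. j < K \<Longrightarrow> dt (\<lambda>e. g e j)" "\<And>e j. \<not> j < K \<Longrightarrow> g e j = undefined"
  shows "dp (\<lambda>e. f e \<in> Bs (g e))"
proof -
  have "dp (\<lambda>e. cat 1 (tup 1 (\<lambda>_. f e)) (g e) \<in> BX)"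
    by (rule dp_mem[OF definable_BX]) (auto intro!: dt_intros assms simp: cat_def)
  then show ?thesis unfolding Bs_def using dp_conj[OF dp_univ[OF assms(1)]] by simp
qed

lemma definable1I:
  assumes "dp (\<lambda>e. P (e 0 0))"
  shows "definable1 L M {a \<in> univ M. P a}"
proof -
  have "definable L M 1 {x \<in> tuples M 1. P (x 0)}"
    by (rule definableI) (use assms in simp)
  moreover have "{x \<in> tuples M 1. x 0 \<in> {a \<in> univ M. P a}} = {x \<in> tuples M 1. P (x 0)}" by auto
  ultimately show ?thesis by (simp add: definable1_def)
qed

lemma infinite_definable:
  assumes "dp (\<lambda>e. P (e 0 0))" "infinite {a \<in> univ M. P a}"
  shows "\<exists>b\<in>Y. Bs b \<noteq> {} \<and> Bs b \<subseteq> {a \<in> univ M. P a}"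
proof -
  obtain a where a: "a \<in> \<tau> interior_of {a \<in> univ M. P a}"
    using interior_iff[OF definable1I[OF assms(1)]] assms(2) by auto
  from ex_Bs[OF openin_interior_of a] show ?thesis
    using interior_of_subset by fast
qed

text \<open>A set without its interior has empty interior, so t-minimality makes it finite as soon
  as it is definable.\<close>

lemma finite_diff_interior:
  assumes "dp (\<lambda>e. P (e 0 0))" "{a \<in> univ M. P a} = E - \<tau> interior_of E"
  shows "finite {a \<in> univ M. P a}"
proof -
  have "\<tau> interior_of (E - \<tau> interior_of E) = {}"
    by (meson Diff_eq_empty_iff Diff_subset disjoint_iff interior_of_mono interior_of_subset
        subsetD subset_empty subsetI Diff_iff)
  then show ?thesis using interior_iff[OF definable1I[OF assms(1)]] assms(2) by auto
qed

text \<open>Here t-minimality is used in the other direction, where it excludes isolated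
  points.\<close>

lemma infinite_Bs:
  assumes "b \<in> Y" "Bs b \<noteq> {}"
  shows "infinite (Bs b)"
proof -
  have "dp (\<lambda>e. e 0 0 \<in> Bs b)"
    using Y_tuples[OF assms(1)] by (intro dp_Bs dt_var) (auto intro: dt_const)
  from interior_iff[OF definable1I[OF this]] show ?thesis
    using open_Bs[OF assms(1)] assms(2) Bs_subset[of b]
    by (simp add: Collect_conj_eq Int_absorb1 interior_of_openin)
qed

lemma infinite_open: "openin \<tau> U \<Longrightarrow> U \<noteq> {} \<Longrightarrow> infinite U"
  by (metis all_not_in_conv ex_Bs infinite_Bs infinite_super)

text \<open>Projecting away the last coordinate gives a common point \<open>x\<close> of all
  projections by induction. The fibres over \<open>x\<close> are then a descending sequence of
  non-empty definable sets in one variable.\<close>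

lemma saturated_tuples:
  assumes "\<And>k::nat. definable L M n (X k)" "\<And>k. X (Suc k) \<subseteq> X k" "\<And>k. X k \<noteq> {}"
  shows "\<exists>x. \<forall>k. x \<in> X k"
  using assms
proof (induction n arbitrary: X)
  case 0
  have "X k \<subseteq> {\<lambda>_. undefined}" for k using definable_subset[OF 0(1)] by simp
  then show ?case using 0(3) by blast
next
  case (Suc n)
  define P where "P k = {x \<in> tuples M n. \<exists>a\<in>univ M. x(n := a) \<in> X k}" for k
  have "definable L M n (P k)" for k
    unfolding P_def
    apply (rule definableI)
    apply (rule dp_ex1[where i = 1])
     apply (rule dp_mem[OF Suc.prems(1)])
    by (auto intro!: dt_intros)
  moreover have "P (Suc k) \<subseteq> P k" for k using Suc.prems(2) by (auto simp: P_def)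
  moreover have "P k \<noteq> {}" for k
  proof -
    obtain z where "z \<in> X k" using Suc.prems(3) by blast
    moreover from this have "z \<in> tuples M (Suc n)" using definable_subset[OF Suc.prems(1)] by auto
    ultimately have "tup n z \<in> P k"
      using tuples_Suc[of z M n] unfolding P_def by (metis (mono_tags, lifting) mem_Collect_eq)
    then show ?thesis by blast
  qed
  ultimately obtain x where x: "\<And>k. x \<in> P k" using Suc.IH by meson
  then have xt: "x \<in> tuples M n" by (auto simp: P_def)
  define A where "A k = {y \<in> tuples M 1. x(n := y 0) \<in> X k}" for k
  have "definable L M 1 (A k)" for k
    unfolding A_def
    apply (rule definableI)
    apply (rule dp_mem[OF Suc.prems(1)])
    using xt by (auto intro!: dt_intros simp: tuples_iff)
  moreover have "A (Suc k) \<subseteq> A k" for k using Suc.prems(2) by (auto simp: A_def)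
  moreover have "A k \<noteq> {}" for k
  proof -
    obtain a where "a \<in> univ M" "x(n := a) \<in> X k" using x[of k] by (auto simp: P_def)
    then have "tup 1 (\<lambda>_. a) \<in> A k" by (auto simp: A_def tup_in_tuples_iff)
    then show ?thesis by blast
  qed
  ultimately obtain y where "\<And>k. y \<in> A k" using countably_saturated by meson
  then show ?case by (auto simp: A_def)
qed

text \<open>The induction enlarges the base: over a point \<open>(x, y)\<close>, the fibre of
  \<open>R'\<close> is the fibre of \<open>R\<close> over \<open>x\<close> with \<open>y\<close>
  removed, which is what \<open>at_least_Suc\<close> asks for.\<close>

lemma definable_at_least:
  assumes "definable L M (n + m) R"
  shows "definable L M n {x \<in> tuples M n. at_least k {y \<in> tuples M m. cat n x y \<in> R}}"
  using assms
proof (induction k arbitrary: n R)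
  case 0
  then show ?case by (simp add: at_least_0 definable_tuples)
next
  case (Suc k)
  define R' where "R' = {cat (n + m) z y |z y. z \<in> tuples M (n + m) \<and> y \<in> tuples M m \<and>
    cat n (tup n z) y \<in> R \<and> y \<noteq> tup m (\<lambda>j. z (n + j))}"
  have R': "definable L M (n + m + m) R'"
    unfolding R'_def
    apply (rule definable2I)
    apply (rule dp_conj)
     apply (rule dp_mem[OF Suc.prems])
      apply (intro dt_intros; simp)
     apply (simp add: cat_def)
    apply (rule dp_not)
    apply (rule dp_tup_eq[where n = m])
       apply (intro dt_intros; simp)+
     apply simp_all
    done
  define S where "S = {z \<in> tuples M (n + m). at_least k {y \<in> tuples M m. cat (n + m) z y \<in> R'}}"
  have S: "definable L M (n + m) S"
    unfolding S_def by (rule Suc.IH[OF R'])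
  have "definable L M n {x \<in> tuples M n. \<exists>y\<in>tuples M m. cat n x y \<in> R \<and> cat n x y \<in> S}"
    apply (rule definableI)
    apply (rule dp_ex[where i = 1])
     apply (intro dp_intros dp_mem[OF S] dp_mem[OF Suc.prems])
    by (auto intro!: dt_intros simp: cat_def)
  moreover have "at_least (Suc k) {y \<in> tuples M m. cat n x y \<in> R} \<longleftrightarrow>
    (\<exists>y\<in>tuples M m. cat n x y \<in> R \<and> cat n x y \<in> S)" if x: "x \<in> tuples M n" for x
  proof -
    have "{y' \<in> tuples M m. cat (n + m) (cat n x y) y' \<in> R'} = {y \<in> tuples M m. cat n x y \<in> R} - {y}"
      if y: "y \<in> tuples M m" for y
    proof -
      have "tup n (cat n x y) = x" "tup m (\<lambda>j. cat n x y (n + j)) = y"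
        using x y by (auto simp: tup_def cat_def fun_eq_iff tuples_iff)
      moreover have "cat n x y \<in> tuples M (n + m)" by (rule cat_tuples[OF x y])
      ultimately show ?thesis
        unfolding R'_def using cat_eq_iff[of _ M "n + m"] by auto
    qed
    then show ?thesis unfolding at_least_Suc S_def
      using cat_tuples[OF x] by auto
  qed
  ultimately show ?case by (simp cong: conj_cong)
qed

text \<open>The conditions of having at least \<open>k\<close> points descend in \<open>k\<close>,
  so saturation satisfies all of them at once. It is mostly used in contraposition: in a definable
  family of finite sets the cardinalities are bounded.\<close>

lemma uniform_finiteness:
  assumes "definable L M (n + m) R"
    and "\<And>k. \<exists>x\<in>tuples M n. at_least k {y \<in> tuples M m. cat n x y \<in> R}"
  shows "\<exists>x\<in>tuples M n. infinite {y \<in> tuples M m. cat n x y \<in> R}"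
proof -
  have "\<exists>x. \<forall>k. x \<in> {x \<in> tuples M n. at_least k {y \<in> tuples M m. cat n x y \<in> R}}"
  proof (intro saturated_tuples[where n = n] definable_at_least[OF assms(1)])
    show "{x \<in> tuples M n. at_least (Suc k) {y \<in> tuples M m. cat n x y \<in> R}}
        \<subseteq> {x \<in> tuples M n. at_least k {y \<in> tuples M m. cat n x y \<in> R}}" for k
      using at_least_antimono[of k "Suc k"] by auto
    show "{x \<in> tuples M n. at_least k {y \<in> tuples M m. cat n x y \<in> R}} \<noteq> {}" for k
      using assms(2)[of k] by blast
  qed
  then show ?thesis unfolding infinite_iff_at_least by blast
qed

section \<open>Boxes and the definability of interiors\<close>

definition box :: "nat \<Rightarrow> (nat \<Rightarrow> nat \<Rightarrow> 'm) \<Rightarrow> (nat \<Rightarrow> 'm) set" where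
  "box n b = (\<Pi>\<^sub>E j\<in>{..<n}. Bs (b j))"

lemma topspace_top [simp]: "topspace (ptop n) = tuples M n"
  by (simp add: power_top_def topspace_\<tau> tuples_def)

lemma Hausdorff_top: "Hausdorff_space (ptop n)"
  by (simp add: power_top_def Hausdorff_space_product_topology Hausdorff_\<tau>)

lemma box_iff:
  "x \<in> box n b \<longleftrightarrow> x \<in> tuples M n \<and> (\<forall>j<n. x j \<in> Bs (b j))"
  using Bs_subset by (auto simp: box_def tuples_iff PiE_iff extensional_def)

lemma open_box: "(\<And>j. j < n \<Longrightarrow> b j \<in> Y) \<Longrightarrow> openin (ptop n) (box n b)"
  unfolding power_top_def box_def by (subst openin_PiE) (auto intro: open_Bs)

lemma ex_box:
  assumes "openin (ptop n) U" "x \<in> U"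
  shows "\<exists>b. (\<forall>j<n. b j \<in> Y) \<and> x \<in> box n b \<and> box n b \<subseteq> U"
proof -
  obtain V where V: "\<And>j. j < n \<Longrightarrow> openin \<tau> (V j)" "x \<in> Pi\<^sub>E {..<n} V" "Pi\<^sub>E {..<n} V \<subseteq> U"
    using assms unfolding power_top_def openin_product_topology_alt by (metis lessThan_iff)
  have "\<exists>b\<in>Y. x j \<in> Bs b \<and> Bs b \<subseteq> V j" if "j < n" for j
    using V(1,2) that by (intro ex_Bs) auto
  then obtain b where b: "\<And>j. j < n \<Longrightarrow> b j \<in> Y \<and> x j \<in> Bs (b j) \<and> Bs (b j) \<subseteq> V j" by metis
  have "box n b \<subseteq> Pi\<^sub>E {..<n} V" unfolding box_def by (rule PiE_mono) (use b in auto)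
  moreover have "x \<in> extensional {..<n}" using V(2) by (simp add: PiE_iff)
  then have "x \<in> box n b" unfolding box_def by (intro PiE_I) (simp_all add: b extensional_def)
  ultimately show ?thesis using V(3) b by (intro exI[of _ b]) auto
qed

lemma definable_box:
  assumes "\<And>j. j < n \<Longrightarrow> b j \<in> Y"
  shows "definable L M n (box n b)"
proof -
  have "definable L M n {x \<in> tuples M n. \<forall>j<n. x j \<in> Bs (b j)}"
    apply (rule definableI)
    apply (intro dp_intros dp_Bs)
    using Y_tuples[OF assms] by (auto intro!: dt_intros)
  then show ?thesis by (simp add: box_iff[symmetric] cong: conj_cong)
qed

lemma definable_interior:
  assumes "definable L M n D"
  shows "definable L M n (ptop n interior_of D)"
proof -
  \<comment> \<open>The \<open>n\<close> indices of a box are \<open>K\<close>-tuples; they are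
    quantified as one tuple \<open>w\<close>, from which \<open>s j\<close> cuts out the one for
    direction \<open>j\<close>.\<close>
  define s where "s j w = tup K (\<lambda>l. w (j * K + l))" for j and w :: "nat \<Rightarrow> 'm"
  have "definable L M n {x \<in> tuples M n. \<exists>w\<in>tuples M (n * K).
      (\<forall>j<n. s j w \<in> Y \<and> x j \<in> Bs (s j w)) \<and>
      (\<forall>x'\<in>tuples M n. (\<forall>j<n. x' j \<in> Bs (s j w)) \<longrightarrow> x' \<in> D)}"
    unfolding s_def
    apply (rule definableI)
    apply (rule dp_ex[where i = 1])
     apply (intro dp_conj dp_all_less)
       apply (rule dp_mem[OF definable_Y]; (intro dt_intros)?; simp add: index_bound)
      apply (rule dp_Bs; (intro dt_intros)?; simp add: index_bound)
     apply (rule dp_all[where i = 2])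
      apply (intro dp_imp dp_all_less)
       apply (rule dp_Bs; (intro dt_intros)?; simp add: index_bound)
      apply (rule dp_mem[OF assms]; (intro dt_intros)?; simp add: index_bound)
     apply simp_all
    done
  moreover have "x \<in> ptop n interior_of D \<longleftrightarrow> (\<exists>w\<in>tuples M (n * K).
      (\<forall>j<n. s j w \<in> Y \<and> x j \<in> Bs (s j w)) \<and>
      (\<forall>x'\<in>tuples M n. (\<forall>j<n. x' j \<in> Bs (s j w)) \<longrightarrow> x' \<in> D))" (is "_ \<longleftrightarrow> ?r")
    if "x \<in> tuples M n" for x
  proof
    assume "x \<in> ptop n interior_of D"
    then obtain b where b: "\<forall>j<n. b j \<in> Y" "x \<in> box n b" "box n b \<subseteq> D"
      using ex_box[OF openin_interior_of] interior_of_subset[of "ptop n" D] by (meson subset_trans)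
    define w where "w = tup (n * K) (\<lambda>i. b (i div K) (i mod K))"
    have "s j w = b j" if "j < n" for j
      using b(1) Y_tuples that
      by (intro tuples_eqI[of _ M K]) (auto simp: s_def w_def index_bound tup_in_tuples_iff)
    moreover have "w \<in> tuples M (n * K)"
      unfolding w_def tup_in_tuples_iff
    proof (intro allI impI)
      fix i assume "i < n * K"
      then have "i div K < n" "i mod K < K" by (rule div_mod_bound)+
      then show "b (i div K) (i mod K) \<in> univ M" using b(1) Y_tuples by blast
    qed
    ultimately show ?r using b by (intro bexI[of _ w]) (auto simp: box_iff)
  next
    assume ?r
    then obtain w where w: "\<forall>j<n. s j w \<in> Y \<and> x j \<in> Bs (s j w)"
      "\<forall>x'\<in>tuples M n. (\<forall>j<n. x' j \<in> Bs (s j w)) \<longrightarrow> x' \<in> D" by blast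
    let ?B = "box n (\<lambda>j. s j w)"
    have "openin (ptop n) ?B" using w by (intro open_box) auto
    moreover have "x \<in> ?B" "?B \<subseteq> D" using w that by (auto simp: box_iff)
    ultimately show "x \<in> ptop n interior_of D" by (auto simp: interior_of_def)
  qed
  moreover have "ptop n interior_of D \<subseteq> tuples M n"
    by (metis interior_of_subset_topspace topspace_top)
  ultimately show ?thesis
    by (elim back_subst[of "definable L M n"]) auto
qed

text \<open>The broad sets of the overview are those with a grid for every \<open>k\<close>. The
  size is kept as an argument because only for fixed \<open>k\<close> is the condition
  first-order.\<close>

definition has_grid :: "nat \<Rightarrow> nat \<Rightarrow> (nat \<Rightarrow> 'm) set \<Rightarrow> bool" where
  "has_grid n k S \<longleftrightarrow> (\<exists>A. (\<forall>j<n. A j \<subseteq> univ M \<and> finite (A j) \<and> card (A j) = k) \<and> Pi\<^sub>E {..<n} A \<subseteq> S)"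

lemma has_grid_mono: "S \<subseteq> S' \<Longrightarrow> has_grid n k S \<Longrightarrow> has_grid n k S'"
  unfolding has_grid_def by (meson subset_trans)

lemma has_grid_antimono:
  assumes "l \<le> k" "has_grid n k S"
  shows "has_grid n l S"
proof -
  obtain A where A: "\<And>j. j < n \<Longrightarrow> A j \<subseteq> univ M \<and> finite (A j) \<and> card (A j) = k" "Pi\<^sub>E {..<n} A \<subseteq> S"
    using assms(2) unfolding has_grid_def by metis
  have "\<exists>B\<subseteq>A j. finite B \<and> card B = l" if "j < n" for j
    using A(1)[OF that] assms(1) by (metis obtain_subset_with_card_n)
  then obtain B where B: "\<And>j. j < n \<Longrightarrow> B j \<subseteq> A j \<and> finite (B j) \<and> card (B j) = l" by metis
  have "Pi\<^sub>E {..<n} B \<subseteq> Pi\<^sub>E {..<n} A" by (rule PiE_mono) (use B in auto)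
  then show ?thesis unfolding has_grid_def using A B
    by (intro exI[of _ B] conjI allI impI) (meson subset_trans)+
qed

lemma has_grid_Suc:
  assumes "\<And>j. j < n \<Longrightarrow> A j \<subseteq> univ M \<and> finite (A j) \<and> card (A j) = k"
    and "F \<subseteq> univ M" "finite F" "card F = k"
    and "\<And>x a. x \<in> Pi\<^sub>E {..<n} A \<Longrightarrow> a \<in> F \<Longrightarrow> x(n := a) \<in> S"
  shows "has_grid (Suc n) k S"
  unfolding has_grid_def
proof (intro exI conjI subsetI)
  show "\<forall>j<Suc n. (A(n := F)) j \<subseteq> univ M \<and> finite ((A(n := F)) j) \<and> card ((A(n := F)) j) = k"
    using assms by (auto simp: less_Suc_eq)
  fix y assume y: "y \<in> Pi\<^sub>E {..<Suc n} (A(n := F))"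
  have "y = (tup n y)(n := y n)"
    using y by (auto simp: fun_eq_iff tup_def PiE_iff extensional_def)
  moreover have "tup n y \<in> Pi\<^sub>E {..<n} A"
    using y by (auto simp: tup_def PiE_iff Ball_def) (metis less_SucI nat_neq_iff)
  moreover have "y n \<in> F" using PiE_mem[OF y, of n] by simp
  ultimately show "y \<in> S" using assms(5) by metis
qed

text \<open>The tuple \<open>w\<close> enumerates all \<open>n\<close> factors of a grid,
  \<open>k\<close> entries for each; this predicate forbids repetitions within a factor, and
  \<open>grid_point\<close> describes the points of the product.\<close>

definition grid_index :: "nat \<Rightarrow> nat \<Rightarrow> (nat \<Rightarrow> 'm) \<Rightarrow> bool" where
  "grid_index n k w \<longleftrightarrow> (\<forall>j<n. \<forall>l<k. \<forall>l'<k. l \<noteq> l' \<longrightarrow> w (j * k + l) \<noteq> w (j * k + l'))"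

definition grid_point :: "nat \<Rightarrow> nat \<Rightarrow> (nat \<Rightarrow> 'm) \<Rightarrow> (nat \<Rightarrow> 'm) \<Rightarrow> bool" where
  "grid_point n k w x \<longleftrightarrow> (\<forall>j<n. \<exists>l<k. x j = w (j * k + l))"

lemma has_grid_iff:
  "has_grid n k S \<longleftrightarrow> (\<exists>w\<in>tuples M (n * k). grid_index n k w \<and>
     (\<forall>x\<in>tuples M n. grid_point n k w x \<longrightarrow> x \<in> S))"
proof
  assume "has_grid n k S"
  then obtain A where A: "\<And>j. j < n \<Longrightarrow> A j \<subseteq> univ M \<and> finite (A j) \<and> card (A j) = k"
    "Pi\<^sub>E {..<n} A \<subseteq> S"
    unfolding has_grid_def by metis
  have "\<exists>h. bij_betw h {..<k} (A j)" if "j < n" for j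
    using A(1)[OF that] ex_bij_betw_nat_finite[of "A j"] by (auto simp: atLeast0LessThan)
  then obtain h where h: "\<And>j. j < n \<Longrightarrow> bij_betw (h j) {..<k} (A j)" by metis
  define w where "w = tup (n * k) (\<lambda>i. h (i div k) (i mod k))"
  have w: "w (j * k + l) = h j l" if "j < n" "l < k" for j l
    using that by (simp add: w_def index_bound)
  have hA: "h j l \<in> A j" if "j < n" "l < k" for j l
    using h[OF that(1)] that(2) by (auto simp: bij_betw_def)
  have "w \<in> tuples M (n * k)"
    unfolding w_def tup_in_tuples_iff
  proof (intro allI impI)
    fix i assume i: "i < n * k"
    then have "i div k < n" "i mod k < k" by (rule div_mod_bound)+
    then show "h (i div k) (i mod k) \<in> univ M" using hA A(1) by blast
  qed
  moreover have "grid_index n k w"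
    unfolding grid_index_def using w h by (auto simp: bij_betw_def inj_on_def)
  moreover have "x \<in> S" if "x \<in> tuples M n" "grid_point n k w x" for x
  proof -
    have "x j \<in> A j" if "j < n" for j
      using \<open>grid_point n k w x\<close> that w hA unfolding grid_point_def by metis
    then have "x \<in> Pi\<^sub>E {..<n} A" using that by (auto simp: PiE_iff extensional_def tuples_iff)
    then show ?thesis using A(2) by blast
  qed
  ultimately show "\<exists>w\<in>tuples M (n * k). grid_index n k w \<and>
     (\<forall>x\<in>tuples M n. grid_point n k w x \<longrightarrow> x \<in> S)" by blast
next
  assume "\<exists>w\<in>tuples M (n * k). grid_index n k w \<and>
     (\<forall>x\<in>tuples M n. grid_point n k w x \<longrightarrow> x \<in> S)"
  then obtain w where w: "w \<in> tuples M (n * k)" "grid_index n k w"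
    "\<And>x. x \<in> tuples M n \<Longrightarrow> grid_point n k w x \<Longrightarrow> x \<in> S" by blast
  define A where "A j = (\<lambda>l. w (j * k + l)) ` {..<k}" for j
  have "A j \<subseteq> univ M" if "j < n" for j
    using w(1) that by (auto simp: A_def tuples_iff index_bound)
  moreover have "card (A j) = k" if "j < n" for j
  proof -
    have "inj_on (\<lambda>l. w (j * k + l)) {..<k}"
      using w(2) that unfolding grid_index_def inj_on_def by (metis lessThan_iff)
    then show ?thesis by (simp add: A_def card_image)
  qed
  moreover have "finite (A j)" for j by (simp add: A_def)
  moreover have "Pi\<^sub>E {..<n} A \<subseteq> S"
  proof
    fix x assume x: "x \<in> Pi\<^sub>E {..<n} A"
    then have "x \<in> tuples M n"
      using \<open>\<And>j. j < n \<Longrightarrow> A j \<subseteq> univ M\<close> by (fastforce simp: tuples_def PiE_iff)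
    moreover have "grid_point n k w x" using x by (auto simp: grid_point_def A_def PiE_iff)
    ultimately show "x \<in> S" by (rule w(3))
  qed
  ultimately show "has_grid n k S" unfolding has_grid_def by (intro exI[of _ A]) auto
qed

text \<open>Non-empty basic sets are infinite, so each factor of a box contains \<open>k\<close>
  points.\<close>

lemma open_has_grid:
  assumes "openin (ptop n) U" "U \<noteq> {}"
  shows "has_grid n k U"
proof -
  obtain x b where b: "\<And>j. j < n \<Longrightarrow> b j \<in> Y" "x \<in> box n b" "box n b \<subseteq> U"
    using ex_box[OF assms(1)] assms(2) by blast
  have "\<exists>A\<subseteq>Bs (b j). finite A \<and> card A = k" if "j < n" for j
    using infinite_Bs[OF b(1)[OF that]] b(2) that infinite_arbitrarily_large
    by (metis box_iff empty_iff)
  then obtain A where A: "\<And>j. j < n \<Longrightarrow> A j \<subseteq> Bs (b j) \<and> finite (A j) \<and> card (A j) = k" by metis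
  have "Pi\<^sub>E {..<n} A \<subseteq> box n b" unfolding box_def by (rule PiE_mono) (use A in auto)
  then have "Pi\<^sub>E {..<n} A \<subseteq> U" using b(3) by (rule subset_trans)
  moreover have "A j \<subseteq> univ M" if "j < n" for j using A[OF that] Bs_subset by (meson subset_trans)
  ultimately show ?thesis unfolding has_grid_def using A by (intro exI[of _ A]) auto
qed

lemma open_cylinder:
  assumes "openin (ptop n) U" "openin \<tau> B"
  shows "openin (ptop (Suc n)) {y \<in> tuples M (Suc n). tup n y \<in> U \<and> y n \<in> B}"
proof -
  have "continuous_map (ptop (Suc n)) (ptop n) (tup n)"
    unfolding power_top_def tup_def
    by (intro continuous_map_componentwise[THEN iffD2])
      (auto intro!: continuous_map_product_projection)
  moreover have "continuous_map (ptop (Suc n)) \<tau> (\<lambda>y. y n)"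
    unfolding power_top_def by (intro continuous_map_product_projection) simp
  ultimately have "openin (ptop (Suc n)) {y \<in> topspace (ptop (Suc n)). tup n y \<in> U}"
    "openin (ptop (Suc n)) {y \<in> topspace (ptop (Suc n)). y n \<in> B}"
    using assms openin_continuous_map_preimage by blast+
  from openin_Int[OF this] show ?thesis
    by (rule back_subst[of "openin _"]) auto
qed

text \<open>
  The step from \<open>n\<close> to \<open>Suc n\<close> finds, for every \<open>k\<close>, a basic open set \<open>Bs b\<close> contained in the fibres over
  all points of a grid of size \<open>k\<close>, and then by saturation a single \<open>b\<close> that works for all \<open>k\<close>.
\<close>

lemma has_grid_interior:
  assumes "definable L M n D" "\<And>k. has_grid n k D"
  shows "ptop n interior_of D \<noteq> {}"
  using assms
proof (induction n arbitrary: D)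
  case 0
  have "(\<lambda>_. undefined) \<in> D"
    using "0.prems"(2)[of 0] by (auto simp: has_grid_def)
  then have "D = topspace (ptop 0)" using definable_subset[OF "0.prems"(1)] by auto
  then show ?case by (metis interior_of_topspace tuples_0 topspace_top insert_not_empty)
next
  case (Suc n)
  \<comment> \<open>Once a single \<open>b\<close> gives \<open>E b\<close> grids of every size, the
    induction hypothesis gives \<open>E b\<close> an interior, and the product of that interior with
    \<open>Bs b\<close> is an open subset of \<open>D\<close>.\<close>
  define E where "E b = {x \<in> tuples M n. \<forall>a\<in>univ M. a \<in> Bs b \<longrightarrow> x(n := a) \<in> D}" for b
  define S where "S k = {b \<in> tuples M K. b \<in> Y \<and> (\<exists>a\<in>univ M. a \<in> Bs b) \<and> has_grid n k (E b)}" for k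
  have S_def': "S k = {b \<in> tuples M K. b \<in> Y \<and> (\<exists>a\<in>univ M. a \<in> Bs b) \<and>
      (\<exists>w\<in>tuples M (n * k). grid_index n k w \<and>
         (\<forall>x\<in>tuples M n. grid_point n k w x \<longrightarrow> (\<forall>a\<in>univ M. a \<in> Bs b \<longrightarrow> x(n := a) \<in> D)))}" for k
    unfolding S_def has_grid_iff E_def by auto
  have "definable L M K (S k)" for k
    unfolding S_def' grid_index_def grid_point_def
    apply (rule definableI)
    apply (intro dp_conj)
      apply (rule dp_mem[OF definable_Y]; (intro dt_intros)?; simp add: index_bound)
     apply (rule dp_ex1[where i = 1])
      apply (rule dp_Bs; (intro dt_intros)?; simp add: index_bound)
     apply simp
    apply (rule dp_ex[where i = 1])
     apply (intro dp_conj dp_all_less dp_imp)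
       apply (rule dp_triv)
      apply (rule dp_not, rule dp_eq; (intro dt_intros)?; simp add: index_bound)
     apply (rule dp_all[where i = 2])
      apply (intro dp_imp dp_all_less dp_ex_less)
       apply (rule dp_eq; (intro dt_intros)?; simp add: index_bound)
      apply (rule dp_all1[where i = 3])
       apply (rule dp_imp)
        apply (rule dp_Bs; (intro dt_intros)?; simp add: index_bound)
       apply (rule dp_mem[OF Suc.prems(1)]; (intro dt_intros)?; simp add: index_bound)
      apply simp_all
    done
  moreover have "S (Suc k) \<subseteq> S k" for k
    unfolding S_def using has_grid_antimono[of k "Suc k"] by auto
  moreover have "S k \<noteq> {}" for k
  proof -
    \<comment> \<open>Here \<open>k\<close> is fixed while \<open>k'\<close> grows. Cutting the
      first \<open>n\<close> factors of a grid of size \<open>max k k'\<close> down to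
      \<open>k\<close> leaves at least \<open>k'\<close> admissible last coordinates; so by uniform
      finiteness some grid of size \<open>k\<close> admits infinitely many, and these contain a
      basic open set.\<close>
    define R where "R = {cat (n * k) w y |w y. w \<in> tuples M (n * k) \<and> y \<in> tuples M 1 \<and>
      grid_index n k w \<and> (\<forall>x\<in>tuples M n. grid_point n k w x \<longrightarrow> x(n := y 0) \<in> D)}"
    have fib: "{y \<in> tuples M 1. cat (n * k) w y \<in> R} = {y \<in> tuples M 1. grid_index n k w \<and>
        (\<forall>x\<in>tuples M n. grid_point n k w x \<longrightarrow> x(n := y 0) \<in> D)}"
      if "w \<in> tuples M (n * k)" for w
      unfolding R_def using cat_eq_iff[of _ M "n * k"] that by auto
    have R: "definable L M (n * k + 1) R"
      unfolding R_def grid_index_def grid_point_def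
      apply (rule definable2I)
      apply (intro dp_conj dp_all_less dp_imp)
        apply (rule dp_triv)
       apply (rule dp_not, rule dp_eq; (intro dt_intros)?; simp add: index_bound)
      apply (rule dp_all[where i = 3])
       apply (intro dp_imp dp_all_less dp_ex_less)
        apply (rule dp_eq; (intro dt_intros)?; simp add: index_bound)
       apply (rule dp_mem[OF Suc.prems(1)]; (intro dt_intros)?; simp add: index_bound)
      apply simp
      done
    have "\<exists>w\<in>tuples M (n * k). at_least k' {y \<in> tuples M 1. cat (n * k) w y \<in> R}" for k'
    proof -
      obtain A where A: "\<And>j. j < Suc n \<Longrightarrow> A j \<subseteq> univ M \<and> finite (A j) \<and> card (A j) = max k k'"
        "Pi\<^sub>E {..<Suc n} A \<subseteq> D"
        using Suc.prems(2)[of "max k k'"] unfolding has_grid_def by metis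
      have "has_grid n (max k k') (Pi\<^sub>E {..<n} A)"
        unfolding has_grid_def using A(1) by (intro exI[of _ A]) auto
      then have "has_grid n k (Pi\<^sub>E {..<n} A)" by (rule has_grid_antimono[rotated]) simp
      then obtain w where w: "w \<in> tuples M (n * k)" "grid_index n k w"
        "\<And>x. x \<in> tuples M n \<Longrightarrow> grid_point n k w x \<Longrightarrow> x \<in> Pi\<^sub>E {..<n} A"
        unfolding has_grid_iff by blast
      have "x(n := a) \<in> D" if "x \<in> Pi\<^sub>E {..<n} A" "a \<in> A n" for x a
      proof -
        have "x(n := a) \<in> Pi\<^sub>E {..<Suc n} A"
          using that by (auto simp: PiE_iff extensional_def less_Suc_eq)
        then show ?thesis using A(2) by blast
      qed
      then have "(\<lambda>a. tup 1 (\<lambda>_. a)) ` A n \<subseteq> {y \<in> tuples M 1. cat (n * k) w y \<in> R}"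
        unfolding fib[OF w(1)] using w A(1)[of n] by (auto simp: tup_in_tuples_iff)
      moreover have "inj_on (\<lambda>a. tup 1 (\<lambda>_. a)) (A n)"
        by (rule inj_on_inverseI[where g = "\<lambda>x. x 0"]) simp
      then have "at_least k' ((\<lambda>a. tup 1 (\<lambda>_. a)) ` A n)"
        using A(1)[of n] by (simp add: at_least_finite card_image)
      ultimately show ?thesis using w(1) at_least_mono by blast
    qed
    from uniform_finiteness[OF R this] obtain w where w: "w \<in> tuples M (n * k)"
      and inf: "infinite {y \<in> tuples M 1. cat (n * k) w y \<in> R}" by blast
    have gi: "grid_index n k w" using inf unfolding fib[OF w] by (metis (mono_tags, lifting) Collect_empty_eq finite.emptyI)
    have inf': "infinite {a \<in> univ M. \<forall>x\<in>tuples M n. grid_point n k w x \<longrightarrow> x(n := a) \<in> D}"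
    proof
      assume "finite {a \<in> univ M. \<forall>x\<in>tuples M n. grid_point n k w x \<longrightarrow> x(n := a) \<in> D}"
      then have "finite ((\<lambda>a. tup 1 (\<lambda>_. a)) ` {a \<in> univ M. \<forall>x\<in>tuples M n. grid_point n k w x \<longrightarrow> x(n := a) \<in> D})"
        by blast
      moreover have "y = tup 1 (\<lambda>_. y 0)" if "y \<in> tuples M 1" for y
        using that by (intro tuples_eqI[of _ M 1]) (auto simp: tup_in_tuples_iff)
      then have "{y \<in> tuples M 1. cat (n * k) w y \<in> R} \<subseteq>
          (\<lambda>a. tup 1 (\<lambda>_. a)) ` {a \<in> univ M. \<forall>x\<in>tuples M n. grid_point n k w x \<longrightarrow> x(n := a) \<in> D}"
        unfolding fib[OF w] by blast
      ultimately show False using inf finite_subset by blast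
    qed
    have "dp (\<lambda>e. \<forall>x\<in>tuples M n. grid_point n k w x \<longrightarrow> x(n := e 0 0) \<in> D)"
      unfolding grid_point_def
      using w
      apply (intro dp_all[where i = 1])
       apply (intro dp_imp dp_all_less dp_ex_less)
        apply (rule dp_eq; (intro dt_intros)?; simp add: index_bound tuples_iff)
       apply (rule dp_mem[OF Suc.prems(1)]; (intro dt_intros)?; simp add: index_bound)
      apply simp
      done
    from infinite_definable[OF this inf'] obtain b where b: "b \<in> Y" "Bs b \<noteq> {}"
      "Bs b \<subseteq> {a \<in> univ M. \<forall>x\<in>tuples M n. grid_point n k w x \<longrightarrow> x(n := a) \<in> D}" by blast
    have "b \<in> S k"
      unfolding S_def' using b gi w Y_tuples Bs_subset by blast
    then show ?thesis by blast
  qed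
  ultimately obtain b where "\<And>k. b \<in> S k" using saturated_tuples[where X = S] by meson
  then have b: "b \<in> Y" "Bs b \<noteq> {}" "\<And>k. has_grid n k (E b)" by (auto simp: S_def)
  have "definable L M n (E b)"
    unfolding E_def
    apply (rule definableI)
    apply (rule dp_all1[where i = 1])
     apply (intro dp_intros dp_Bs dp_mem[OF Suc.prems(1)])
    using Y_tuples[OF b(1)] by (auto intro!: dt_intros)
  then have "ptop n interior_of E b \<noteq> {}" using Suc.IH b(3) by blast
  then obtain x where x: "x \<in> ptop n interior_of E b" by blast
  obtain a where a: "a \<in> Bs b" using b(2) by blast
  let ?O = "{y \<in> tuples M (Suc n). tup n y \<in> ptop n interior_of E b \<and> y n \<in> Bs b}"
  have "?O \<subseteq> D"
  proof
    fix y assume y: "y \<in> ?O"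
    then have "tup n y \<in> E b" using interior_of_subset[of "ptop n"] by auto
    then have "(tup n y)(n := y n) \<in> D" using y Bs_subset by (auto simp: E_def)
    then show "y \<in> D" using y tuples_Suc(3)[of y M n] by simp
  qed
  then have "?O \<subseteq> ptop (Suc n) interior_of D"
    by (intro interior_of_maximal open_cylinder openin_interior_of open_Bs b)
  moreover have "x \<in> tuples M n" using x interior_of_subset_topspace[of "ptop n"] by auto
  then have "x(n := a) \<in> ?O" "a \<in> univ M"
    using x a tuples_upd[of x M n a] Bs_subset[of b] tup_tuples[of x M n]
      tup_cong[of n "x(n := a)" x]
    by auto
  ultimately show ?case by blast
qed

lemma open_subset_tuples: "openin (ptop n) U \<Longrightarrow> U \<subseteq> tuples M n"
  using openin_subset by fastforce

section \<open>Sets without interior\<close>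

lemma has_gridE:
  assumes "has_grid n k S"
  obtains A where "\<And>j. j < n \<Longrightarrow> A j \<subseteq> univ M \<and> finite (A j) \<and> card (A j) = k"
    "Pi\<^sub>E {..<n} A \<subseteq> S"
  using assms unfolding has_grid_def by blast

lemma definable_slice:
  assumes "definable L M (Suc n) X" "z \<in> univ M"
  shows "definable L M n {x \<in> tuples M n. x(n := z) \<in> X}"
  apply (rule definableI)
  apply (rule dp_mem[OF assms(1)])
   apply (rule dt_upd)
    apply (rule dt_const[OF assms(2)])
   apply (intro dt_intros; simp)
  apply simp
  done

text \<open>
  Shrinking an open set of \<open>M\<^sup>n\<close> successively along \<open>2 k\<close> values of the last coordinate decides membership in
  \<open>X\<close> for each of them, so either \<open>X\<close> or its complement gets a grid of size \<open>k\<close>.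
\<close>

lemma open_split:
  assumes "definable L M n X" "openin (ptop n) U" "U \<noteq> {}"
  shows "\<exists>V. openin (ptop n) V \<and> V \<noteq> {} \<and> V \<subseteq> U \<and> (V \<subseteq> X \<or> V \<inter> X = {})"
  using assms
proof (induction n arbitrary: X U)
  case 0
  then have "U = {\<lambda>_. undefined}" using open_subset_tuples[of 0 U] by auto
  then show ?case using "0.prems" by (intro exI[of _ U]) auto
next
  case (Suc n)
  obtain b p where b: "\<And>j. j < Suc n \<Longrightarrow> b j \<in> Y" and p: "p \<in> box (Suc n) b" "box (Suc n) b \<subseteq> U"
    using ex_box[OF Suc.prems(2)] Suc.prems(3) by blast
  let ?W = "box (Suc n) b"
  have upd: "x(n := z) \<in> ?W" if "x \<in> box n b" "z \<in> Bs (b n)" for x z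
    using that Bs_subset[of "b n"] tuples_upd[of x M n z] by (auto simp: box_iff less_Suc_eq)
  have open0: "openin (ptop n) (box n b)" using b by (intro open_box) auto
  have ne0: "tup n p \<in> box n b"
    using p(1) tuples_Suc(1)[of p M n] by (auto simp: box_iff)
  have shrink: "\<exists>V. openin (ptop n) V \<and> V \<noteq> {} \<and> V \<subseteq> box n b \<and>
      (\<forall>z\<in>F. (\<forall>x\<in>V. x(n := z) \<in> X) \<or> (\<forall>x\<in>V. x(n := z) \<notin> X))"
    if "finite F" "F \<subseteq> Bs (b n)" for F
    using that
  proof (induction F rule: finite_induct)
    case empty
    then show ?case using open0 ne0 by (intro exI[of _ "box n b"]) auto
  next
    case (insert z F)
    then have "F \<subseteq> Bs (b n)" by simp
    from insert.IH[OF this] obtain V where V: "openin (ptop n) V" "V \<noteq> {}" "V \<subseteq> box n b"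
      "\<And>z. z \<in> F \<Longrightarrow> (\<forall>x\<in>V. x(n := z) \<in> X) \<or> (\<forall>x\<in>V. x(n := z) \<notin> X)" by blast
    have z: "z \<in> univ M" using insert.prems Bs_subset by auto
    obtain V' where V': "openin (ptop n) V'" "V' \<noteq> {}" "V' \<subseteq> V"
      "V' \<subseteq> {x \<in> tuples M n. x(n := z) \<in> X} \<or> V' \<inter> {x \<in> tuples M n. x(n := z) \<in> X} = {}"
      using Suc.IH[OF definable_slice[OF Suc.prems(1) z] V(1,2)] by blast
    have "(\<forall>x\<in>V'. x(n := z') \<in> X) \<or> (\<forall>x\<in>V'. x(n := z') \<notin> X)" if "z' \<in> insert z F" for z'
    proof (cases "z' = z")
      case True
      then show ?thesis using V'(4) open_subset_tuples[OF V'(1)] by blast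
    next
      case False
      then show ?thesis using that V(4)[of z'] V'(3) by blast
    qed
    moreover have "V' \<subseteq> box n b" using V'(3) V(3) by (rule subset_trans)
    ultimately show ?case using V'(1,2) by blast
  qed
  have "has_grid (Suc n) k (?W \<inter> X) \<or> has_grid (Suc n) k (?W - X)" for k
  proof -
    have "infinite (Bs (b n))" using b[of n] p(1) by (intro infinite_Bs) (auto simp: box_iff)
    then obtain F where F: "F \<subseteq> Bs (b n)" "finite F" "card F = 2 * k"
      using infinite_arbitrarily_large by metis
    obtain V where V: "openin (ptop n) V" "V \<noteq> {}" "V \<subseteq> box n b"
      "\<And>z. z \<in> F \<Longrightarrow> (\<forall>x\<in>V. x(n := z) \<in> X) \<or> (\<forall>x\<in>V. x(n := z) \<notin> X)"
      using shrink[OF F(2,1)] by blast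
    obtain A where A: "\<And>j. j < n \<Longrightarrow> A j \<subseteq> univ M \<and> finite (A j) \<and> card (A j) = k" "Pi\<^sub>E {..<n} A \<subseteq> V"
      using open_has_grid[OF V(1,2), of k] unfolding has_grid_def by metis
    have grid: "has_grid (Suc n) k S"
      if "k \<le> card G" "G \<subseteq> F" "\<And>x z. x \<in> V \<Longrightarrow> z \<in> G \<Longrightarrow> x(n := z) \<in> S" for G S
    proof -
      obtain G' where G': "G' \<subseteq> G" "card G' = k" "finite G'"
        using obtain_subset_with_card_n[OF \<open>k \<le> card G\<close>] by metis
      show ?thesis
      proof (rule has_grid_Suc[where A = A and F = G'])
        show "G' \<subseteq> univ M" using G'(1) that(2) F(1) Bs_subset by (meson subset_trans)
        show "x(n := a) \<in> S" if "x \<in> Pi\<^sub>E {..<n} A" "a \<in> G'" for x a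
          by (rule \<open>\<And>x z. x \<in> V \<Longrightarrow> z \<in> G \<Longrightarrow> x(n := z) \<in> S\<close>) (use that A(2) G'(1) in blast)+
      qed (use A(1) G' in auto)
    qed
    define G where "G = {z \<in> F. \<forall>x\<in>V. x(n := z) \<in> X}"
    have inW: "x(n := z) \<in> ?W" if "x \<in> V" "z \<in> F" for x z
      using upd that V(3) F(1) by blast
    have "card F = card G + card (F - G)"
    proof -
      have "G \<subseteq> F" by (auto simp: G_def)
      then show ?thesis
        using card_mono[OF F(2)] card_Diff_subset[OF finite_subset[OF _ F(2)]] by simp
    qed
    then have "k \<le> card G \<or> k \<le> card (F - G)" using F(3) by linarith
    then show ?thesis
    proof
      assume "k \<le> card G"
      then have "has_grid (Suc n) k (?W \<inter> X)"
        by (rule grid) (use inW in \<open>unfold G_def; blast\<close>)+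
      then show ?thesis ..
    next
      assume "k \<le> card (F - G)"
      then have "has_grid (Suc n) k (?W - X)"
        by (rule grid) (use inW V(4) in \<open>unfold G_def; blast\<close>)+
      then show ?thesis ..
    qed
  qed
  \<comment> \<open>One of the two alternatives occurs for arbitrarily large \<open>k\<close>, and
    large grids contain small ones.\<close>
  then have "(\<forall>k. has_grid (Suc n) k (?W \<inter> X)) \<or> (\<forall>k. has_grid (Suc n) k (?W - X))"
    using has_grid_antimono by (meson nle_le)
  moreover have W: "definable L M (Suc n) ?W" by (rule definable_box) (use b in auto)
  ultimately have "ptop (Suc n) interior_of (?W \<inter> X) \<noteq> {} \<or> ptop (Suc n) interior_of (?W - X) \<noteq> {}"
    using has_grid_interior[OF definable_Int[OF W Suc.prems(1)]]
      has_grid_interior[OF definable_Diff[OF W Suc.prems(1)]] by blast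
  then show ?case
  proof
    assume "ptop (Suc n) interior_of (?W \<inter> X) \<noteq> {}"
    then show ?thesis using p(2) interior_of_subset[of "ptop (Suc n)" "?W \<inter> X"]
      by (intro exI[of _ "ptop (Suc n) interior_of (?W \<inter> X)"]) auto
  next
    assume "ptop (Suc n) interior_of (?W - X) \<noteq> {}"
    then show ?thesis using p(2) interior_of_subset[of "ptop (Suc n)" "?W - X"]
      by (intro exI[of _ "ptop (Suc n) interior_of (?W - X)"]) auto
  qed
qed

text \<open>By \<open>open_split\<close>, a member of the cover either contains a smaller open set
  or is avoided by one, and in the second case the remaining members still cover.\<close>

lemma open_cover:
  assumes "finite \<V>" "\<And>V. V \<in> \<V> \<Longrightarrow> definable L M n V"
    and "openin (ptop n) U" "U \<noteq> {}" "U \<subseteq> \<Union>\<V>"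
  shows "\<exists>U'. \<exists>V\<in>\<V>. openin (ptop n) U' \<and> U' \<noteq> {} \<and> U' \<subseteq> U \<and> U' \<subseteq> V"
  using assms
proof (induction \<V> arbitrary: U rule: finite_induct)
  case (insert V \<V>)
  obtain U' where U': "openin (ptop n) U'" "U' \<noteq> {}" "U' \<subseteq> U" "U' \<subseteq> V \<or> U' \<inter> V = {}"
    using open_split[OF _ insert.prems(2,3), of V] insert.prems(1) by auto
  from U'(4) show ?case
  proof
    assume "U' \<subseteq> V"
    then show ?thesis using U' by auto
  next
    assume "U' \<inter> V = {}"
    then have "U' \<subseteq> \<Union>\<V>" using U'(3) insert.prems(4) by auto
    then obtain U'' V' where "V' \<in> \<V>" "openin (ptop n) U''" "U'' \<noteq> {}" "U'' \<subseteq> U'" "U'' \<subseteq> V'"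
      using insert.IH[OF _ U'(1,2)] insert.prems(1) by auto
    then show ?thesis using U'(3) by (intro exI[of _ U''] bexI[of _ V']) auto
  qed
qed auto

text \<open>This keeps all \<open>N\<close> coordinates in place when only the first
  \<open>n\<close> of them vary, so that the sets of an induction on \<open>n\<close> all live in
  the same power.\<close>

definition merge :: "nat \<Rightarrow> (nat \<Rightarrow> 'm) \<Rightarrow> (nat \<Rightarrow> 'm) \<Rightarrow> nat \<Rightarrow> 'm" where
  "merge n x p = (\<lambda>j. if j < n then x j else p j)"

lemma dt_merge:
  "(j < n \<Longrightarrow> dt (\<lambda>e. f e j)) \<Longrightarrow> (\<not> j < n \<Longrightarrow> dt (\<lambda>e. g e j)) \<Longrightarrow>
    dt (\<lambda>e. merge n (f e) (g e) j)"
  by (cases "j < n") (auto simp: merge_def)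

text \<open>
  The coordinates from \<open>n\<close> on are parameters, which lets the induction on \<open>n\<close> pass to the subset \<open>D1\<close> of the
  points of \<open>D\<close> interior to their line in direction \<open>n\<close>.  The fibres of \<open>D1\<close> over the coordinates from \<open>n\<close>
  on have no interior: finitely many points of such a fibre share a neighbourhood in direction \<open>n\<close>,
  so otherwise \<open>D\<close> would be broad.
\<close>

lemma finite_lines:
  assumes "n \<le> N" "definable L M N D"
    and "\<And>p. p \<in> tuples M N \<Longrightarrow> ptop n interior_of {x \<in> tuples M n. merge n x p \<in> D} = {}"
  shows "\<exists>E. (\<forall>j<n. definable L M N (E j) \<and>
      (\<forall>p\<in>tuples M N. finite {a \<in> univ M. p(j := a) \<in> E j})) \<and> D = (\<Union>j<n. E j)"
  using assms
proof (induction n arbitrary: D)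
  case 0
  have "p \<notin> D" for p
  proof
    assume "p \<in> D"
    then have "p \<in> tuples M N" using definable_subset[OF "0.prems"(2)] by auto
    moreover have "{x \<in> tuples M 0. merge 0 x p \<in> D} = topspace (ptop 0)"
      using \<open>p \<in> D\<close> by (auto simp: merge_def)
    ultimately show False using "0.prems"(3)[of p] interior_of_topspace[of "ptop 0"] by auto
  qed
  then show ?case by auto
next
  case (Suc n)
  note D = Suc.prems(2)
  define line where "line p = {a \<in> univ M. p(n := a) \<in> D}" for p
  define D1 where "D1 = {p \<in> tuples M N. p \<in> D \<and>
    (\<exists>b\<in>tuples M K. b \<in> Y \<and> p n \<in> Bs b \<and> (\<forall>a\<in>univ M. a \<in> Bs b \<longrightarrow> p(n := a) \<in> D))}"
  have D1: "definable L M N D1"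
    unfolding D1_def
    using Suc.prems(1)
    apply (intro definableI dp_conj)
     apply (rule dp_mem_var[OF D])
    apply (rule dp_ex[where i = 1])
     apply (intro dp_conj)
       apply (rule dp_mem_var[OF definable_Y])
      apply (rule dp_Bs; (intro dt_intros)?; simp)
     apply (rule dp_all1[where i = 2])
      apply (rule dp_imp)
       apply (rule dp_Bs; (intro dt_intros)?; simp)
      apply (rule dp_mem[OF D]; (intro dt_intros)?; simp)
     apply simp_all
    done
  have mem: "p \<in> D1 \<longleftrightarrow> p \<in> D \<and> p n \<in> \<tau> interior_of line p" if "p \<in> tuples M N" for p
  proof
    assume "p \<in> D1"
    then obtain b where b: "p \<in> D" "b \<in> Y" "p n \<in> Bs b" "\<And>a. a \<in> univ M \<Longrightarrow> a \<in> Bs b \<Longrightarrow> p(n := a) \<in> D"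
      by (auto simp: D1_def)
    have "Bs b \<subseteq> line p" using b(4) Bs_subset by (auto simp: line_def)
    then show "p \<in> D \<and> p n \<in> \<tau> interior_of line p"
      using b open_Bs by (auto simp: interior_of_def)
  next
    assume *: "p \<in> D \<and> p n \<in> \<tau> interior_of line p"
    then obtain b where "b \<in> Y" "p n \<in> Bs b" "Bs b \<subseteq> \<tau> interior_of line p"
      using ex_Bs[OF openin_interior_of] by blast
    moreover from this have "Bs b \<subseteq> line p" using interior_of_subset[of \<tau>] by (meson subset_trans)
    ultimately show "p \<in> D1"
      using * that Y_tuples by (auto simp: D1_def line_def)
  qed
  have upd: "p(n := a) \<in> tuples M N" if "p \<in> tuples M N" "a \<in> univ M" for p a
    using that Suc.prems(1) by (auto simp: tuples_iff)
  \<comment> \<open>Changing the \<open>n\<close>-th coordinate of \<open>p\<close> does not change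
    \<open>line p\<close>; so on each line in direction \<open>n\<close> the set
    \<open>D - D1\<close> is the line of \<open>D\<close> without its interior.\<close>
  have fin: "finite {a \<in> univ M. p(n := a) \<in> D - D1}" if p: "p \<in> tuples M N" for p
  proof (rule finite_diff_interior)
    have "dp (\<lambda>e. p(n := e 0 0) \<in> D - D1)"
      using p Suc.prems(1)
      by (intro dp_mem[OF definable_Diff[OF D D1]] dt_upd dt_var dt_const) (auto simp: tuples_iff)
    then show "dp (\<lambda>e. p(n := e 0 0) \<in> D - D1)" .
    have "line (p(n := a)) = line p" for a by (simp add: line_def)
    then show "{a \<in> univ M. p(n := a) \<in> D - D1} = line p - \<tau> interior_of line p"
      using mem[OF upd[OF p]] by (auto simp: line_def)
  qed
  have "ptop n interior_of {x \<in> tuples M n. merge n x p \<in> D1} = {}" if p: "p \<in> tuples M N" for p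
  proof (rule ccontr)
    let ?Q = "{x \<in> tuples M n. merge n x p \<in> D1}"
    let ?S = "{x \<in> tuples M (Suc n). merge (Suc n) x p \<in> D}"
    assume ne: "ptop n interior_of ?Q \<noteq> {}"
    have "has_grid (Suc n) k ?S" for k
    proof -
      have "has_grid n k ?Q"
        by (rule has_grid_mono[OF interior_of_subset open_has_grid[OF openin_interior_of ne]])
      then obtain A where A: "\<And>j. j < n \<Longrightarrow> A j \<subseteq> univ M \<and> finite (A j) \<and> card (A j) = k"
          "Pi\<^sub>E {..<n} A \<subseteq> ?Q"
        by (erule has_gridE)
      \<comment> \<open>Inserting \<open>univ M\<close> keeps the intersection inside the universe
        even if the grid is empty.\<close>
      define O' where "O' = \<Inter>(insert (univ M) ((\<lambda>x. \<tau> interior_of line (merge n x p)) ` Pi\<^sub>E {..<n} A))"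
      have "finite (Pi\<^sub>E {..<n} A)" using A(1) by (intro finite_PiE) auto
      then have "openin \<tau> O'"
        unfolding O'_def using topspace_\<tau> openin_topspace[of \<tau>]
        by (intro openin_Inter) auto
      moreover have "p n \<in> O'"
      proof -
        have "p n \<in> \<tau> interior_of line (merge n x p)" if "x \<in> Pi\<^sub>E {..<n} A" for x
        proof -
          have "x \<in> ?Q" using that A(2) by blast
          moreover from this have "merge n x p \<in> tuples M N" by (auto simp: D1_def)
          ultimately show ?thesis using mem[of "merge n x p"] by (simp add: merge_def)
        qed
        moreover have "p n \<in> univ M" using p Suc.prems(1) by (auto simp: tuples_iff)
        ultimately show ?thesis by (auto simp: O'_def)
      qed
      ultimately have "infinite O'" by (intro infinite_open) auto
      then obtain F where F: "F \<subseteq> O'" "finite F" "card F = k"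
        using infinite_arbitrarily_large by metis
      show ?thesis
      proof (rule has_grid_Suc[where A = A and F = F])
        show "F \<subseteq> univ M" using F(1) by (auto simp: O'_def)
        fix x a assume x: "x \<in> Pi\<^sub>E {..<n} A" and a: "a \<in> F"
        have "a \<in> line (merge n x p)"
        proof (rule subsetD[OF interior_of_subset])
          show "a \<in> \<tau> interior_of line (merge n x p)" using F(1) a x unfolding O'_def by blast
        qed
        moreover have "(merge n x p)(n := a) = merge (Suc n) (x(n := a)) p"
          by (auto simp: merge_def fun_eq_iff)
        moreover have "x(n := a) \<in> tuples M (Suc n)"
          using x A(2) \<open>F \<subseteq> univ M\<close> a by (intro tuples_upd) auto
        ultimately show "x(n := a) \<in> ?S" by (simp add: line_def)
      qed (use A F in auto)
    qed
    moreover have "definable L M (Suc n) ?S"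
    proof (intro definableI dp_mem[OF D] dt_merge)
      show "dt (\<lambda>e. tup (Suc n) (e 0) j)" if "j < Suc n" for j
        by (rule dt_tup[OF that dt_var])
      show "dt (\<lambda>e. p j)" if "j < N" for j
        using p that by (intro dt_const) (simp add: tuples_iff)
      show "merge (Suc n) (tup (Suc n) (e 0)) p j = undefined" if "\<not> j < N" for e and j :: nat
        using p that Suc.prems(1) by (simp add: merge_def tuples_iff)
    qed
    ultimately have "ptop (Suc n) interior_of ?S \<noteq> {}" using has_grid_interior by blast
    then show False using Suc.prems(3)[OF p] by blast
  qed
  from Suc.IH[OF Suc_leD[OF Suc.prems(1)] D1 this] obtain E where E: "\<And>j. j < n \<Longrightarrow> definable L M N (E j) \<and>
      (\<forall>p\<in>tuples M N. finite {a \<in> univ M. p(j := a) \<in> E j})" "D1 = (\<Union>j<n. E j)"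
    by metis
  \<comment> \<open>Direction \<open>n\<close> receives \<open>D - D1\<close>, while the induction
    hypothesis distributes \<open>D1\<close> over the earlier directions.\<close>
  define E' where "E' = E(n := D - D1)"
  have E': "E' n = D - D1" "\<And>j. j < n \<Longrightarrow> E' j = E j" by (simp_all add: E'_def)
  have "(\<Union>j<Suc n. E' j) = D1 \<union> (D - D1)"
    by (simp add: lessThan_Suc E' E(2) Un_commute)
  moreover have "D1 \<subseteq> D" unfolding D1_def by blast
  ultimately have "D = (\<Union>j<Suc n. E' j)" by (simp only: Un_Diff_cancel Un_absorb1)
  moreover have "definable L M N (E' j) \<and> (\<forall>p\<in>tuples M N. finite {a \<in> univ M. p(j := a) \<in> E' j})"
    if "j < Suc n" for j
  proof (cases "j = n")
    case True
    then show ?thesis using definable_Diff[OF D D1] fin E'(1) by simp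
  next
    case False
    then have "j < n" using that by simp
    then show ?thesis using E(1)[of j] E'(2)[of j] by simp
  qed
  ultimately show ?case by (intro exI[of _ E']) blast
qed

section \<open>Cell decomposition\<close>

text \<open>The full set of coordinates is one of the candidates \<open>J\<close> in the definition
  of \<open>dim\<close>. This is the form in which the conclusion of niceness is exploited.\<close>

lemma dim_less_imp_interior_empty:
  assumes "X \<subseteq> tuples M n" "dim \<tau> n X < ereal (real n)"
  shows "ptop n interior_of X = {}"
proof (rule ccontr)
  assume ne: "ptop n interior_of X \<noteq> {}"
  then have "X \<noteq> {}" by auto
  let ?S = "{card J |J. J \<subseteq> {..<n} \<and>
    product_topology (\<lambda>_. \<tau>) J interior_of ((\<lambda>x. restrict x J) ` X) \<noteq> {}}"
  have "(\<lambda>x. restrict x {..<n}) ` X = X"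
    using assms(1) tup_tuples[of _ M n] unfolding tup_def by (force simp: image_iff)
  then have "card {..<n} \<in> ?S"
    using ne unfolding power_top_def by (intro CollectI exI[of _ "{..<n}"]) simp
  moreover have "finite ?S"
    by (rule finite_subset[of _ "card ` Pow {..<n}"]) auto
  ultimately have "card {..<n} \<le> Max ?S" by (intro Max_ge)
  then have "n \<le> Max ?S" by simp
  then show False using assms(2) \<open>X \<noteq> {}\<close> by (simp add: dim_def)
qed

lemma corr_graph_iff:
  assumes "U \<subseteq> tuples M n" "x \<in> tuples M n"
  shows "cat n x y \<in> corr_graph n U f \<longleftrightarrow> x \<in> U \<and> y \<in> f x"
proof
  assume "cat n x y \<in> corr_graph n U f"
  then obtain x' y' where "cat n x y = cat n x' y'" "x' \<in> U" "y' \<in> f x'"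
    unfolding corr_graph_def by auto
  then show "x \<in> U \<and> y \<in> f x" using assms cat_eq_iff[of x M n x' y y'] by auto
qed (auto simp: corr_graph_def)

lemma cell_permute:
  assumes "cell L M \<tau> n C" "\<pi> permutes {..<n}"
  shows "cell L M \<tau> n ((\<lambda>x. x \<circ> \<pi>) ` C)"
proof -
  obtain i k U f \<sigma> where C: "i \<le> n" "definable L M i U" "openin (power_top \<tau> i) U"
    "definable_correspondence L M i (n - i) k U f"
    "continuous_correspondence (subtopology (power_top \<tau> i) U) (power_top \<tau> (n - i)) k f"
    "\<sigma> permutes {..<n}" "C = (\<lambda>x. x \<circ> \<sigma>) ` corr_graph i U f"
    using assms(1) unfolding cell_def by metis
  have "(\<lambda>x. x \<circ> \<pi>) ` C = (\<lambda>x. x \<circ> (\<sigma> \<circ> \<pi>)) ` corr_graph i U f"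
    unfolding C(7) image_image by (simp add: comp_assoc)
  then show ?thesis
    unfolding cell_def using C(1-6) permutes_compose[OF assms(2) C(6)] by blast
qed

text \<open>The cells may overlap, so finite unions of such sets are again of this kind without any
  refinement.\<close>

definition cellular :: "nat \<Rightarrow> (nat \<Rightarrow> 'm) set \<Rightarrow> bool" where
  "cellular n Z \<longleftrightarrow> (\<exists>\<C>. finite \<C> \<and> (\<forall>C\<in>\<C>. cell L M \<tau> n C) \<and> \<Union>\<C> = Z)"

lemma cellular_cell: "cell L M \<tau> n C \<Longrightarrow> cellular n C"
  unfolding cellular_def by (intro exI[of _ "{C}"]) auto

lemma cellular_UN:
  assumes "finite I" "\<And>i. i \<in> I \<Longrightarrow> cellular n (Z i)"
  shows "cellular n (\<Union>i\<in>I. Z i)"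
proof -
  obtain \<C> where \<C>: "\<And>i. i \<in> I \<Longrightarrow> finite (\<C> i) \<and> (\<forall>C\<in>\<C> i. cell L M \<tau> n C) \<and> \<Union>(\<C> i) = Z i"
    using assms(2) unfolding cellular_def by metis
  have "\<Union>(\<Union>(\<C> ` I)) = (\<Union>i\<in>I. \<Union>(\<C> i))" by blast
  also have "\<dots> = (\<Union>i\<in>I. Z i)" using \<C> by (intro SUP_cong) auto
  finally show ?thesis
    unfolding cellular_def using \<C> assms(1) by (intro exI[of _ "\<Union>(\<C> ` I)"]) auto
qed

lemma cellular_Un: "cellular n X \<Longrightarrow> cellular n Z \<Longrightarrow> cellular n (X \<union> Z)"
  using cellular_UN[of "{False, True}" n "\<lambda>b. if b then X else Z"] by (simp add: Un_commute)

lemma cellular_permute: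
  assumes "cellular n Z" "\<pi> permutes {..<n}"
  shows "cellular n ((\<lambda>x. x \<circ> \<pi>) ` Z)"
proof -
  obtain \<C> where "finite \<C>" "\<And>C. C \<in> \<C> \<Longrightarrow> cell L M \<tau> n C" "\<Union>\<C> = Z"
    using assms(1) unfolding cellular_def by blast
  then show ?thesis
    unfolding cellular_def using cell_permute[OF _ assms(2)]
    by (intro exI[of _ "(\<lambda>C. (\<lambda>x. x \<circ> \<pi>) ` C) ` \<C>"]) auto
qed

lemma tuples_permute:
  assumes "z \<in> tuples M n" "\<pi> permutes {..<n}"
  shows "z \<circ> \<pi> \<in> tuples M n"
proof -
  have "\<pi> j < n \<longleftrightarrow> j < n" for j using permutes_in_image[OF assms(2), of j] by simp
  then show ?thesis using assms(1) by (auto simp: tuples_iff)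
qed

lemma definable_permute:
  assumes "definable L M n Z" "\<pi> permutes {..<n}"
  shows "definable L M n {z \<in> tuples M n. z \<circ> \<pi> \<in> Z}"
proof -
  have \<pi>: "\<pi> j < n \<longleftrightarrow> j < n" for j using permutes_in_image[OF assms(2), of j] by simp
  show ?thesis
    apply (rule definableI)
    apply (rule dp_mem[OF assms(1)])
    unfolding comp_def
     apply (rule dt_tup)
      apply (simp add: \<pi>)
     apply (rule dt_var)
    apply (simp add: \<pi>)
    done
qed

section \<open>Sets with finite fibres over their first coordinates\<close>

lemma fibre_dp:
  assumes "definable L M (i + m) Z"
  shows "definable L M i {x \<in> tuples M i. at_least k {y \<in> tuples M m. cat i x y \<in> Z} \<and>
     \<not> at_least (Suc k) {y \<in> tuples M m. cat i x y \<in> Z}}"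
  using definable_Diff[OF definable_at_least[OF assms, of k] definable_at_least[OF assms, of "Suc k"]]
  by (rule back_subst[of "definable L M i"]) auto

lemma definable_restrict_base:
  assumes "definable L M (i + m) Z" "definable L M i U"
  shows "definable L M (i + m) {z \<in> Z. tup i z \<in> U}"
proof -
  have "definable L M (i + m) {z \<in> tuples M (i + m). z \<in> Z \<and> tup i z \<in> U}"
    apply (rule definableI)
    apply (rule dp_conj)
     apply (rule dp_mem_var[OF assms(1)])
    apply (rule dp_mem[OF assms(2)]; (intro dt_intros)?; simp)
    done
  moreover have "{z \<in> tuples M (i + m). z \<in> Z \<and> tup i z \<in> U} = {z \<in> Z. tup i z \<in> U}"
    using definable_subset[OF assms(1)] by auto
  ultimately show ?thesis by simp
qed

lemma corr_graph_fibres: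
  assumes "Z \<subseteq> tuples M (i + m)" "U \<subseteq> tuples M i"
  shows "corr_graph i U (\<lambda>x. {y \<in> tuples M m. cat i x y \<in> Z}) = {z \<in> Z. tup i z \<in> U}"
proof (intro equalityI subsetI)
  fix z assume "z \<in> corr_graph i U (\<lambda>x. {y \<in> tuples M m. cat i x y \<in> Z})"
  then obtain x y where "z = cat i x y" "x \<in> U" "y \<in> tuples M m" "cat i x y \<in> Z"
    unfolding corr_graph_def by blast
  moreover from this have "tup i z = x"
    using assms(2) by (intro tuples_eqI[of _ M i]) (auto simp: tup_in_tuples_iff cat_def tuples_iff)
  ultimately show "z \<in> {z \<in> Z. tup i z \<in> U}" by simp
next
  fix z assume z: "z \<in> {z \<in> Z. tup i z \<in> U}"
  then have "z \<in> tuples M (i + m)" using assms(1) by auto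
  from split_tuple[OF this] z show "z \<in> corr_graph i U (\<lambda>x. {y \<in> tuples M m. cat i x y \<in> Z})"
    unfolding corr_graph_def mem_Collect_eq
    by (intro exI[of _ "tup i z"] exI[of _ "tup m (\<lambda>j. z (i + j))"]) auto
qed

text \<open>Niceness is applied to the correspondence of fibres on the interior of \<open>P\<close>.
  An open subset of what remains of \<open>P\<close> lies in that interior and misses the continuity
  locus, so it sits in a set of too small dimension and is empty.\<close>

lemma cell_over_open:
  assumes Z: "definable L M (i + m) Z" and P: "definable L M i P"
    and card: "\<And>x. x \<in> P \<Longrightarrow> finite {y \<in> tuples M m. cat i x y \<in> Z} \<and>
        card {y \<in> tuples M m. cat i x y \<in> Z} = k"
  shows "\<exists>U\<subseteq>P. definable L M i U \<and> cell L M \<tau> (i + m) {z \<in> Z. tup i z \<in> U} \<and>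
      ptop i interior_of (P - U) = {}"
proof -
  let ?f = "\<lambda>x. {y \<in> tuples M m. cat i x y \<in> Z}"
  define U where "U = ptop i interior_of P"
  have UP: "U \<subseteq> P" unfolding U_def by (rule interior_of_subset)
  have graph: "corr_graph i V ?f = {z \<in> Z. tup i z \<in> V}" if "V \<subseteq> P" for V
    using that definable_subset[OF P] by (intro corr_graph_fibres definable_subset[OF Z]) auto
  have dc: "definable_correspondence L M i m k V ?f" if "V \<subseteq> P" "definable L M i V" for V
    unfolding definable_correspondence_def correspondence_def graph[OF that(1)]
    using that card definable_restrict_base[OF Z that(2)] definable_subset[OF that(2)] by auto
  have U: "definable L M i U" "openin (ptop i) U"
    unfolding U_def using definable_interior[OF P] by auto
  obtain U0 where U0: "U0 \<subseteq> U" "definable L M i U0" "openin (ptop i) U0"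
      "dim \<tau> i (U - U0) < ereal (real i)"
      "continuous_correspondence (subtopology (ptop i) U0) (ptop m) k ?f"
    using niceness dc[OF UP U(1)] U unfolding nice_def by meson
  have U0P: "U0 \<subseteq> P" using U0(1) UP by (rule subset_trans)
  have "cell L M \<tau> (i + m) {z \<in> Z. tup i z \<in> U0}"
    unfolding cell_def
    by (rule exI[of _ i], rule exI[of _ k], rule exI[of _ U0], rule exI[of _ ?f], rule exI[of _ id])
      (use U0 dc[OF U0P U0(2)] graph[OF U0P] in \<open>simp add: permutes_id\<close>)
  moreover have "ptop i interior_of (P - U0) = {}"
  proof -
    have "U - U0 \<subseteq> tuples M i" using open_subset_tuples[OF U(2)] by auto
    then have "ptop i interior_of (U - U0) = {}"
      using U0(4) by (rule dim_less_imp_interior_empty)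
    moreover have "ptop i interior_of (P - U0) \<subseteq> ptop i interior_of (U - U0)"
    proof (rule interior_of_maximal)
      have "ptop i interior_of (P - U0) \<subseteq> P - U0" by (rule interior_of_subset)
      moreover have "ptop i interior_of (P - U0) \<subseteq> U"
        unfolding U_def by (rule interior_of_mono) auto
      ultimately show "ptop i interior_of (P - U0) \<subseteq> U - U0" by auto
    qed simp
    ultimately show ?thesis by simp
  qed
  ultimately show ?thesis using U0 U0P by (intro exI[of _ U0]) auto
qed

text \<open>Exchanging the coordinates \<open>j\<close> and \<open>i\<close> turns coordinate
  \<open>j\<close> into the first fibre coordinate. It takes finitely many values by the hypothesis
  on \<open>E\<close>, and each value leaves finitely many points of the old fibre.\<close>

lemma finite_fibres_transpose:
  assumes Z: "definable L M (Suc i + m) Z" and j: "j < Suc i"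
    and fin: "\<And>x. x \<in> tuples M (Suc i) \<Longrightarrow> finite {y \<in> tuples M m. cat (Suc i) x y \<in> Z}"
    and E: "\<And>p. p \<in> tuples M (Suc i) \<Longrightarrow> finite {a \<in> univ M. p(j := a) \<in> E}"
    and \<pi>: "\<pi> = Transposition.transpose j i"
    and x: "x \<in> tuples M i"
  shows "finite {y \<in> tuples M (Suc m). cat i x y \<circ> \<pi> \<in> {z \<in> Z. tup (Suc i) z \<in> E}}"
proof -
  have \<pi>_less: "\<pi> l < Suc i \<longleftrightarrow> l < Suc i" for l
    using j by (auto simp: \<pi> Transposition.transpose_def)
  have \<pi>_ge: "\<pi> l = l" if "\<not> l < Suc i" for l
    using j that by (auto simp: \<pi> Transposition.transpose_def)
  \<comment> \<open>After the exchange, \<open>elt\<close> stands at position \<open>j\<close>; it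
    is only a placeholder, as \<open>p\<close> is always used with coordinate \<open>j\<close>
    overwritten.\<close>
  define p where "p = tup (Suc i) ((x(i := elt)) \<circ> \<pi>)"
  have "x(i := elt) \<in> tuples M (Suc i)" by (rule tuples_upd[OF x elt_in])
  then have p: "p \<in> tuples M (Suc i)"
    unfolding p_def tup_in_tuples_iff using \<pi>_less by (auto simp: tuples_iff)
  have upd: "p(j := a) \<in> tuples M (Suc i)" if "a \<in> univ M" for a
    using p that j by (auto simp: tuples_iff)
  define A where "A = {a \<in> univ M. p(j := a) \<in> E}"
  define B where "B a = {y \<in> tuples M m. cat (Suc i) (p(j := a)) y \<in> Z}" for a
  have "{y \<in> tuples M (Suc m). cat i x y \<circ> \<pi> \<in> {z \<in> Z. tup (Suc i) z \<in> E}} \<subseteq>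
      (\<Union>a\<in>A. cat 1 (tup 1 (\<lambda>_. a)) ` B a)"
  proof
    fix y assume "y \<in> {y \<in> tuples M (Suc m). cat i x y \<circ> \<pi> \<in> {z \<in> Z. tup (Suc i) z \<in> E}}"
    then have y: "y \<in> tuples M (Suc m)" "cat i x y \<circ> \<pi> \<in> Z" "tup (Suc i) (cat i x y \<circ> \<pi>) \<in> E" by auto
    have y0: "y 0 \<in> univ M" using y(1) by (simp add: tuples_iff)
    define y' where "y' = tup m (\<lambda>l. y (Suc l))"
    have y': "y' \<in> tuples M m" using y(1) by (auto simp: y'_def tuples_iff)
    have "tup (Suc i) (cat i x y \<circ> \<pi>) = p(j := y 0)"
    proof
      fix l
      show "tup (Suc i) (cat i x y \<circ> \<pi>) l = (p(j := y 0)) l"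
        using j by (auto simp: p_def tup_def cat_def \<pi> Transposition.transpose_def restrict_def)
    qed
    then have "y 0 \<in> A" using y0 y(3) by (simp add: A_def)
    moreover have "cat (Suc i) (p(j := y 0)) y' = cat i x y \<circ> \<pi>"
    proof
      fix l
      show "cat (Suc i) (p(j := y 0)) y' l = (cat i x y \<circ> \<pi>) l"
      proof (cases "l < Suc i")
        case True
        then show ?thesis
          using j by (auto simp: p_def tup_def cat_def \<pi> Transposition.transpose_def restrict_def)
      next
        case False
        then have "Suc (l - Suc i) = l - i" by simp
        then show ?thesis using False y(1)
          by (auto simp: cat_def \<pi>_ge y'_def tup_def tuples_iff)
      qed
    qed
    then have "y' \<in> B (y 0)" using y(2) y' by (simp add: B_def)
    moreover have "y = cat 1 (tup 1 (\<lambda>_. y 0)) y'"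
    proof
      fix l show "y l = cat 1 (tup 1 (\<lambda>_. y 0)) y' l"
        using y(1) by (cases l) (auto simp: cat_def y'_def tup_def tuples_iff)
    qed
    ultimately show "y \<in> (\<Union>a\<in>A. cat 1 (tup 1 (\<lambda>_. a)) ` B a)" by blast
  qed
  moreover have "finite A" unfolding A_def by (rule E[OF p])
  moreover have "finite (B a)" if "a \<in> A" for a
    unfolding B_def using that by (intro fin upd) (simp add: A_def)
  ultimately show ?thesis by (meson finite_UN finite_imageI finite_subset)
qed

text \<open>The induction is on the number \<open>i\<close> of base coordinates, with the number
  \<open>m\<close> of fibre coordinates left free. Fibre sizes are bounded, so the base splits into
  finitely many \<open>P k\<close>. Over most of \<open>P k\<close> the set is a cell; the rest of
  \<open>P k\<close> has no interior, hence is a union of sets with finite lines in one direction,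
  and over each of these that direction moves from the base to the fibre.\<close>

lemma cellular_finite_fibres:
  assumes "definable L M (i + m) Z"
    and "\<And>x. x \<in> tuples M i \<Longrightarrow> finite {y \<in> tuples M m. cat i x y \<in> Z}"
  shows "cellular (i + m) Z"
  using assms
proof (induction i arbitrary: m Z rule: less_induct)
  case (less i)
  note Z = less.prems(1)
  let ?f = "\<lambda>x. {y \<in> tuples M m. cat i x y \<in> Z}"
  define P where "P k = {x \<in> tuples M i. at_least k (?f x) \<and> \<not> at_least (Suc k) (?f x)}" for k
  have P: "definable L M i (P k)" for k
    unfolding P_def by (rule fibre_dp[OF Z])
  have P_card: "x \<in> P k \<longleftrightarrow> x \<in> tuples M i \<and> card (?f x) = k" for x k
    unfolding P_def using at_least_finite[OF less.prems(2)] by auto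
  have "\<exists>N. \<forall>x\<in>tuples M i. \<not> at_least N (?f x)"
  proof (rule ccontr)
    assume "\<not> (\<exists>N. \<forall>x\<in>tuples M i. \<not> at_least N (?f x))"
    then have "\<exists>x\<in>tuples M i. at_least k (?f x)" for k by simp
    from uniform_finiteness[OF Z this] show False using less.prems(2) by auto
  qed
  then obtain N where N: "\<And>x. x \<in> tuples M i \<Longrightarrow> \<not> at_least N (?f x)" by auto
  have "cellular (i + m) {z \<in> Z. tup i z \<in> P k}" for k
  proof -
    obtain U where U: "U \<subseteq> P k" "definable L M i U" "cell L M \<tau> (i + m) {z \<in> Z. tup i z \<in> U}"
      "ptop i interior_of (P k - U) = {}"
    proof -
      have "finite (?f x) \<and> card (?f x) = k" if "x \<in> P k" for x
        using that P_card less.prems(2) by simp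
      from cell_over_open[OF Z P this] show thesis using that by auto
    qed
    \<comment> \<open>All \<open>i\<close> coordinates vary here, so in this instance of
      \<open>finite_lines\<close> no coordinate remains as a parameter.\<close>
    have "{x \<in> tuples M i. merge i x p \<in> P k - U} = P k - U" if "p \<in> tuples M i" for p
    proof -
      have "merge i x p = x" if "x \<in> tuples M i" for x
        using that \<open>p \<in> tuples M i\<close> by (auto simp: merge_def fun_eq_iff tuples_iff)
      moreover have "x \<in> tuples M i" if "x \<in> P k" for x using that by (simp add: P_def)
      ultimately show ?thesis by auto
    qed
    then have "\<exists>E. (\<forall>j<i. definable L M i (E j) \<and>
        (\<forall>p\<in>tuples M i. finite {a \<in> univ M. p(j := a) \<in> E j})) \<and> P k - U = (\<Union>j<i. E j)"
      using U(4) by (intro finite_lines definable_Diff P U(2)) auto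
    then obtain E where E: "\<And>j. j < i \<Longrightarrow> definable L M i (E j)"
      "\<And>j p. j < i \<Longrightarrow> p \<in> tuples M i \<Longrightarrow> finite {a \<in> univ M. p(j := a) \<in> E j}"
      "P k - U = (\<Union>j<i. E j)"
      by blast
    have "cellular (i + m) {z \<in> Z. tup i z \<in> E j}" if j: "j < i" for j
    proof -
      obtain i' where i': "i = Suc i'" using j by (cases i) auto
      define \<pi> where "\<pi> = Transposition.transpose j i'"
      have \<pi>: "\<pi> permutes {..<i + m}"
        unfolding \<pi>_def using j i' by (intro permutes_swap_id) auto
      have \<pi>\<pi>: "\<pi> \<circ> \<pi> = id" by (simp add: \<pi>_def)
      let ?Z' = "{z \<in> Z. tup i z \<in> E j}"
      have Z': "definable L M (i + m) ?Z'" by (rule definable_restrict_base[OF Z E(1)[OF j]])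
      let ?Z'' = "{z \<in> tuples M (i + m). z \<circ> \<pi> \<in> ?Z'}"
      have "definable L M (i + m) ?Z''" by (rule definable_permute[OF Z' \<pi>])
      then have Z'': "definable L M (i' + Suc m) ?Z''" by (simp add: i')
      have "cellular (i' + Suc m) ?Z''"
      proof (rule less.IH[OF _ Z''])
        fix x assume x: "x \<in> tuples M i'"
        have "finite {y \<in> tuples M (Suc m). cat i' x y \<circ> \<pi> \<in> ?Z'}"
          using finite_fibres_transpose[of i' m Z j "E j" \<pi> x] Z less.prems(2) E(2)[OF j] x j
          unfolding i' \<pi>_def by blast
        then show "finite {y \<in> tuples M (Suc m). cat i' x y \<in> ?Z''}"
          by (rule rev_finite_subset) blast
      qed (simp add: i')
      then have "cellular (i + m) ((\<lambda>z. z \<circ> \<pi>) ` ?Z'')"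
        by (intro cellular_permute \<pi>) (simp add: i')
      moreover have "(\<lambda>z. z \<circ> \<pi>) ` ?Z'' = ?Z'"
      proof (intro equalityI subsetI)
        fix z assume z: "z \<in> ?Z'"
        then have "z \<in> tuples M (i + m)" using definable_subset[OF Z] by blast
        then have "z \<circ> \<pi> \<in> tuples M (i + m)" using \<pi> by (rule tuples_permute)
        moreover have "z \<circ> \<pi> \<circ> \<pi> = z" by (simp add: comp_assoc \<pi>\<pi>)
        ultimately show "z \<in> (\<lambda>z. z \<circ> \<pi>) ` ?Z''"
          using z by (intro image_eqI[of _ _ "z \<circ> \<pi>"]) auto
      qed auto
      ultimately show ?thesis by simp
    qed
    then have "cellular (i + m) (\<Union>j\<in>{..<i}. {z \<in> Z. tup i z \<in> E j})"
      by (intro cellular_UN) auto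
    then have "cellular (i + m) ({z \<in> Z. tup i z \<in> U} \<union> (\<Union>j\<in>{..<i}. {z \<in> Z. tup i z \<in> E j}))"
      by (intro cellular_Un cellular_cell[OF U(3)])
    moreover have "{z \<in> Z. tup i z \<in> P k} = {z \<in> Z. tup i z \<in> U} \<union> (\<Union>j\<in>{..<i}. {z \<in> Z. tup i z \<in> E j})"
      using U(1) E(3) by blast
    ultimately show ?thesis by simp
  qed
  then have "cellular (i + m) (\<Union>k\<in>{..<N}. {z \<in> Z. tup i z \<in> P k})"
    by (intro cellular_UN) auto
  moreover have "Z = (\<Union>k\<in>{..<N}. {z \<in> Z. tup i z \<in> P k})"
  proof (intro equalityI subsetI)
    fix z assume z: "z \<in> Z"
    then have t: "tup i z \<in> tuples M i" using definable_subset[OF Z] split_tuple(1) by blast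
    then have "card (?f (tup i z)) < N"
      using N[OF t] at_least_finite[OF less.prems(2)[OF t]] by auto
    then show "z \<in> (\<Union>k\<in>{..<N}. {z \<in> Z. tup i z \<in> P k})"
      using z t P_card by blast
  qed auto
  ultimately show ?case by simp
qed

text \<open>With all coordinates in the base, each fibre is a subset of the one-point set
  \<open>tuples M 0\<close> and thus finite.\<close>

lemma cell_decomposition:
  assumes "definable L M n Z"
  shows "cellular n Z"
  using cellular_finite_fibres[of n 0 Z] assms by simp

section \<open>Topology of cells and definable manifolds\<close>

lemma continuous_map_ptop:
  "continuous_map X (ptop n) f \<longleftrightarrow>
     (\<forall>x\<in>topspace X. f x \<in> tuples M n) \<and> (\<forall>j<n. continuous_map X \<tau> (\<lambda>x. f x j))"
proof -
  have "f x \<in> tuples M n"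
    if "f ` topspace X \<subseteq> extensional {..<n}" "\<forall>k\<in>{..<n}. continuous_map X \<tau> (\<lambda>x. f x k)" "x \<in> topspace X" for x
  proof -
    have "f x j \<in> univ M" if "j < n" for j
      using that \<open>\<forall>k\<in>{..<n}. continuous_map X \<tau> (\<lambda>x. f x k)\<close> \<open>x \<in> topspace X\<close> topspace_\<tau>
      by (auto simp: continuous_map_def)
    then show ?thesis using that by (auto simp: tuples_iff extensional_def)
  qed
  then show ?thesis
    unfolding power_top_def continuous_map_componentwise
    by (auto simp: tuples_def PiE_def)
qed

lemma continuous_map_coord: "j < n \<Longrightarrow> continuous_map (ptop n) \<tau> (\<lambda>x. x j)"
  unfolding power_top_def by (intro continuous_map_product_projection) simp

lemma continuous_map_head: "continuous_map (ptop (i + m)) (ptop i) (tup i)"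
  by (auto simp: continuous_map_ptop tuples_iff intro: continuous_map_coord)

lemma continuous_map_tail: "continuous_map (ptop (i + m)) (ptop m) (\<lambda>z. tup m (\<lambda>j. z (i + j)))"
  by (auto simp: continuous_map_ptop tuples_iff intro: continuous_map_coord)

lemma continuous_map_cat:
  assumes "continuous_map X (ptop i) f" "continuous_map X (ptop m) g"
  shows "continuous_map X (ptop (i + m)) (\<lambda>x. cat i (f x) (g x))"
proof -
  have "continuous_map X \<tau> (\<lambda>x. cat i (f x) (g x) j)" if "j < i + m" for j
    using assms that by (cases "j < i") (auto simp: cat_def continuous_map_ptop)
  then show ?thesis using assms by (auto simp: continuous_map_ptop intro: cat_tuples)
qed

lemma continuous_map_permute:
  assumes "\<pi> permutes {..<n}"
  shows "continuous_map (ptop n) (ptop n) (\<lambda>z. z \<circ> \<pi>)"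
proof -
  have "\<pi> j < n" if "j < n" for j using permutes_in_image[OF assms, of j] that by simp
  then show ?thesis
    using tuples_permute[OF _ assms] by (auto simp: continuous_map_ptop intro: continuous_map_coord)
qed

text \<open>Locally the graph is a finite union of graphs of continuous maps into a Hausdorff space,
  so it is closed in the cylinder over \<open>U\<close>. Openness of the complement is a local
  matter, and so the choice of branches near each point suffices.\<close>

lemma graph_locally_closed:
  assumes U: "openin (ptop i) U"
    and f: "continuous_correspondence (subtopology (ptop i) U) (ptop m) k f"
  shows "openin (ptop (i + m)) ({z \<in> tuples M (i + m). tup i z \<in> U} - corr_graph i U f)"
proof (subst openin_subopen, intro ballI)
  let ?n = "i + m"
  let ?tl = "\<lambda>z. tup m (\<lambda>j. z (i + j))"
  have UT: "U \<subseteq> tuples M i" by (rule open_subset_tuples[OF U])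
  fix z assume z: "z \<in> {z \<in> tuples M ?n. tup i z \<in> U} - corr_graph i U f"
  then have zU: "tup i z \<in> U" by blast
  obtain V g where oV: "openin (ptop i) V" and zV: "tup i z \<in> V" and VU: "V \<subseteq> U"
    and g': "\<forall>l<k. continuous_map (subtopology (ptop i) V) (ptop m) (g l)"
    and fg': "\<forall>v\<in>V. f v = {g l v |l. l < k}"
    by (rule continuous_correspondenceE[OF f U zU])
  note g = g'[rule_format] and fg = fg'[rule_format]
  define Q where "Q = {z \<in> tuples M ?n. tup i z \<in> V}"
  have oQ: "openin (ptop ?n) Q"
    using openin_continuous_map_preimage[OF continuous_map_head oV, of m] by (simp add: Q_def)
  define E where "E l = {z \<in> Q. g l (tup i z) = ?tl z}" for l
  have QT: "topspace (subtopology (ptop ?n) Q) = Q" by (auto simp: Q_def)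
  have "closedin (subtopology (ptop ?n) Q) (E l)" if "l < k" for l
  proof -
    have "continuous_map (subtopology (ptop ?n) Q) (subtopology (ptop i) V) (tup i)"
      using continuous_map_from_subtopology[OF continuous_map_head]
      by (intro continuous_map_into_subtopology) (auto simp: Q_def)
    moreover note g[OF that]
    ultimately have "continuous_map (subtopology (ptop ?n) Q) (ptop m) (\<lambda>z. g l (tup i z))"
      using continuous_map_compose[of _ _ "tup i" _ "g l"] by (simp add: comp_def)
    from closedin_continuous_maps_eq[OF Hausdorff_top this
        continuous_map_from_subtopology[OF continuous_map_tail]]
    show ?thesis unfolding QT by (simp only: E_def)
  qed
  then have "closedin (subtopology (ptop ?n) Q) (\<Union>(E ` {..<k}))"
    by (intro closedin_Union) auto
  then have "openin (subtopology (ptop ?n) Q) (Q - \<Union>(E ` {..<k}))"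
    using QT by (metis openin_closedin_eq closedin_def)
  then have T: "openin (ptop ?n) (Q - \<Union>(E ` {..<k}))"
    using oQ by (simp add: openin_open_subtopology)
  have E: "z' \<in> corr_graph i U f \<longleftrightarrow> z' \<in> \<Union>(E ` {..<k})" if "z' \<in> Q" for z'
  proof -
    have z': "z' \<in> tuples M ?n" "tup i z' \<in> V" using that by (auto simp: Q_def)
    have "z' \<in> corr_graph i U f \<longleftrightarrow> ?tl z' \<in> f (tup i z')"
      using corr_graph_iff[OF UT split_tuple(1)[OF z'(1)], of "?tl z'" f] split_tuple(3)[OF z'(1)]
        z'(2) VU by auto
    also have "\<dots> \<longleftrightarrow> z' \<in> \<Union>(E ` {..<k})" using that fg[OF z'(2)] by (auto simp: E_def)
    finally show ?thesis .
  qed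
  have "z \<in> Q" using z zV by (simp add: Q_def)
  then have "z \<in> Q - \<Union>(E ` {..<k})" using E[of z] z by blast
  moreover have "Q - \<Union>(E ` {..<k}) \<subseteq> {z \<in> tuples M ?n. tup i z \<in> U} - corr_graph i U f"
    using E VU by (auto simp: Q_def)
  ultimately show "\<exists>T. openin (ptop ?n) T \<and> z \<in> T \<and>
      T \<subseteq> {z \<in> tuples M ?n. tup i z \<in> U} - corr_graph i U f"
    using T by blast
qed

lemma permute_image_iff:
  assumes "\<sigma> permutes {..<n}"
  shows "z \<in> (\<lambda>x. x \<circ> \<sigma>) ` Z \<longleftrightarrow> z \<circ> Hilbert_Choice.inv \<sigma> \<in> Z"
proof
  assume "z \<in> (\<lambda>x. x \<circ> \<sigma>) ` Z"
  then show "z \<circ> Hilbert_Choice.inv \<sigma> \<in> Z" using permutes_inv_o(1)[OF assms] by (auto simp: comp_assoc)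
next
  assume "z \<circ> Hilbert_Choice.inv \<sigma> \<in> Z"
  moreover have "z = z \<circ> Hilbert_Choice.inv \<sigma> \<circ> \<sigma>" using permutes_inv_o(2)[OF assms] by (simp add: comp_assoc)
  ultimately show "z \<in> (\<lambda>x. x \<circ> \<sigma>) ` Z" by blast
qed

lemma cellE:
  assumes "cell L M \<tau> n C"
  obtains i m k U f \<sigma> where "n = i + m" "definable L M i U" "openin (ptop i) U"
    "definable_correspondence L M i m k U f"
    "continuous_correspondence (subtopology (ptop i) U) (ptop m) k f"
    "\<sigma> permutes {..<n}" "C = (\<lambda>x. x \<circ> \<sigma>) ` corr_graph i U f"
proof -
  obtain i k U f \<sigma> where *: "i \<le> n" "definable L M i U" "openin (ptop i) U"
    "definable_correspondence L M i (n - i) k U f"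
    "continuous_correspondence (subtopology (ptop i) U) (ptop (n - i)) k f"
    "\<sigma> permutes {..<n}" "C = (\<lambda>x. x \<circ> \<sigma>) ` corr_graph i U f"
    using assms unfolding cell_def by metis
  show thesis by (rule that[of i "n - i", OF _ *(2-7)]) (use *(1) in simp)
qed

lemma corr_graph_tuples:
  assumes "definable_correspondence L M i m k U f"
  shows "corr_graph i U f \<subseteq> tuples M (i + m)"
  using assms unfolding definable_correspondence_def by (auto dest: definable_subset)

text \<open>Up to the coordinate permutation, \<open>Q\<close> is the open cylinder over the base,
  and \<open>F\<close> is the complement of the open set which the graph leaves in that
  cylinder.\<close>

lemma cell_locally_closed:
  assumes "cell L M \<tau> n C"
  shows "\<exists>F Q. closedin (ptop n) F \<and> openin (ptop n) Q \<and> C = F \<inter> Q"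
proof -
  obtain i m k U f \<sigma> where n: "n = i + m" and U: "openin (ptop i) U"
    and dc: "definable_correspondence L M i m k U f"
    and cc: "continuous_correspondence (subtopology (ptop i) U) (ptop m) k f"
    and \<sigma>: "\<sigma> permutes {..<n}" and C: "C = (\<lambda>x. x \<circ> \<sigma>) ` corr_graph i U f"
    using assms by (rule cellE)
  let ?\<Gamma> = "corr_graph i U f"
  let ?Q = "{z \<in> tuples M n. tup i z \<in> U}"
  have UT: "U \<subseteq> tuples M i" by (rule open_subset_tuples[OF U])
  have cont: "continuous_map (ptop n) (ptop n) (\<lambda>z. z \<circ> Hilbert_Choice.inv \<sigma>)"
    by (rule continuous_map_permute[OF permutes_inv[OF \<sigma>]])
  have "openin (ptop n) ?Q"
    using openin_continuous_map_preimage[OF continuous_map_head U, of m] by (simp add: n)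
  from openin_continuous_map_preimage[OF cont this]
  have Q': "openin (ptop n) {z \<in> tuples M n. z \<circ> Hilbert_Choice.inv \<sigma> \<in> ?Q}" by simp
  have "openin (ptop n) (?Q - ?\<Gamma>)"
    using graph_locally_closed[OF U cc] by (simp add: n)
  from openin_continuous_map_preimage[OF cont this]
  have F': "openin (ptop n) {z \<in> tuples M n. z \<circ> Hilbert_Choice.inv \<sigma> \<in> ?Q - ?\<Gamma>}" by simp
  have \<Gamma>: "?\<Gamma> \<subseteq> ?Q"
  proof
    fix z assume z: "z \<in> ?\<Gamma>"
    then have zt: "z \<in> tuples M n" using corr_graph_tuples[OF dc] n by blast
    obtain x y where xy: "z = cat i x y" "x \<in> U" "y \<in> f x" using z unfolding corr_graph_def by blast
    have "tup i z = x" using xy UT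
      by (intro tuples_eqI[of _ M i]) (auto simp: tup_in_tuples_iff cat_def tuples_iff)
    then show "z \<in> ?Q" using zt xy by simp
  qed
  have CT: "C \<subseteq> tuples M n"
    unfolding C using tuples_permute[OF _ \<sigma>] corr_graph_tuples[OF dc] n by blast
  have "C = (tuples M n - {z \<in> tuples M n. z \<circ> Hilbert_Choice.inv \<sigma> \<in> ?Q - ?\<Gamma>}) \<inter> {z \<in> tuples M n. z \<circ> Hilbert_Choice.inv \<sigma> \<in> ?Q}"
  proof (intro equalityI subsetI)
    fix z assume "z \<in> C"
    moreover from this have "z \<circ> Hilbert_Choice.inv \<sigma> \<in> ?\<Gamma>" unfolding C permute_image_iff[OF \<sigma>] .
    ultimately show "z \<in> (tuples M n - {z \<in> tuples M n. z \<circ> Hilbert_Choice.inv \<sigma> \<in> ?Q - ?\<Gamma>}) \<inter>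
        {z \<in> tuples M n. z \<circ> Hilbert_Choice.inv \<sigma> \<in> ?Q}" using CT \<Gamma> by blast
  next
    fix z assume "z \<in> (tuples M n - {z \<in> tuples M n. z \<circ> Hilbert_Choice.inv \<sigma> \<in> ?Q - ?\<Gamma>}) \<inter>
        {z \<in> tuples M n. z \<circ> Hilbert_Choice.inv \<sigma> \<in> ?Q}"
    then have "z \<circ> Hilbert_Choice.inv \<sigma> \<in> ?\<Gamma>" by blast
    then show "z \<in> C" unfolding C permute_image_iff[OF \<sigma>] .
  qed
  moreover have "closedin (ptop n) (tuples M n - {z \<in> tuples M n. z \<circ> Hilbert_Choice.inv \<sigma> \<in> ?Q - ?\<Gamma>})"
    using F' closedin_diff[OF closedin_topspace, of "ptop n"] by simp
  ultimately show ?thesis using Q' by blast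
qed

text \<open>Since \<open>f x\<close> has exactly \<open>k\<close> elements, the \<open>k\<close>
  branches have distinct values at \<open>x\<close>, and a box \<open>B\<close> around
  \<open>y\<close> can be separated from all other values near \<open>x\<close>. Definability of
  \<open>B\<close> is the point: it makes the chosen branch definable as the unique element of
  \<open>f v \<inter> B\<close>, although the branches themselves come without formulas.\<close>

lemma graph_branch:
  assumes U: "openin (ptop i) U"
    and f: "continuous_correspondence (subtopology (ptop i) U) (ptop m) k f"
    and x: "x \<in> U" and y: "y \<in> f x"
    and Q: "openin (ptop (i + m)) Q" "cat i x y \<in> Q"
  shows "\<exists>V B g. openin (ptop i) V \<and> x \<in> V \<and> V \<subseteq> U \<and> openin (ptop m) B \<and> definable L M m B \<and>
    (\<forall>v\<in>V. f v \<inter> B = {g v} \<and> cat i v (g v) \<in> Q)"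
proof -
  have UT: "U \<subseteq> tuples M i" by (rule open_subset_tuples[OF U])
  obtain V g where oV: "openin (ptop i) V" and xV: "x \<in> V" and VU: "V \<subseteq> U"
    and gc': "\<forall>l<k. continuous_map (subtopology (ptop i) V) (ptop m) (g l)"
    and fg': "\<forall>v\<in>V. f v = {g l v |l. l < k}"
    by (rule continuous_correspondenceE[OF f U x])
  note gc = gc'[rule_format] and fg = fg'[rule_format]
  have VT: "V \<subseteq> tuples M i" using VU UT by blast
  have gT: "g l v \<in> tuples M m" if "l < k" "v \<in> V" for l v
    using gc[OF that(1)] that(2) VT by (auto simp: continuous_map_ptop)
  have card: "card (f x) = k"
    using f UT x unfolding continuous_correspondence_def correspondence_def by auto
  have fx: "f x = (\<lambda>l. g l x) ` {..<k}" using fg[OF xV] by auto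
  then have inj: "inj_on (\<lambda>l. g l x) {..<k}" using card by (intro eq_card_imp_inj_on) auto
  obtain l0 where l0: "l0 < k" "y = g l0 x" using y fx by auto
  have yT: "y \<in> tuples M m" using gT[OF l0(1) xV] l0(2) by simp
  have "\<exists>A A'. openin (ptop m) A \<and> openin (ptop m) A' \<and> y \<in> A \<and> g l x \<in> A' \<and> disjnt A A'"
    if "l \<in> {..<k} - {l0}" for l
  proof -
    have "g l x \<noteq> y" using inj that l0 by (auto simp: inj_on_def)
    then show ?thesis
      using Hausdorff_top[of m] yT gT[OF _ xV, of l] that unfolding Hausdorff_space_def by auto
  qed
  then obtain A A' where A: "\<And>l. l \<in> {..<k} - {l0} \<Longrightarrow> openin (ptop m) (A l) \<and> openin (ptop m) (A' l) \<and>
      y \<in> A l \<and> g l x \<in> A' l \<and> disjnt (A l) (A' l)"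
    by metis
  \<comment> \<open>For \<open>k = 1\<close> there is nothing to separate, and the whole space is
    the only member of this intersection.\<close>
  define A0 where "A0 = \<Inter>(insert (tuples M m) (A ` ({..<k} - {l0})))"
  have "openin (ptop m) A0"
    unfolding A0_def using A openin_topspace[of "ptop m"] by (intro openin_Inter) auto
  moreover have "y \<in> A0" using A yT by (auto simp: A0_def)
  ultimately obtain b where b: "\<And>j. j < m \<Longrightarrow> b j \<in> Y" "y \<in> box m b" "box m b \<subseteq> A0"
    using ex_box by meson
  let ?B = "box m b"
  have oB: "openin (ptop m) ?B" by (rule open_box) (rule b(1))
  have pre: "openin (ptop i) {v \<in> V. g l v \<in> O'}" if "l < k" "openin (ptop m) O'" for l O'
  proof -
    have "openin (subtopology (ptop i) V) {v \<in> V. g l v \<in> O'}"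
      using openin_continuous_map_preimage[OF gc[OF that(1)] that(2)] VT by (simp add: Int_absorb1)
    then show ?thesis using oV by (simp add: openin_open_subtopology)
  qed
  define V1 where "V1 = \<Inter>(insert V ((\<lambda>l. {v \<in> V. g l v \<in> A' l}) ` ({..<k} - {l0})))"
  have V1: "openin (ptop i) V1"
    unfolding V1_def using A pre oV by (intro openin_Inter) auto
  define V2 where "V2 = {v \<in> V. g l0 v \<in> ?B}"
  have V2: "openin (ptop i) V2" unfolding V2_def by (rule pre[OF l0(1) oB])
  define V3 where "V3 = {v \<in> V. cat i v (g l0 v) \<in> Q}"
  have V3: "openin (ptop i) V3"
  proof -
    have "continuous_map (subtopology (ptop i) V) (ptop (i + m)) (\<lambda>v. cat i v (g l0 v))"
      by (intro continuous_map_cat gc[OF l0(1)] continuous_map_from_subtopology continuous_map_id[unfolded id_def])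
    from openin_continuous_map_preimage[OF this Q(1)]
    have "openin (subtopology (ptop i) V) V3" using VT by (simp add: V3_def Int_absorb1)
    then show ?thesis using oV by (simp add: openin_open_subtopology)
  qed
  have "f v \<inter> ?B = {g l0 v}" if v: "v \<in> V1" "v \<in> V2" for v
  proof -
    have "v \<in> V" using v by (simp add: V2_def)
    have "g l v \<notin> ?B" if "l < k" "l \<noteq> l0" for l
    proof
      assume "g l v \<in> ?B"
      then have "g l v \<in> A l" using b(3) that by (auto simp: A0_def)
      moreover have "g l v \<in> A' l" using v(1) that by (auto simp: V1_def)
      ultimately show False using A[of l] that by (auto simp: disjnt_iff)
    qed
    moreover have "g l0 v \<in> ?B" using v(2) by (simp add: V2_def)
    ultimately show ?thesis unfolding fg[OF \<open>v \<in> V\<close>] using l0(1) by auto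
  qed
  moreover have "x \<in> V1" using xV A by (auto simp: V1_def)
  moreover have "x \<in> V2" using xV b(2) l0 by (simp add: V2_def)
  moreover have "x \<in> V3" using xV Q(2) l0 by (simp add: V3_def)
  moreover have "definable L M m ?B" by (rule definable_box) (rule b(1))
  ultimately show ?thesis
    using V1 V2 V3 VU oB
    by (intro exI[of _ "V1 \<inter> V2 \<inter> V3"] exI[of _ ?B] exI[of _ "g l0"]) (auto simp: V3_def)
qed

section \<open>Definable maps: preimages, images, composites and inverses\<close>

lemma graph_image_iff:
  assumes "X \<subseteq> tuples M n" "x \<in> tuples M n"
  shows "cat n x y \<in> (\<lambda>x. cat n x (h x)) ` X \<longleftrightarrow> x \<in> X \<and> h x = y"
proof
  assume "cat n x y \<in> (\<lambda>x. cat n x (h x)) ` X"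
  then obtain x' where "x' \<in> X" "cat n x y = cat n x' (h x')" by blast
  then show "x \<in> X \<and> h x = y" using assms cat_eq_iff[of x M n x' y "h x'"] by auto
qed auto

lemma definable_mapE:
  assumes "definable_map L M n m X h"
  obtains R where "definable L M (n + m) R" "X \<subseteq> tuples M n" "h ` X \<subseteq> tuples M m"
    "\<forall>x\<in>tuples M n. \<forall>y. cat n x y \<in> R \<longleftrightarrow> x \<in> X \<and> h x = y"
  using assms graph_image_iff[of X n _ _ h] unfolding definable_map_def by blast

lemma definable_mapI:
  assumes "definable L M (n + m) R" "X \<subseteq> tuples M n" "h ` X \<subseteq> tuples M m"
    and "\<And>x y. x \<in> tuples M n \<Longrightarrow> y \<in> tuples M m \<Longrightarrow> cat n x y \<in> R \<longleftrightarrow> x \<in> X \<and> h x = y"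
  shows "definable_map L M n m X h"
proof -
  have "(\<lambda>x. cat n x (h x)) ` X = R"
  proof (intro equalityI subsetI)
    fix z assume z: "z \<in> R"
    then have "z \<in> tuples M (n + m)" using definable_subset[OF assms(1)] by blast
    from split_tuple[OF this] z assms(4) show "z \<in> (\<lambda>x. cat n x (h x)) ` X"
      by (metis (no_types, lifting) image_eqI)
  next
    fix z assume "z \<in> (\<lambda>x. cat n x (h x)) ` X"
    then obtain x where "z = cat n x (h x)" "x \<in> X" by blast
    then show "z \<in> R" using assms(2,3) assms(4)[of x "h x"] by blast
  qed
  then show ?thesis unfolding definable_map_def using assms by simp
qed

lemma definable_preimage:
  assumes h: "definable_map L M n m X h" and A: "definable L M m A" and V: "definable L M n V"
  shows "definable L M n {x \<in> X. x \<in> V \<and> h x \<in> A}"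
proof -
  obtain R where R: "definable L M (n + m) R" and X: "X \<subseteq> tuples M n" and hX: "h ` X \<subseteq> tuples M m"
    and R': "\<forall>x\<in>tuples M n. \<forall>y. cat n x y \<in> R \<longleftrightarrow> x \<in> X \<and> h x = y"
    by (rule definable_mapE[OF h])
  note R_iff = R'[rule_format]
  have "definable L M n {x \<in> tuples M n. \<exists>y\<in>tuples M m. cat n x y \<in> R \<and> y \<in> A \<and> x \<in> V}"
    apply (rule definableI)
    apply (rule dp_ex[where i = 1])
     apply (intro dp_conj)
       apply (rule dp_mem[OF R]; (intro dt_intros)?; simp add: cat_def)
      apply (rule dp_mem_var[OF A])
     apply (rule dp_mem_var[OF V])
    apply simp
    done
  moreover have "{x \<in> tuples M n. \<exists>y\<in>tuples M m. cat n x y \<in> R \<and> y \<in> A \<and> x \<in> V} =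
      {x \<in> X. x \<in> V \<and> h x \<in> A}"
    using R_iff X hX by (auto simp: subset_iff)
  ultimately show ?thesis by simp
qed

lemma definable_image:
  assumes h: "definable_map L M n m X h" and A: "definable L M n A" "A \<subseteq> X"
  shows "definable L M m (h ` A)"
proof -
  obtain R where R: "definable L M (n + m) R" and X: "X \<subseteq> tuples M n" and hX: "h ` X \<subseteq> tuples M m"
    and R': "\<forall>x\<in>tuples M n. \<forall>y. cat n x y \<in> R \<longleftrightarrow> x \<in> X \<and> h x = y"
    by (rule definable_mapE[OF h])
  note R_iff = R'[rule_format]
  have "definable L M m {y \<in> tuples M m. \<exists>x\<in>tuples M n. cat n x y \<in> R \<and> x \<in> A}"
    apply (rule definableI)
    apply (rule dp_ex[where i = 1])
     apply (intro dp_conj)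
      apply (rule dp_mem[OF R]; (intro dt_intros)?; simp add: cat_def)
     apply (rule dp_mem_var[OF A(1)])
    apply simp
    done
  moreover have "{y \<in> tuples M m. \<exists>x\<in>tuples M n. cat n x y \<in> R \<and> x \<in> A} = h ` A"
    using R_iff A(2) X hX by (auto simp: subset_iff image_subset_iff)
  ultimately show ?thesis by simp
qed

lemma definable_map_compose:
  assumes g: "definable_map L M d n U g" and h: "definable_map L M n m X h"
    and V: "definable L M d V" "V \<subseteq> U" "g ` V \<subseteq> X"
  shows "definable_map L M d m V (h \<circ> g)"
proof -
  obtain R where R: "definable L M (n + m) R" and X: "X \<subseteq> tuples M n" and hX: "h ` X \<subseteq> tuples M m"
    and R': "\<forall>x\<in>tuples M n. \<forall>y. cat n x y \<in> R \<longleftrightarrow> x \<in> X \<and> h x = y"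
    by (rule definable_mapE[OF h])
  note R_iff = R'[rule_format]
  obtain S where S: "definable L M (d + n) S" and U: "U \<subseteq> tuples M d" and gU: "g ` U \<subseteq> tuples M n"
    and S': "\<forall>x\<in>tuples M d. \<forall>y. cat d x y \<in> S \<longleftrightarrow> x \<in> U \<and> g x = y"
    by (rule definable_mapE[OF g])
  note S_iff = S'[rule_format]
  let ?P = "\<lambda>u w. u \<in> V \<and> (\<exists>x\<in>tuples M n. cat d u x \<in> S \<and> cat n x w \<in> R)"
  let ?T = "{cat d u w |u w. u \<in> tuples M d \<and> w \<in> tuples M m \<and> ?P u w}"
  have T: "definable L M (d + m) ?T"
    apply (rule definable2I)
    apply (rule dp_conj)
     apply (rule dp_mem_var[OF V(1)])
    apply (rule dp_ex[where i = 3])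
     apply (rule dp_conj)
      apply (rule dp_mem[OF S]; (intro dt_intros)?; simp add: cat_def)
     apply (rule dp_mem[OF R]; (intro dt_intros)?; simp add: cat_def)
    apply simp
    done
  show ?thesis
  proof (rule definable_mapI[OF T])
    show "V \<subseteq> tuples M d" using V(2) U by blast
    show "(h \<circ> g) ` V \<subseteq> tuples M m" using V(3) hX by auto
    fix u w assume uw: "u \<in> tuples M d" "w \<in> tuples M m"
    have "cat d u w \<in> ?T \<longleftrightarrow> ?P u w"
      by (rule cat_mem_Collect_iff[OF uw])
    also have "\<dots> \<longleftrightarrow> u \<in> V \<and> (h \<circ> g) u = w"
      using R_iff S_iff[OF uw(1)] V(2,3) gU X by (auto simp: subset_iff image_subset_iff)
    finally show "cat d u w \<in> ?T \<longleftrightarrow> u \<in> V \<and> (h \<circ> g) u = w" .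
  qed
qed

lemma definable_map_inverse:
  assumes h: "definable_map L M n m X h" and A: "definable L M m A"
    and k: "\<And>y. y \<in> A \<Longrightarrow> k y \<in> X \<and> h (k y) = y" and inj: "inj_on h X"
  shows "definable_map L M m n A k"
proof -
  obtain R where R: "definable L M (n + m) R" and X: "X \<subseteq> tuples M n" and hX: "h ` X \<subseteq> tuples M m"
    and R': "\<forall>x\<in>tuples M n. \<forall>y. cat n x y \<in> R \<longleftrightarrow> x \<in> X \<and> h x = y"
    by (rule definable_mapE[OF h])
  note R_iff = R'[rule_format]
  let ?P = "\<lambda>y x. y \<in> A \<and> cat n x y \<in> R"
  let ?T = "{cat m y x |y x. y \<in> tuples M m \<and> x \<in> tuples M n \<and> ?P y x}"
  have T: "definable L M (m + n) ?T"
    apply (rule definable2I)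
    apply (rule dp_conj)
     apply (rule dp_mem_var[OF A])
    apply (rule dp_mem[OF R]; (intro dt_intros)?; simp add: cat_def)
    done
  show ?thesis
  proof (rule definable_mapI[OF T])
    show "A \<subseteq> tuples M m" by (rule definable_subset[OF A])
    show "k ` A \<subseteq> tuples M n" using k X by auto
    fix y x assume yx: "y \<in> tuples M m" "x \<in> tuples M n"
    have "cat m y x \<in> ?T \<longleftrightarrow> ?P y x"
      by (rule cat_mem_Collect_iff[OF yx])
    also have "\<dots> \<longleftrightarrow> y \<in> A \<and> x \<in> X \<and> h x = y"
      using R_iff[OF yx(2)] by auto
    also have "\<dots> \<longleftrightarrow> y \<in> A \<and> k y = x"
      using k inj by (auto simp: inj_on_def)
    finally show "cat m y x \<in> ?T \<longleftrightarrow> y \<in> A \<and> k y = x" .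
  qed
qed

text \<open>One branch of the correspondence over a small box parametrizes part of the cell. The
  images are relatively open because a point of the cell with base in \<open>V\<close> and fibre
  part in the isolating box \<open>B\<close> can only lie on that branch.\<close>

lemma cell_branch:
  assumes "cell L M \<tau> n C" "openin (ptop n) Q" "Q \<inter> C \<noteq> {}"
  shows "\<exists>d U g. definable L M d U \<and> openin (ptop d) U \<and> U \<noteq> {} \<and> definable_map L M d n U g \<and>
    g ` U \<subseteq> Q \<inter> C \<and> (\<forall>V\<subseteq>U. openin (ptop d) V \<longrightarrow> (\<exists>Q'. openin (ptop n) Q' \<and> g ` V = C \<inter> Q'))"
proof -
  obtain i m k U f \<sigma> where n: "n = i + m" and Ud: "definable L M i U" and U: "openin (ptop i) U"
    and dc: "definable_correspondence L M i m k U f"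
    and cc: "continuous_correspondence (subtopology (ptop i) U) (ptop m) k f"
    and \<sigma>: "\<sigma> permutes {..<n}" and C: "C = (\<lambda>x. x \<circ> \<sigma>) ` corr_graph i U f"
    using assms(1) by (rule cellE)
  have UT: "U \<subseteq> tuples M i" by (rule open_subset_tuples[OF U])
  have fT: "y \<in> tuples M m" if "x \<in> U" "y \<in> f x" for x y
    using that dc unfolding definable_correspondence_def correspondence_def by blast
  have \<Gamma>: "definable L M n (corr_graph i U f)"
    using dc n unfolding definable_correspondence_def by simp
  let ?Q = "{z \<in> tuples M n. z \<circ> \<sigma> \<in> Q}"
  have oQ: "openin (ptop (i + m)) ?Q"
    using openin_continuous_map_preimage[OF continuous_map_permute[OF \<sigma>] assms(2)] by (simp add: n)
  obtain x y where xy: "x \<in> U" "y \<in> f x" "cat i x y \<circ> \<sigma> \<in> Q"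
    using assms(3) unfolding C corr_graph_def by blast
  have "cat i x y \<in> tuples M n" using xy(1,2) UT fT by (auto simp: n intro!: cat_tuples)
  then have "cat i x y \<in> ?Q" using xy(3) by simp
  from graph_branch[OF U cc xy(1,2) oQ this] obtain V B g where V: "openin (ptop i) V" "x \<in> V" "V \<subseteq> U"
    and B: "openin (ptop m) B" "definable L M m B"
    and g: "\<And>v. v \<in> V \<Longrightarrow> f v \<inter> B = {g v} \<and> cat i v (g v) \<in> ?Q" by blast
  obtain b where b: "\<And>j. j < i \<Longrightarrow> b j \<in> Y" "x \<in> box i b" "box i b \<subseteq> V"
    using ex_box[OF V(1,2)] by meson
  define W where "W = box i b"
  define G where "G v = cat i v (g v) \<circ> \<sigma>" for v
  have W: "definable L M i W" "openin (ptop i) W" "W \<noteq> {}" "W \<subseteq> V"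
    unfolding W_def using b definable_box open_box by blast+
  have WT: "W \<subseteq> tuples M i" by (rule open_subset_tuples[OF W(2)])
  have gf: "g v \<in> f v" "g v \<in> B" "cat i v (g v) \<in> ?Q" if "v \<in> W" for v
    using g that W(4) by blast+
  have GT: "G v \<in> tuples M n" if "v \<in> W" for v
    unfolding G_def using gf(3)[OF that] tuples_permute[OF _ \<sigma>] by blast
  have Ginv: "G v \<circ> Hilbert_Choice.inv \<sigma> = cat i v (g v)" for v
    unfolding G_def using permutes_inv_o(1)[OF \<sigma>] by (simp add: comp_assoc)
  have "definable_map L M i n W G"
  proof -
    \<comment> \<open>The branch \<open>g\<close> has no formula of its own, so the graph of
      \<open>G\<close> is described through the graph of \<open>f\<close> and the box
      \<open>B\<close>.\<close>
    let ?P = "\<lambda>v z. v \<in> W \<and> (\<exists>y\<in>tuples M m. cat i v y \<in> corr_graph i U f \<and> y \<in> B \<and> z = cat i v y \<circ> \<sigma>)"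
    let ?T = "{cat i v z |v z. v \<in> tuples M i \<and> z \<in> tuples M n \<and> ?P v z}"
    have \<sigma>_less: "\<sigma> j < n \<longleftrightarrow> j < n" for j using permutes_in_image[OF \<sigma>, of j] by simp
    have \<sigma>_bound: "\<sigma> j - i < m" if "j < n" "\<not> \<sigma> j < i" for j
      using \<sigma>_less[of j] that n by simp
    have \<sigma>_bound': "\<not> \<sigma> j < i" "\<not> \<sigma> j - i < m" if "\<not> j < n" for j
      using \<sigma>_less[of j] that n by simp_all
    have T: "definable L M (i + n) ?T"
      apply (rule definable2I)
      apply (rule dp_conj)
       apply (rule dp_mem_var[OF W(1)])
      apply (rule dp_ex[where i = 3])
       apply (intro dp_conj)
         apply (rule dp_mem[OF \<Gamma>]; (intro dt_intros)?; simp add: cat_def n)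
        apply (rule dp_mem_var[OF B(2)])
       apply (rule dp_tup_eq[where n = n])
          apply (intro dt_intros; simp)
         apply (simp only: comp_apply)
         apply (intro dt_intros; simp add: \<sigma>_bound)
        apply simp
       apply (simp add: cat_def \<sigma>_bound')
      apply simp
      done
    show ?thesis
    proof (rule definable_mapI[OF T WT])
      show "G ` W \<subseteq> tuples M n" using GT by blast
      fix v z assume vz: "v \<in> tuples M i" "z \<in> tuples M n"
      have "cat i v z \<in> ?T \<longleftrightarrow> ?P v z"
        by (rule cat_mem_Collect_iff[OF vz])
      also have "\<dots> \<longleftrightarrow> v \<in> W \<and> G v = z"
      proof (cases "v \<in> W")
        case True
        have *: "cat i v y \<in> corr_graph i U f \<and> y \<in> B \<longleftrightarrow> y = g v" for y
          using corr_graph_iff[OF UT vz(1), of y f] g[of v] True W(4) V(3) by blast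
        have "?P v z \<longleftrightarrow> (\<exists>y\<in>tuples M m. (cat i v y \<in> corr_graph i U f \<and> y \<in> B) \<and> z = cat i v y \<circ> \<sigma>)"
          using True by blast
        moreover have "g v \<in> tuples M m" using True gf(1) W(4) V(3) fT by blast
        ultimately show ?thesis unfolding * using True by (auto simp: G_def)
      qed simp
      finally show "cat i v z \<in> ?T \<longleftrightarrow> v \<in> W \<and> G v = z" .
    qed
  qed
  moreover have "G ` W \<subseteq> Q \<inter> C"
  proof
    fix z assume "z \<in> G ` W"
    then obtain v where v: "v \<in> W" "z = G v" by blast
    have "z \<in> Q" using v gf(3) by (simp add: G_def)
    moreover have "z \<in> C"
      unfolding C v(2) G_def corr_graph_def using gf(1)[OF v(1)] v(1) W(4) V(3) by blast
    ultimately show "z \<in> Q \<inter> C" by blast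
  qed
  moreover have "\<exists>Q'. openin (ptop n) Q' \<and> G ` V' = C \<inter> Q'" if V': "V' \<subseteq> W" "openin (ptop i) V'" for V'
  proof -
    \<comment> \<open>The first condition controls the base point, the second selects the branch;
      intersected with the graph of \<open>f\<close>, this leaves the chosen branch over
      \<open>V'\<close>.\<close>
    define R where "R = {z \<in> tuples M n. tup i z \<in> V'} \<inter> {z \<in> tuples M n. tup m (\<lambda>j. z (i + j)) \<in> B}"
    have "openin (ptop n) R"
      unfolding R_def
      using openin_continuous_map_preimage[OF continuous_map_head V'(2), of m]
        openin_continuous_map_preimage[OF continuous_map_tail B(1), of i]
      by (intro openin_Int) (simp_all add: n)
    from openin_continuous_map_preimage[OF continuous_map_permute[OF permutes_inv[OF \<sigma>]] this]
    have "openin (ptop n) {z \<in> tuples M n. z \<circ> Hilbert_Choice.inv \<sigma> \<in> R}" by simp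
    moreover have "G ` V' = C \<inter> {z \<in> tuples M n. z \<circ> Hilbert_Choice.inv \<sigma> \<in> R}"
    proof -
      have head_tail: "cat i v y \<in> R \<longleftrightarrow> v \<in> V' \<and> y \<in> B" if "v \<in> U" "y \<in> f v" for v y
      proof -
        have vy: "v \<in> tuples M i" "y \<in> tuples M m" using that UT fT by blast+
        have "tup i (cat i v y) = v" "tup m (\<lambda>j. cat i v y (i + j)) = y"
          using vy by (auto simp: tup_def cat_def fun_eq_iff tuples_iff)
        then show ?thesis using cat_tuples[OF vy] by (simp add: R_def n)
      qed
      show ?thesis
      proof (intro equalityI subsetI)
        fix z assume "z \<in> G ` V'"
        then obtain v where v: "v \<in> V'" "z = G v" by blast
        then have "v \<in> W" "v \<in> U" using V'(1) W(4) V(3) by blast+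
        then have "cat i v (g v) \<in> R" using head_tail[of v "g v"] v gf by blast
        moreover have "z \<in> C" "z \<in> tuples M n"
          using \<open>G ` W \<subseteq> Q \<inter> C\<close> \<open>v \<in> W\<close> v GT by blast+
        ultimately show "z \<in> C \<inter> {z \<in> tuples M n. z \<circ> Hilbert_Choice.inv \<sigma> \<in> R}" using v Ginv by simp
      next
        fix z assume z: "z \<in> C \<inter> {z \<in> tuples M n. z \<circ> Hilbert_Choice.inv \<sigma> \<in> R}"
        then obtain v y where vy: "z = cat i v y \<circ> \<sigma>" "v \<in> U" "y \<in> f v"
          unfolding C corr_graph_def by blast
        have "z \<circ> Hilbert_Choice.inv \<sigma> = cat i v y" unfolding vy(1) using permutes_inv_o(1)[OF \<sigma>] by (simp add: comp_assoc)
        then have "v \<in> V'" "y \<in> B" using z head_tail[OF vy(2,3)] by auto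
        moreover from this have "y = g v" using g[of v] vy(3) V'(1) W(4) by blast
        ultimately show "z \<in> G ` V'" using vy(1) by (auto simp: G_def)
      qed
    qed
    ultimately show ?thesis by blast
  qed
  ultimately show ?thesis using W(1-3) by (intro exI[of _ i] exI[of _ W] exI[of _ G]) blast
qed

text \<open>A map is a correspondence with \<open>k = 1\<close>. Its continuity locus is not empty,
  since otherwise the non-empty open set \<open>U\<close> would have dimension below
  \<open>d\<close>.\<close>

lemma generic_continuity:
  assumes h: "definable_map L M d m U h" and U: "definable L M d U" "openin (ptop d) U" "U \<noteq> {}"
  shows "\<exists>V\<subseteq>U. openin (ptop d) V \<and> V \<noteq> {} \<and> continuous_map (subtopology (ptop d) V) (ptop m) h"
proof -
  let ?f = "\<lambda>x. {h x}"
  have "corr_graph d U ?f = (\<lambda>x. cat d x (h x)) ` U" by (auto simp: corr_graph_def)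
  then have dc: "definable_correspondence L M d m 1 U ?f"
    using h unfolding definable_correspondence_def correspondence_def definable_map_def by auto
  obtain U0 where U0: "U0 \<subseteq> U" "definable L M d U0" "openin (ptop d) U0"
      "dim \<tau> d (U - U0) < ereal (real d)"
      "continuous_correspondence (subtopology (ptop d) U0) (ptop m) 1 ?f"
    using niceness dc U(1,2) unfolding nice_def by meson
  have "U0 \<noteq> {}"
  proof
    assume "U0 = {}"
    then have "ptop d interior_of U = {}"
      using dim_less_imp_interior_empty[OF open_subset_tuples[OF U(2)]] U0(4) by simp
    then show False using U(2,3) by (simp add: interior_of_openin)
  qed
  then obtain x where x: "x \<in> U0" by blast
  obtain V g where V: "openin (ptop d) V" "x \<in> V" "V \<subseteq> U0"
    and g: "\<forall>l<1::nat. continuous_map (subtopology (ptop d) V) (ptop m) (g l)"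
    and fg: "\<forall>v\<in>V. {h v} = {g l v |l::nat. l < 1}"
    by (rule continuous_correspondenceE[OF U0(5,3) x])
  have "continuous_map (subtopology (ptop d) V) (ptop m) h"
  proof (rule continuous_map_eq)
    show "continuous_map (subtopology (ptop d) V) (ptop m) (g 0)" using g by simp
    fix v assume "v \<in> topspace (subtopology (ptop d) V)"
    then show "g 0 v = h v" using fg by auto
  qed
  then show ?thesis using V U0(1) by blast
qed

section \<open>Maps into definable manifolds and parametrizations of definable subsets\<close>

lemma manifold_chart:
  assumes "definable_manifold L M \<tau> n X t"
  obtains \<V> where "finite \<V>" "\<Union>\<V> = X"
    "\<forall>V\<in>\<V>. definable L M n V \<and> openin t V \<and>
       (\<exists>m C W h. cell L M \<tau> m C \<and> openin (subtopology (ptop m) C) W \<and>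
          definable_map L M n m V h \<and>
          homeomorphic_map (subtopology t V) (subtopology (ptop m) W) h)"
  using assms unfolding definable_manifold_def by (elim conjE exE)

text \<open>The preimages of the finitely many chart domains form a definable cover of
  \<open>U\<close>, so an open part of \<open>U\<close> is sent into one chart. There the question
  becomes continuity into a power of the structure, and the inverse of the chart carries the answer
  back to \<open>t\<close>.\<close>

lemma generic_continuity_manifold:
  assumes X: "definable_manifold L M \<tau> n X t"
    and \<psi>: "definable_map L M d n U \<psi>" "\<psi> ` U \<subseteq> X"
    and U: "definable L M d U" "openin (ptop d) U" "U \<noteq> {}"
  shows "\<exists>V\<subseteq>U. openin (ptop d) V \<and> V \<noteq> {} \<and> continuous_map (subtopology (ptop d) V) t \<psi>"
proof -
  obtain \<V> where \<V>: "finite \<V>" "\<Union>\<V> = X"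
    and chart: "\<forall>V\<in>\<V>. definable L M n V \<and> openin t V \<and>
       (\<exists>m C W h. cell L M \<tau> m C \<and> openin (subtopology (ptop m) C) W \<and>
          definable_map L M n m V h \<and>
          homeomorphic_map (subtopology t V) (subtopology (ptop m) W) h)"
    by (rule manifold_chart[OF X])
  have "\<exists>U'. \<exists>P\<in>(\<lambda>V. {x \<in> U. x \<in> U \<and> \<psi> x \<in> V}) ` \<V>.
      openin (ptop d) U' \<and> U' \<noteq> {} \<and> U' \<subseteq> U \<and> U' \<subseteq> P"
  proof (rule open_cover)
    show "definable L M d P" if "P \<in> (\<lambda>V. {x \<in> U. x \<in> U \<and> \<psi> x \<in> V}) ` \<V>" for P
      using that chart definable_preimage[OF \<psi>(1) _ U(1)] by auto
    show "U \<subseteq> \<Union>((\<lambda>V. {x \<in> U. x \<in> U \<and> \<psi> x \<in> V}) ` \<V>)"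
      using \<psi>(2) \<V>(2) by auto
  qed (use \<V> U in auto)
  then obtain V U1 where V: "V \<in> \<V>" and U1: "openin (ptop d) U1" "U1 \<noteq> {}" "U1 \<subseteq> U" "\<psi> ` U1 \<subseteq> V"
    by auto
  \<comment> \<open>\<open>U1\<close> is only known to be open; a box inside it is in addition
    definable, as the composition with the chart requires.\<close>
  obtain x where "x \<in> U1" using U1(2) by blast
  then obtain b where b: "\<And>j. j < d \<Longrightarrow> b j \<in> Y" "x \<in> box d b" "box d b \<subseteq> U1"
    using ex_box[OF U1(1)] by meson
  let ?B = "box d b"
  obtain m C W h where h: "definable_map L M n m V h"
      "homeomorphic_map (subtopology t V) (subtopology (ptop m) W) h"
    and oV: "openin t V"
    using chart V by auto
  have B: "definable L M d ?B" by (rule definable_box) (rule b(1))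
  have oB: "openin (ptop d) ?B" by (rule open_box) (rule b(1))
  have BU: "?B \<subseteq> U" using b(3) U1(3) by (rule subset_trans)
  have BV: "\<psi> ` ?B \<subseteq> V" using b(3) U1(4) by blast
  have "definable_map L M d m ?B (h \<circ> \<psi>)"
    by (rule definable_map_compose[OF \<psi>(1) h(1) B BU BV])
  from generic_continuity[OF this B oB] b(2)
  obtain V' where V': "V' \<subseteq> ?B" "openin (ptop d) V'" "V' \<noteq> {}"
      "continuous_map (subtopology (ptop d) V') (ptop m) (h \<circ> \<psi>)"
    by blast
  obtain k where k: "homeomorphic_maps (subtopology t V) (subtopology (ptop m) W) h k"
    using h(2) homeomorphic_map_maps by blast
  have topV: "topspace (subtopology t V) = V"
    using openin_subset[OF oV] by auto
  have kc: "continuous_map (subtopology (ptop m) W) (subtopology t V) k"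
    and kh: "\<And>x. x \<in> V \<Longrightarrow> k (h x) = x"
    and hV: "\<And>x. x \<in> V \<Longrightarrow> h x \<in> W"
    using k homeomorphic_imp_surjective_map[OF h(2)] unfolding homeomorphic_maps_def topV by auto
  have "continuous_map (subtopology (ptop d) V') (subtopology (ptop m) W) (h \<circ> \<psi>)"
  proof (rule continuous_map_into_subtopology[OF V'(4)])
    have "h (\<psi> x) \<in> W" if "x \<in> V'" for x using that hV BV V'(1) by blast
    then show "h \<circ> \<psi> \<in> topspace (subtopology (ptop d) V') \<rightarrow> W" by auto
  qed
  from continuous_map_compose[OF this kc]
  have "continuous_map (subtopology (ptop d) V') t (k \<circ> (h \<circ> \<psi>))"
    by (simp add: continuous_map_in_subtopology)
  then have "continuous_map (subtopology (ptop d) V') t \<psi>"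
    by (rule continuous_map_eq) (use kh BV V'(1) in auto)
  then show ?thesis using V' BU by blast
qed

text \<open>Both conclusions come from one choice of a chart and of a cell with which the image of
  \<open>H\<close> agrees near a point. The branch of that cell, followed by the inverse chart, is
  the parametrization; the cell being locally closed gives the second conclusion.\<close>

lemma open_parametrization:
  assumes X: "definable_manifold L M \<tau> n X t" and H: "definable L M n H" "H \<subseteq> X" "H \<noteq> {}"
  shows "\<exists>d U \<psi>. definable L M d U \<and> openin (ptop d) U \<and> U \<noteq> {} \<and> definable_map L M d n U \<psi> \<and>
      \<psi> ` U \<subseteq> H \<and> (\<forall>V\<subseteq>U. openin (ptop d) V \<longrightarrow> openin (subtopology t H) (\<psi> ` V))"
    and "\<exists>O'. openin t O' \<and> O' \<inter> H \<noteq> {} \<and> closedin (subtopology t O') (O' \<inter> H)"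
proof -
  obtain \<V> where \<V>: "finite \<V>" "\<Union>\<V> = X"
    and chart: "\<forall>V\<in>\<V>. definable L M n V \<and> openin t V \<and>
       (\<exists>m C W h. cell L M \<tau> m C \<and> openin (subtopology (ptop m) C) W \<and>
          definable_map L M n m V h \<and>
          homeomorphic_map (subtopology t V) (subtopology (ptop m) W) h)"
    by (rule manifold_chart[OF X])
  obtain V where V: "V \<in> \<V>" "V \<inter> H \<noteq> {}" using \<V>(2) H(2,3) by blast
  obtain m C W h where h: "definable_map L M n m V h"
      "homeomorphic_map (subtopology t V) (subtopology (ptop m) W) h"
    and oV: "openin t V" and dV: "definable L M n V"
    using chart V(1) by auto
  have topV: "topspace (subtopology t V) = V"
    using openin_subset[OF oV] by auto
  obtain k where k: "homeomorphic_maps (subtopology t V) (subtopology (ptop m) W) h k"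
    using h(2) homeomorphic_map_maps by blast
  have hc: "continuous_map (subtopology t V) (ptop m) h" and kh: "\<And>x. x \<in> V \<Longrightarrow> k (h x) = x"
    using k unfolding homeomorphic_maps_def topV by (auto simp: continuous_map_in_subtopology)
  have inj: "inj_on h V" by (rule inj_on_inverseI[of V k]) (rule kh)
  have pre_open: "openin t {v \<in> V. h v \<in> Q}" if "openin (ptop m) Q" for Q
    using openin_continuous_map_preimage[OF hc that] unfolding topV
    by (rule openin_trans_full[OF _ oV])
  have pre_closed: "closedin (subtopology t V) {v \<in> V. h v \<in> F}" if "closedin (ptop m) F" for F
    using closedin_continuous_map_preimage[OF hc that] unfolding topV .
  have VH: "definable L M n (V \<inter> H)" by (rule definable_Int[OF dV H(1)])
  define D where "D = h ` (V \<inter> H)"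
  have D: "definable L M m D" unfolding D_def by (rule definable_image[OF h(1) VH]) auto
  have kD: "k y \<in> V \<inter> H" "h (k y) = y" if "y \<in> D" for y
    using that kh by (auto simp: D_def)
  obtain \<C> where \<C>: "finite \<C>" "\<forall>C\<in>\<C>. cell L M \<tau> m C" "\<Union>\<C> = D"
    using cell_decomposition[OF D] unfolding cellular_def by blast
  have "D \<noteq> {}" using V(2) by (auto simp: D_def)
  have "\<exists>C\<in>\<C>. \<exists>Q. openin (ptop m) Q \<and> Q \<inter> \<Union>\<C> \<noteq> {} \<and> Q \<inter> \<Union>\<C> \<subseteq> C"
  proof (rule finite_union_locally_closed[OF \<C>(1)])
    show "\<C> \<noteq> {}" "\<Union>\<C> \<noteq> {}" using \<C>(3) \<open>D \<noteq> {}\<close> by auto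
    show "\<Union>\<C> \<subseteq> topspace (ptop m)" using \<C>(3) definable_subset[OF D] by simp
    show "\<exists>F Q. closedin (ptop m) F \<and> openin (ptop m) Q \<and> C = F \<inter> Q" if "C \<in> \<C>" for C
      using cell_locally_closed \<C>(2) that by blast
  qed
  then obtain C' Q where C': "cell L M \<tau> m C'" "C' \<subseteq> D"
    and Q: "openin (ptop m) Q" "Q \<inter> D \<noteq> {}" "Q \<inter> D \<subseteq> C'"
    using \<C>(2,3) by blast
  have QC: "Q \<inter> C' = Q \<inter> D" using C'(2) Q(3) by blast
  show "\<exists>d U \<psi>. definable L M d U \<and> openin (ptop d) U \<and> U \<noteq> {} \<and> definable_map L M d n U \<psi> \<and>
      \<psi> ` U \<subseteq> H \<and> (\<forall>V\<subseteq>U. openin (ptop d) V \<longrightarrow> openin (subtopology t H) (\<psi> ` V))"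
  proof -
    have "Q \<inter> C' \<noteq> {}" using QC Q(2) by simp
    from cell_branch[OF C'(1) Q(1) this] obtain d U g where U: "definable L M d U" "openin (ptop d) U" "U \<noteq> {}"
      and g: "definable_map L M d m U g" "g ` U \<subseteq> Q \<inter> C'"
      and g_open: "\<forall>V\<subseteq>U. openin (ptop d) V \<longrightarrow> (\<exists>Q'. openin (ptop m) Q' \<and> g ` V = C' \<inter> Q')"
      by (elim exE conjE)
    have gD: "g ` U \<subseteq> D" using g(2) C'(2) by blast
    have "definable_map L M m n D k"
      by (rule definable_map_inverse[OF h(1) D _ inj]) (use kD in blast)
    from definable_map_compose[OF g(1) this U(1) subset_refl gD]
    have "definable_map L M d n U (k \<circ> g)" .
    moreover have "(k \<circ> g) ` U \<subseteq> H" using gD kD(1) by auto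
    moreover have "openin (subtopology t H) ((k \<circ> g) ` V')" if V': "V' \<subseteq> U" "openin (ptop d) V'" for V'
    proof -
      obtain Q' where Q': "openin (ptop m) Q'" "g ` V' = C' \<inter> Q'" using g_open V' by blast
      have "(k \<circ> g) ` V' = {v \<in> V. h v \<in> Q \<inter> Q'} \<inter> H"
      proof (intro equalityI subsetI)
        fix v assume "v \<in> (k \<circ> g) ` V'"
        then obtain u where u: "u \<in> V'" "v = k (g u)" by auto
        then have "g u \<in> D" "g u \<in> Q" "g u \<in> Q'" using gD g(2) V'(1) Q'(2) by blast+
        then show "v \<in> {v \<in> V. h v \<in> Q \<inter> Q'} \<inter> H" using kD[of "g u"] u(2) by simp
      next
        fix v assume v: "v \<in> {v \<in> V. h v \<in> Q \<inter> Q'} \<inter> H"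
        then have "h v \<in> D" by (auto simp: D_def)
        then have "h v \<in> g ` V'" using v Q(3) Q'(2) by blast
        then obtain u where "u \<in> V'" "h v = g u" by blast
        then show "v \<in> (k \<circ> g) ` V'" using kh[of v] v by (metis (no_types, lifting) IntD1 comp_apply imageI mem_Collect_eq)
      qed
      moreover have "openin t {v \<in> V. h v \<in> Q \<inter> Q'}" by (intro pre_open openin_Int Q(1) Q'(1))
      ultimately show ?thesis unfolding openin_subtopology by blast
    qed
    ultimately show ?thesis using U by blast
  qed
  show "\<exists>O'. openin t O' \<and> O' \<inter> H \<noteq> {} \<and> closedin (subtopology t O') (O' \<inter> H)"
  proof -
    obtain F Q' where F: "closedin (ptop m) F" and Q': "openin (ptop m) Q'" and C'FQ: "C' = F \<inter> Q'"
      using cell_locally_closed[OF C'(1)] by blast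
    \<comment> \<open>On \<open>Q\<close> the image \<open>D\<close> coincides with
      \<open>C'\<close>, and on \<open>Q'\<close> the cell \<open>C'\<close> coincides with the
      closed set \<open>F\<close>; so on the preimage of both, \<open>H\<close> is the preimage of
      \<open>F\<close>.\<close>
    define O' where "O' = {v \<in> V. h v \<in> Q \<inter> Q'}"
    have "openin t O'" unfolding O'_def by (intro pre_open openin_Int Q(1) Q')
    moreover have "O' \<inter> H \<noteq> {}"
    proof -
      obtain y where y: "y \<in> Q" "y \<in> D" using Q(2) by blast
      then have "y \<in> Q'" using Q(3) C'FQ by blast
      then show ?thesis using y kD[OF y(2)] by (auto simp: O'_def)
    qed
    moreover have "closedin (subtopology t O') (O' \<inter> H)"
    proof -
      have "O' \<inter> H = O' \<inter> {v \<in> V. h v \<in> F}"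
      proof (intro equalityI subsetI)
        fix v assume v: "v \<in> O' \<inter> H"
        then have "h v \<in> Q \<inter> D" by (auto simp: O'_def D_def)
        then show "v \<in> O' \<inter> {v \<in> V. h v \<in> F}" using v Q(3) C'FQ by (auto simp: O'_def)
      next
        fix v assume v: "v \<in> O' \<inter> {v \<in> V. h v \<in> F}"
        then have "h v \<in> D" using C'FQ C'(2) by (auto simp: O'_def)
        then obtain v' where "v' \<in> V \<inter> H" "h v = h v'" by (auto simp: D_def)
        then show "v \<in> O' \<inter> H" using inj v by (auto simp: inj_on_def)
      qed
      moreover obtain F' where "closedin t F'" "{v \<in> V. h v \<in> F} = F' \<inter> V"
        using pre_closed[OF F] unfolding closedin_subtopology by blast
      moreover have "O' \<subseteq> V" by (auto simp: O'_def)
      ultimately have "O' \<inter> H = F' \<inter> O'" by blast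
      then show ?thesis using \<open>closedin t F'\<close> unfolding closedin_subtopology by blast
    qed
    ultimately show ?thesis by blast
  qed
qed

text \<open>The parametrization \<open>\<psi>\<close> is open for the topology induced by
  \<open>t\<close> and generically continuous for \<open>u\<close>. Pulling a
  \<open>u\<close>-neighbourhood back along \<open>\<psi>\<close> and pushing it forward gives a
  \<open>t\<close>-neighbourhood. The two manifolds are kept independent so that the result can be
  applied with their roles exchanged.\<close>

lemma identity_continuous_somewhere:
  assumes X: "definable_manifold L M \<tau> n X t" "H \<subseteq> X"
    and Z: "definable_manifold L M \<tau> n Z u" "H \<subseteq> Z"
    and H: "definable L M n H" "H \<noteq> {}"
  shows "\<exists>p\<in>H. \<forall>N. openin u N \<longrightarrow> p \<in> N \<longrightarrow> (\<exists>N'. openin (subtopology t H) N' \<and> p \<in> N' \<and> N' \<subseteq> N)"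
proof -
  obtain d U \<psi> where U: "definable L M d U" "openin (ptop d) U" "U \<noteq> {}"
    and \<psi>: "definable_map L M d n U \<psi>" "\<psi> ` U \<subseteq> H"
      "\<forall>V\<subseteq>U. openin (ptop d) V \<longrightarrow> openin (subtopology t H) (\<psi> ` V)"
    using open_parametrization(1)[OF X(1) H(1) X(2) H(2)] by (elim exE conjE)
  obtain V where V: "V \<subseteq> U" "openin (ptop d) V" "V \<noteq> {}" "continuous_map (subtopology (ptop d) V) u \<psi>"
    using generic_continuity_manifold[OF Z(1) \<psi>(1) subset_trans[OF \<psi>(2) Z(2)] U] by blast
  obtain v where v: "v \<in> V" using V(3) by blast
  have topV: "topspace (subtopology (ptop d) V) = V" using openin_subset[OF V(2)] by auto
  have "\<exists>N'. openin (subtopology t H) N' \<and> \<psi> v \<in> N' \<and> N' \<subseteq> N" if N: "openin u N" "\<psi> v \<in> N" for N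
  proof -
    have "openin (ptop d) {x \<in> V. \<psi> x \<in> N}"
      using openin_continuous_map_preimage[OF V(4) N(1)] unfolding topV
      by (rule openin_trans_full[OF _ V(2)])
    moreover have "{x \<in> V. \<psi> x \<in> N} \<subseteq> U" using V(1) by auto
    ultimately have "openin (subtopology t H) (\<psi> ` {x \<in> V. \<psi> x \<in> N})" using \<psi>(3) by simp
    then show ?thesis using v N(2) by (intro exI[of _ "\<psi> ` {x \<in> V. \<psi> x \<in> N}"]) auto
  qed
  then show ?thesis using v V(1) \<psi>(2) by (intro bexI[of _ "\<psi> v"]) auto
qed

end

section \<open>Topological groups\<close>

lemma topological_group_translation:
  assumes "topological_group G t" "h \<in> carrier G"
  shows "continuous_map t t (\<lambda>x. h \<otimes>\<^bsub>G\<^esub> x)"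
proof -
  have m: "continuous_map (prod_topology t t) t (\<lambda>(x, y). x \<otimes>\<^bsub>G\<^esub> y)" and "h \<in> topspace t"
    using assms by (auto simp: topological_group_def)
  then have "continuous_map t (prod_topology t t) (\<lambda>x. (h, x))"
    by (intro continuous_map_pairedI) (auto intro: continuous_map_id[unfolded id_def])
  from continuous_map_compose[OF this m] show ?thesis by (simp add: comp_def)
qed

text \<open>Only left translations by elements of \<open>H\<close> are required, so the result
  covers \<open>H\<close> with its own topology and with the subspace topology, as well as the
  surrounding group as target.\<close>

lemma identity_continuous_everywhere:
  assumes G: "group G" "subgroup H G"
    and t: "topspace t = H" "\<And>h. h \<in> H \<Longrightarrow> continuous_map t t (\<lambda>x. h \<otimes>\<^bsub>G\<^esub> x)"
    and u: "H \<subseteq> topspace u" "\<And>h. h \<in> H \<Longrightarrow> continuous_map u u (\<lambda>x. h \<otimes>\<^bsub>G\<^esub> x)"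
    and p: "p \<in> H" "\<And>N. openin u N \<Longrightarrow> p \<in> N \<Longrightarrow> \<exists>N'. openin t N' \<and> p \<in> N' \<and> N' \<subseteq> N"
  shows "continuous_map t u (\<lambda>x. x)"
  unfolding continuous_map
proof (intro conjI allI impI)
  interpret group G by (rule G(1))
  have HG: "x \<in> carrier G" if "x \<in> H" for x using subgroup.mem_carrier[OF G(2) that] .
  show "(\<lambda>x. x) ` topspace t \<subseteq> topspace u" using t(1) u(1) by simp
  fix N assume N: "openin u N"
  show "openin t {x \<in> topspace t. x \<in> N}"
  proof (subst openin_subopen, intro ballI)
    fix q assume "q \<in> {x \<in> topspace t. x \<in> N}"
    then have q: "q \<in> H" "q \<in> N" using t(1) by auto
    \<comment> \<open>Translation by \<open>a\<close> carries \<open>q\<close> to the point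
      \<open>p\<close> of known continuity, and it is continuous with continuous inverse in both
      topologies.\<close>
    define a where "a = p \<otimes>\<^bsub>G\<^esub> inv\<^bsub>G\<^esub> q"
    have a: "a \<in> H" "inv\<^bsub>G\<^esub> a \<in> H"
      using p(1) q(1) G(2) by (auto simp: a_def subgroup.m_closed subgroup.m_inv_closed)
    have aq: "a \<otimes>\<^bsub>G\<^esub> q = p" using HG p(1) q(1) by (simp add: a_def m_assoc)
    have inva: "inv\<^bsub>G\<^esub> a \<otimes>\<^bsub>G\<^esub> (a \<otimes>\<^bsub>G\<^esub> x) = x" if "x \<in> H" for x
      using HG that a by (simp add: m_assoc[symmetric])
    define N1 where "N1 = {x \<in> topspace u. inv\<^bsub>G\<^esub> a \<otimes>\<^bsub>G\<^esub> x \<in> N}"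
    have "openin u N1" unfolding N1_def by (rule openin_continuous_map_preimage[OF u(2)[OF a(2)] N])
    moreover have "p \<in> N1" using p(1) u(1) q inva[OF q(1)] by (auto simp: N1_def aq)
    ultimately obtain N' where N': "openin t N'" "p \<in> N'" "N' \<subseteq> N1" using p(2) by blast
    have "openin t {x \<in> topspace t. a \<otimes>\<^bsub>G\<^esub> x \<in> N'}"
      by (rule openin_continuous_map_preimage[OF t(2)[OF a(1)] N'(1)])
    moreover have "q \<in> {x \<in> topspace t. a \<otimes>\<^bsub>G\<^esub> x \<in> N'}" using q(1) t(1) aq N'(2) by simp
    moreover have "{x \<in> topspace t. a \<otimes>\<^bsub>G\<^esub> x \<in> N'} \<subseteq> {x \<in> topspace t. x \<in> N}"
    proof
      fix x assume x: "x \<in> {x \<in> topspace t. a \<otimes>\<^bsub>G\<^esub> x \<in> N'}"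
      then have "inv\<^bsub>G\<^esub> a \<otimes>\<^bsub>G\<^esub> (a \<otimes>\<^bsub>G\<^esub> x) \<in> N" using N'(3) by (auto simp: N1_def)
      then show "x \<in> {x \<in> topspace t. x \<in> N}" using x t(1) inva[of x] by simp
    qed
    ultimately show "\<exists>T. openin t T \<and> q \<in> T \<and> T \<subseteq> {x \<in> topspace t. x \<in> N}" by blast
  qed
qed

text \<open>Near \<open>p\<close> the closure of \<open>H\<close> adds nothing to \<open>H\<close>.
  A point \<open>q\<close> of the closure can be translated by some \<open>a \<in> H\<close> into
  this neighbourhood while staying in the closure, hence into \<open>H\<close>; undoing the
  translation gives \<open>q \<in> H\<close>.\<close>

lemma locally_closed_subgroup_closed:
  assumes t: "topological_group G t" and H: "subgroup H G"
    and U: "openin t U" "U \<inter> H \<noteq> {}" "closedin (subtopology t U) (U \<inter> H)"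
  shows "closedin t H"
proof -
  interpret group G using t by (simp add: topological_group_def)
  have top: "topspace t = carrier G" using t by (simp add: topological_group_def)
  have HG: "x \<in> carrier G" if "x \<in> H" for x using subgroup.mem_carrier[OF H that] .
  obtain p where p: "p \<in> U" "p \<in> H" using U(2) by blast
  obtain F where F: "closedin t F" "U \<inter> H = F \<inter> U"
    using U(3) unfolding closedin_subtopology by blast
  have clU: "U \<inter> t closure_of H \<subseteq> H"
  proof -
    have "U \<inter> t closure_of H \<subseteq> t closure_of (U \<inter> H)"
      by (rule openin_Int_closure_of_subset[OF U(1)])
    also have "\<dots> \<subseteq> F" by (rule closure_of_minimal) (use F in auto)
    finally show ?thesis using F(2) by blast
  qed
  have "q \<in> H" if q: "q \<in> t closure_of H" for q
  proof -
    have qG: "q \<in> carrier G" using q closure_of_subset_topspace[of t H] top by blast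
    \<comment> \<open>The map sending \<open>x\<close> to \<open>p\<close> times the inverse of
      \<open>x\<close> times \<open>q\<close> takes \<open>q\<close> to \<open>p\<close>. It
      therefore takes some \<open>h \<in> H\<close> close to \<open>q\<close> into \<open>U\<close>,
      and \<open>a\<close> is \<open>p\<close> times the inverse of \<open>h\<close>.\<close>
    have "continuous_map t (prod_topology t t) (\<lambda>x. (inv\<^bsub>G\<^esub> x, q))"
      using t qG top by (intro continuous_map_pairedI) (auto simp: topological_group_def)
    moreover have "continuous_map (prod_topology t t) t (\<lambda>(x, y). x \<otimes>\<^bsub>G\<^esub> y)"
      using t by (simp add: topological_group_def)
    ultimately have "continuous_map t t (\<lambda>x. inv\<^bsub>G\<^esub> x \<otimes>\<^bsub>G\<^esub> q)"
      using continuous_map_compose by (fastforce simp: comp_def)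
    from continuous_map_compose[OF this topological_group_translation[OF t HG[OF p(2)]]]
    have "continuous_map t t (\<lambda>x. p \<otimes>\<^bsub>G\<^esub> (inv\<^bsub>G\<^esub> x \<otimes>\<^bsub>G\<^esub> q))" by (simp add: comp_def)
    from openin_continuous_map_preimage[OF this U(1)]
    have "openin t {x \<in> carrier G. p \<otimes>\<^bsub>G\<^esub> (inv\<^bsub>G\<^esub> x \<otimes>\<^bsub>G\<^esub> q) \<in> U}" by (simp add: top)
    moreover have "q \<in> {x \<in> carrier G. p \<otimes>\<^bsub>G\<^esub> (inv\<^bsub>G\<^esub> x \<otimes>\<^bsub>G\<^esub> q) \<in> U}"
      using p HG qG by simp
    moreover have "\<exists>h\<in>H. h \<in> V" if "openin t V" "q \<in> V" for V
      using q that by (auto simp: in_closure_of)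
    ultimately have "\<exists>h\<in>H. h \<in> {x \<in> carrier G. p \<otimes>\<^bsub>G\<^esub> (inv\<^bsub>G\<^esub> x \<otimes>\<^bsub>G\<^esub> q) \<in> U}" by meson
    then obtain h where h: "h \<in> H" "p \<otimes>\<^bsub>G\<^esub> (inv\<^bsub>G\<^esub> h \<otimes>\<^bsub>G\<^esub> q) \<in> U" by auto
    define a where "a = p \<otimes>\<^bsub>G\<^esub> inv\<^bsub>G\<^esub> h"
    have a: "a \<in> H" using p(2) h(1) H by (auto simp: a_def subgroup.m_closed subgroup.m_inv_closed)
    have aU: "a \<otimes>\<^bsub>G\<^esub> q \<in> U" using h p(2) HG qG by (simp add: a_def m_assoc)
    have "a \<otimes>\<^bsub>G\<^esub> q \<in> (\<lambda>x. a \<otimes>\<^bsub>G\<^esub> x) ` (t closure_of H)" using q by blast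
    also have "\<dots> \<subseteq> t closure_of ((\<lambda>x. a \<otimes>\<^bsub>G\<^esub> x) ` H)"
      by (rule continuous_map_image_closure_subset[OF topological_group_translation[OF t HG[OF a]]])
    also have "\<dots> \<subseteq> t closure_of H"
      using a H by (intro closure_of_mono) (auto simp: subgroup.m_closed)
    finally have "a \<otimes>\<^bsub>G\<^esub> q \<in> H" using aU clU by blast
    then have "inv\<^bsub>G\<^esub> a \<otimes>\<^bsub>G\<^esub> (a \<otimes>\<^bsub>G\<^esub> q) \<in> H"
      using a H by (auto simp: subgroup.m_closed subgroup.m_inv_closed)
    then show ?thesis using HG[OF a] qG by (simp add: m_assoc[symmetric])
  qed
  then show ?thesis using closure_of_subset_eq[of H t] HG top by blast
qed

section \<open>The monster model\<close>

lemma monster_countably_saturated: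
  fixes M :: "('f, 'p, 'm) fo_struct"
  assumes M: "monster L T M"
    and X: "\<And>k::nat. definable L M 1 (X k)" "\<And>k. X (Suc k) \<subseteq> X k" "\<And>k. X k \<noteq> {}"
  shows "\<exists>x. \<forall>k. x \<in> X k"
proof -
  obtain \<kappa> :: "'m rel" where \<kappa>: "Card_order \<kappa>" "|{\<phi>. wf_fm L \<phi>}| <o \<kappa>" "saturated L M \<kappa>"
    using M unfolding monster_def by blast
  have "\<forall>k. \<exists>\<phi> s. wf_fm L \<phi> \<and> range s \<subseteq> univ M \<and>
      X k = {x \<in> tuples M 1. sat M (\<lambda>i. if i < 1 then x i else s i) \<phi>}"
    using X(1) unfolding definable_def ..
  from choice[OF this] obtain \<phi> where "\<forall>k. \<exists>s. wf_fm L (\<phi> k) \<and> range s \<subseteq> univ M \<and>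
      X k = {x \<in> tuples M 1. sat M (\<lambda>i. if i < 1 then x i else s i) (\<phi> k)}" ..
  from choice[OF this] obtain s where \<phi>_s: "\<forall>k. wf_fm L (\<phi> k) \<and> range (s k) \<subseteq> univ M \<and>
      X k = {x \<in> tuples M 1. sat M (\<lambda>i. if i < 1 then x i else s k i) (\<phi> k)}" ..
  have \<phi>: "\<And>k. wf_fm L (\<phi> k)" "\<And>k. range (s k) \<subseteq> univ M"
    "\<And>k. X k = {x \<in> tuples M 1. sat M (\<lambda>i. if i < 1 then x i else s k i) (\<phi> k)}"
    using \<phi>_s by simp_all
  have eq: "(\<lambda>i. if i < 1 then x i else s k i) = (s k)(0 := x 0)" for x k by auto
  have mono: "X l \<subseteq> X k" if "k \<le> l" for k l
    using lift_Suc_antimono_le[of X] X(2) that by blast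
  define A where "A = (\<Union>k. range (s k))"
  define p where "p = range (\<lambda>k. (\<phi> k, s k))"
  have "countable A" unfolding A_def by auto
  then obtain f :: "'m \<Rightarrow> nat" where f: "inj_on f A" by (rule countableE)
  \<comment> \<open>The formulas equating a variable with itself exist in every language, so a
    countable parameter set is no larger than the set of formulas and falls below the saturation
    cardinal.\<close>
  have "inj_on (\<lambda>a. Equal (Var (f a)) (Var (f a)) :: ('f, 'p) fm) A"
    using f by (auto simp: inj_on_def)
  then have "|A| \<le>o |{\<phi>::('f, 'p) fm. wf_fm L \<phi>}|"
    by (intro card_of_ordLeq[THEN iffD1] exI conjI) auto
  then have A: "|A| <o \<kappa>" using \<kappa>(2) by (rule ordLeq_ordLess_trans)
  have fin: "\<exists>a\<in>univ M. \<forall>(\<phi>, s)\<in>q. sat M (s(0 := a)) \<phi>" if q: "q \<subseteq> p" "finite q" for q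
  proof -
    obtain I where I: "finite I" "q = (\<lambda>k. (\<phi> k, s k)) ` I"
      using finite_subset_image[OF q(2) q(1)[unfolded p_def]] by (elim exE conjE)
    \<comment> \<open>Finitely many conditions come from finitely many sets \<open>X k\<close>, and
      all of these contain some single \<open>X N\<close> because the sequence descends.\<close>
    obtain N where N: "\<And>k. k \<in> I \<Longrightarrow> k \<le> N" using I(1) finite_nat_set_iff_bounded_le by auto
    obtain x where x: "x \<in> X N" using X(3) by blast
    have "x 0 \<in> univ M" using x \<phi>(3) by (auto simp: tuples_iff)
    moreover have "sat M ((s k)(0 := x 0)) (\<phi> k)" if "k \<in> I" for k
      using mono[OF N[OF that]] x \<phi>(3)[of k] eq by auto
    ultimately show ?thesis using I(2) by auto
  qed
  have "\<exists>a\<in>univ M. \<forall>(\<phi>, s)\<in>p. sat M (s(0 := a)) \<phi>"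
  proof -
    have 1: "A \<subseteq> univ M" using \<phi>(2) by (auto simp: A_def)
    have 2: "\<forall>(\<phi>, s)\<in>p. wf_fm L \<phi> \<and> (\<forall>i\<in>fv \<phi> - {0}. s i \<in> A)"
      using \<phi>(1) by (auto simp: p_def A_def)
    show ?thesis
      by (rule \<kappa>(3)[unfolded saturated_def, THEN spec, THEN spec, of A p,
            THEN mp, OF 1, THEN mp, OF A, THEN mp, OF 2, THEN mp])
        (intro allI impI fin)
  qed
  then obtain a where a: "a \<in> univ M" "\<And>k. sat M ((s k)(0 := a)) (\<phi> k)" by (auto simp: p_def)
  have "tup 1 (\<lambda>_. a) \<in> X k" for k
    unfolding \<phi>(3) eq mem_Collect_eq using a by (simp add: tup_in_tuples_iff)
  then show ?thesis by blast
qed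

lemma t_minimal_structure_monster:
  assumes "t_minimal L T \<T>" "monster L T M" "nice L M (\<T> M)"
  shows "\<exists>K BX Y. t_minimal_structure L M (\<T> M) K BX Y"
proof -
  have model: "is_model L T M" using assms(2) by (simp add: monster_def)
  then have tm: "t_minimal_topology L M (\<T> M)" using assms(1) by (simp add: t_minimal_def)
  then obtain \<F> where \<F>: "definable_family L M 1 \<F>" "is_basis (\<T> M) ((\<lambda>F. (\<lambda>x. x 0) ` F) ` \<F>)"
    unfolding t_minimal_topology_def by blast
  obtain K BX Y where K: "definable L M (1 + K) BX" "definable L M K Y"
      "\<F> = (\<lambda>b. {x \<in> tuples M 1. cat 1 x b \<in> BX}) ` Y"
    using \<F>(1) unfolding definable_family_def by blast
  \<comment> \<open>The basis is given by definable sets of 1-tuples, whereas the topology lives on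
    elements; this identifies the two forms.\<close>
  have "(\<lambda>x. x 0) ` {x \<in> tuples M 1. cat 1 x b \<in> BX} = {a \<in> univ M. cat 1 (tup 1 (\<lambda>_. a)) b \<in> BX}" for b
  proof (intro equalityI subsetI)
    fix a assume "a \<in> (\<lambda>x. x 0) ` {x \<in> tuples M 1. cat 1 x b \<in> BX}"
    then obtain x where x: "x \<in> tuples M 1" "cat 1 x b \<in> BX" "a = x 0" by blast
    then have "tup 1 (\<lambda>_. a) = x" by (intro tuples_eqI[of _ M 1]) (auto simp: tup_in_tuples_iff tuples_iff)
    then show "a \<in> {a \<in> univ M. cat 1 (tup 1 (\<lambda>_. a)) b \<in> BX}" using x by (auto simp: tuples_iff)
  next
    fix a assume "a \<in> {a \<in> univ M. cat 1 (tup 1 (\<lambda>_. a)) b \<in> BX}"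
    then show "a \<in> (\<lambda>x. x 0) ` {x \<in> tuples M 1. cat 1 x b \<in> BX}"
      by (intro image_eqI[of _ _ "tup 1 (\<lambda>_. a)"]) (auto simp: tup_in_tuples_iff)
  qed
  then have "is_basis (\<T> M) ((\<lambda>b. {a \<in> univ M. cat 1 (tup 1 (\<lambda>_. a)) b \<in> BX}) ` Y)"
    using \<F>(2) by (simp add: K(3) image_image)
  then have "t_minimal_structure L M (\<T> M) K BX Y"
    using model tm K(1,2) assms(3) monster_countably_saturated[OF assms(2)]
    unfolding t_minimal_topology_def is_model_def is_struct_def
    by unfold_locales auto
  then show ?thesis by blast
qed

theorem theorem7p14:
  fixes L :: "('f, 'p) language"
    and T :: "('f, 'p) fm set"
    and \<T> :: "('f, 'p, 'm) fo_struct \<Rightarrow> 'm topology"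
    and \<MM> :: "('f, 'p, 'm) fo_struct"
    and G :: "(nat \<Rightarrow> 'm) monoid"
    and H :: "(nat \<Rightarrow> 'm) set"
    and t\<^sub>G t\<^sub>H :: "(nat \<Rightarrow> 'm) topology"
    and n :: nat
  assumes "t_minimal L T \<T>"
    and "monster L T \<MM>"
    and "nice L \<MM> (\<T> \<MM>)"
    and "definable_group L \<MM> n G"
    and "definable_subgroup L \<MM> n H G"
    and "canonical_topology L \<MM> (\<T> \<MM>) n G t\<^sub>G"
    and "canonical_topology L \<MM> (\<T> \<MM>) n (G\<lparr>carrier := H\<rparr>) t\<^sub>H"
  shows "closed_embedding t\<^sub>H t\<^sub>G (\<lambda>x. x)"
proof -
  obtain K BX Y where "t_minimal_structure L \<MM> (\<T> \<MM>) K BX Y"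
    using t_minimal_structure_monster[OF assms(1-3)] by blast
  then interpret t_minimal_structure L \<MM> "\<T> \<MM>" K BX Y .
  have H: "subgroup H G" "definable L \<MM> n H"
    using assms(5) by (auto simp: definable_subgroup_def)
  have mG: "definable_manifold L \<MM> (\<T> \<MM>) n (carrier G) t\<^sub>G" and tG: "topological_group G t\<^sub>G"
    using assms(6) by (auto simp: canonical_topology_def)
  have mH: "definable_manifold L \<MM> (\<T> \<MM>) n H t\<^sub>H" and tH: "topological_group (G\<lparr>carrier := H\<rparr>) t\<^sub>H"
    using assms(7) by (auto simp: canonical_topology_def)
  have G: "group G" and topG: "topspace t\<^sub>G = carrier G" and topH: "topspace t\<^sub>H = H"
    using tG tH by (auto simp: topological_group_def)
  have HG: "H \<subseteq> carrier G" and ne: "H \<noteq> {}"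
    using subgroup.subset[OF H(1)] subgroup.one_closed[OF H(1)] by auto
  \<comment> \<open>This allows \<open>H\<close> with its own topology to serve as the ambient
    manifold in \<open>identity_continuous_somewhere\<close>.\<close>
  have subH: "subtopology t\<^sub>H H = t\<^sub>H" using subtopology_topspace[of t\<^sub>H] by (simp add: topH)
  have topS: "topspace (subtopology t\<^sub>G H) = H" using HG by (auto simp: topG)
  have transG: "continuous_map t\<^sub>G t\<^sub>G (\<lambda>x. h \<otimes>\<^bsub>G\<^esub> x)" if "h \<in> H" for h
    using topological_group_translation[OF tG] that HG by blast
  have transH: "continuous_map t\<^sub>H t\<^sub>H (\<lambda>x. h \<otimes>\<^bsub>G\<^esub> x)" if "h \<in> H" for h
    using topological_group_translation[OF tH, of h] that by simp
  have transS: "continuous_map (subtopology t\<^sub>G H) (subtopology t\<^sub>G H) (\<lambda>x. h \<otimes>\<^bsub>G\<^esub> x)" if "h \<in> H" for h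
    using transG[OF that] subgroup.m_closed[OF H(1) that]
    by (intro continuous_map_into_subtopology continuous_map_from_subtopology) (auto simp: topS)
  have "continuous_map t\<^sub>H t\<^sub>G (\<lambda>x. x)"
  proof -
    obtain p where "p \<in> H" "\<forall>N. openin t\<^sub>G N \<longrightarrow> p \<in> N \<longrightarrow> (\<exists>N'. openin t\<^sub>H N' \<and> p \<in> N' \<and> N' \<subseteq> N)"
      using identity_continuous_somewhere[OF mH subset_refl mG HG H(2) ne] unfolding subH by blast
    then show ?thesis
      by (intro identity_continuous_everywhere[OF G H(1) topH transH _ transG]) (auto simp: topG HG)
  qed
  \<comment> \<open>The two manifolds exchange roles: now \<open>G\<close> induces the source
    topology, and the manifold on \<open>H\<close> is the target.\<close>
  moreover have "continuous_map (subtopology t\<^sub>G H) t\<^sub>H (\<lambda>x. x)"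
  proof -
    obtain p where "p \<in> H" "\<forall>N. openin t\<^sub>H N \<longrightarrow> p \<in> N \<longrightarrow>
        (\<exists>N'. openin (subtopology t\<^sub>G H) N' \<and> p \<in> N' \<and> N' \<subseteq> N)"
      using identity_continuous_somewhere[OF mG HG mH subset_refl H(2) ne] by blast
    then show ?thesis
      by (intro identity_continuous_everywhere[OF G H(1) topS transS _ transH]) (auto simp: topH)
  qed
  ultimately have "homeomorphic_maps t\<^sub>H (subtopology t\<^sub>G H) (\<lambda>x. x) (\<lambda>x. x)"
    by (simp add: homeomorphic_maps_def continuous_map_in_subtopology topH)
  then have "embedding_map t\<^sub>H t\<^sub>G (\<lambda>x. x)"
    unfolding embedding_map_def using homeomorphic_map_maps by (auto simp: topH)
  moreover obtain U where "openin t\<^sub>G U" "U \<inter> H \<noteq> {}" "closedin (subtopology t\<^sub>G U) (U \<inter> H)"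
    using open_parametrization(2)[OF mG H(2) HG ne] by blast
  then have "closedin t\<^sub>G H" by (rule locally_closed_subgroup_closed[OF tG H(1)])
  ultimately show ?thesis by (simp add: closed_embedding_def topH)
qed

end
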